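(* Let $\mathfrak{S}$ be the nonself-adjoint $2$-graph algebra on a Hilbert space $\mathcal{H}$ generated by a rigid isometric representation $(S,T)$ of a single vertex $2$-graph $\mathbb{F}_\theta^+$. Suppose that $\zeta_j$, $j\in\mathcal{J}$, are wandering vectors for $\mathfrak{S}$. Let $\mathcal{M}_j=\mathfrak{S}[\zeta_j]$ and suppose that $\mathcal{H}=\bigvee_{j\in\mathcal{J}}\mathcal{M}_j$. Then $\mathfrak{S}$ is analytic and completely isometrically isomorphic to $\mathcal{L}_\theta$.
   Context: Single vertex $2$-graph: for positive integers $m,n$ (with $m>1$ or $n>1$) and a permutation $\theta$ of $\{1,\ldots,m\}\times\{1,\ldots,n\}$, $\mathbb{F}_\theta^+$ is the unital cancellative semigroup generated by $e_1,\ldots,e_m,f_1,\ldots,f_n$, where the $e_i$ generate a copy of the free semigroup $\mathbb{F}_m^+$, the $f_j$ generate a copy of $\mathbb{F}_n^+$, and $e_if_j=f_{j'}e_{i'}$ whenever $\theta(i,j)=(i',j')$. Every $w\in\mathbb{F}_\theta^+$ is uniquely $w=e_uf_v$ with $u\in\mathbb{F}_m^+$, $v\in\mathbb{F}_n^+$. An isometric representation $(S,T)$ of $\mathbb{F}_\theta^+$ on $\mathcal{H}$ consists of $S=[S_1,\ldots,S_m]$ and $T=[T_1,\ldots,T_n]$ with $S_i^*S_j=\delta_{i,j}I$, $T_k^*T_l=\delta_{k,l}I$, and $S_iT_j=T_{j'}S_{i'}$ whenever $\theta(i,j)=(i',j')$. For $w=e_uf_v$, $(ST)_w=S_uT_v$.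 The nonself-adjoint $2$-graph algebra generated by $(S,T)$ is the unital WOT-closed algebra generated by all $S_i,T_j$. Left-regular representation: on $\ell^2(\mathbb{F}_\theta^+)$ with orthonormal basis $\{\xi_w\}$, $E_i\xi_w=\xi_{e_iw}$, $F_j\xi_w=\xi_{f_jw}$. $\mathcal{A}_\theta$ (resp. $\mathcal{L}_\theta$) is the norm-closed (resp. WOT-closed) unital algebra generated by the $E_i,F_j$. $(S,T)$ is rigid if $\overline{\mathrm{alg}}^{\|\cdot\|}\{I,S_1,\ldots,S_m,T_1,\ldots,T_n\}$ is completely isometrically isomorphic to $\mathcal{A}_\theta$ (via the canonical map matching generators). $\mathfrak{S}$ is analytic if it is completely isomorphic and weak$^*$-to-weak$^*$ homeomorphic to $\mathcal{L}_\theta$ (via the canonical map sending $S_i\mapsto E_i$, $T_j\mapsto F_j$). A unit vector $\zeta\in\mathcal{H}$ is wandering for $(S,T)$ and $\mathfrak{S}$ if $\langle(ST)_u\zeta,(ST)_w\zeta\rangle=\delta_{u,w}$ for all $u,w\in\mathbb{F}_\theta^+$. $\mathfrak{S}[\zeta]$ denotes the closed subspace $\overline{\mathfrak{S}\zeta}$. *)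

theory Defs
  imports "HOL-Analysis.Analysis"
begin

section \<open>Complex Hilbert spaces\<close>

text \<open>The inner product is linear in the first argument. Positive definiteness is not listed among
  the axioms because it follows from the last one.\<close>

class chilbert_space = banach +
  fixes scaleC :: "complex \<Rightarrow> 'a \<Rightarrow> 'a" (infixr "*\<^sub>C" 75)
    and cinner :: "'a \<Rightarrow> 'a \<Rightarrow> complex"
  assumes scaleC_add_right: "c *\<^sub>C (x + y) = c *\<^sub>C x + c *\<^sub>C y"
    and scaleC_add_left: "(c + d) *\<^sub>C x = c *\<^sub>C x + d *\<^sub>C x"
    and scaleC_scaleC: "c *\<^sub>C d *\<^sub>C x = (c * d) *\<^sub>C x"
    and scaleR_scaleC: "r *\<^sub>R x = complex_of_real r *\<^sub>C x"
    and cinner_commute: "cinner x y = cnj (cinner y x)"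
    and cinner_add_left: "cinner (x + y) z = cinner x z + cinner y z"
    and cinner_scaleC_left: "cinner (c *\<^sub>C x) y = c * cinner x y"
    and norm_eq_sqrt_cinner: "norm x = sqrt (Re (cinner x x))"

lemma scaleC_one [simp]:
  fixes x :: "'a::chilbert_space"
  shows "1 *\<^sub>C x = x"
  using scaleR_scaleC[of 1 x] by simp

lemma cinner_add_right:
  fixes x y z :: "'a::chilbert_space"
  shows "cinner x (y + z) = cinner x y + cinner x z"
  by (metis cinner_add_left cinner_commute complex_cnj_add)

lemma cinner_scaleC_right:
  fixes x y :: "'a::chilbert_space"
  shows "cinner x (c *\<^sub>C y) = cnj c * cinner x y"
  by (metis cinner_scaleC_left cinner_commute complex_cnj_mult)

lemma cinner_zero_left [simp]:
  fixes y :: "'a::chilbert_space"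
  shows "cinner 0 y = 0"
  using cinner_add_left[of 0 0 y] by simp

lemma cinner_zero_right [simp]:
  fixes y :: "'a::chilbert_space"
  shows "cinner y 0 = 0"
  using cinner_add_right[of y 0 0] by simp

lemma cinner_minus_left:
  fixes x y :: "'a::chilbert_space"
  shows "cinner (- x) y = - cinner x y"
  using cinner_add_left[of x "- x" y] by (simp add: eq_neg_iff_add_eq_0 add.commute)

lemma cinner_minus_right:
  fixes x y :: "'a::chilbert_space"
  shows "cinner x (- y) = - cinner x y"
  using cinner_add_right[of x y "- y"] by (simp add: eq_neg_iff_add_eq_0 add.commute)

lemma cinner_diff_left:
  fixes x y z :: "'a::chilbert_space"
  shows "cinner (x - y) z = cinner x z - cinner y z"
  using cinner_add_left[of x "- y" z] by (simp add: cinner_minus_left)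

lemma cinner_diff_right:
  fixes x y z :: "'a::chilbert_space"
  shows "cinner x (y - z) = cinner x y - cinner x z"
  using cinner_add_right[of x y "- z"] by (simp add: cinner_minus_right)

lemma cinner_self:
  fixes x :: "'a::chilbert_space"
  shows "cinner x x = complex_of_real ((norm x)\<^sup>2)"
proof -
  have "Im (cinner x x) = 0"
    using arg_cong[OF cinner_commute[of x x], of Im] by simp
  moreover have "sqrt (Re (cinner x x)) \<ge> 0"
    using norm_ge_zero[of x] by (simp add: norm_eq_sqrt_cinner)
  ultimately show ?thesis
    by (simp add: complex_eq_iff norm_eq_sqrt_cinner)
qed

lemma norm_scaleC:
  fixes x :: "'a::chilbert_space"
  shows "norm (c *\<^sub>C x) = cmod c * norm x"
proof -
  have "cinner (c *\<^sub>C x) (c *\<^sub>C x) = (c * cnj c) * cinner x x"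
    by (simp add: cinner_scaleC_left cinner_scaleC_right)
  also have "\<dots> = complex_of_real ((cmod c * norm x)\<^sup>2)"
    unfolding cinner_self complex_norm_square[symmetric] by (simp add: power_mult_distrib)
  finally show ?thesis
    by (simp add: norm_eq_sqrt_cinner[of "c *\<^sub>C x"])
qed

lemma norm_add_sq:
  fixes x y :: "'a::chilbert_space"
  shows "(norm (x + y))\<^sup>2 = (norm x)\<^sup>2 + 2 * Re (cinner x y) + (norm y)\<^sup>2"
proof -
  have "complex_of_real ((norm (x + y))\<^sup>2) = cinner x x + cinner x y + cinner y x + cinner y y"
    by (simp only: cinner_self[symmetric] cinner_add_left cinner_add_right ac_simps)
  moreover have "Re (cinner y x) = Re (cinner x y)"
    by (subst cinner_commute) simp
  ultimately have "Re (complex_of_real ((norm (x + y))\<^sup>2))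
      = Re (cinner x x) + 2 * Re (cinner x y) + Re (cinner y y)"
    by simp
  then show ?thesis by (simp add: cinner_self)
qed

lemma norm_projection_sq:
  fixes y :: "'a::chilbert_space"
  assumes "y \<noteq> 0"
  shows "(norm ((- (a / complex_of_real ((norm y)\<^sup>2))) *\<^sub>C y))\<^sup>2 = (cmod a)\<^sup>2 / (norm y)\<^sup>2"
proof -
  have "norm ((- (a / complex_of_real ((norm y)\<^sup>2))) *\<^sub>C y) = cmod a / (norm y)\<^sup>2 * norm y"
    unfolding norm_scaleC norm_minus_cancel norm_divide norm_of_real by simp
  also have "\<dots> = cmod a / norm y"
    using assms by (simp add: power2_eq_square)
  finally show ?thesis by (simp add: power_divide)
qed

lemma Cauchy_Schwarz_cinner:
  fixes x y :: "'a::chilbert_space"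
  shows "cmod (cinner x y) \<le> norm x * norm y"
proof (cases "y = 0")
  case True
  then show ?thesis by simp
next
  case False
  define c where "c = - (cinner x y / complex_of_real ((norm y)\<^sup>2))"
  have ny: "(norm y)\<^sup>2 > 0" using False by simp
  have "cinner x (c *\<^sub>C y) = - complex_of_real ((cmod (cinner x y))\<^sup>2 / (norm y)\<^sup>2)"
    by (simp add: cinner_scaleC_right c_def mult.commute complex_norm_square[symmetric]
        flip: of_real_power)
  then have 1: "Re (cinner x (c *\<^sub>C y)) = - ((cmod (cinner x y))\<^sup>2 / (norm y)\<^sup>2)"
    by simp
  have 2: "(norm (c *\<^sub>C y))\<^sup>2 = (cmod (cinner x y))\<^sup>2 / (norm y)\<^sup>2"
    unfolding c_def using False by (rule norm_projection_sq)
  have "0 \<le> (norm (x + c *\<^sub>C y))\<^sup>2" by simp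
  also have "\<dots> = (norm x)\<^sup>2 - (cmod (cinner x y))\<^sup>2 / (norm y)\<^sup>2"
    unfolding norm_add_sq 1 2 by simp
  finally have "(cmod (cinner x y))\<^sup>2 \<le> (norm x * norm y)\<^sup>2"
    using ny by (simp add: field_simps)
  then show ?thesis
    by (rule power2_le_imp_le) simp
qed

lemma cinner_ext: 
  fixes x y :: "'a::chilbert_space"
  assumes "\<And>z. cinner z x = cinner z y"
  shows "x = y"
proof -
  have "cinner (x - y) (x - y) = 0"
    using assms by (simp add: cinner_diff_right)
  then show ?thesis by (simp add: cinner_self)
qed

text \<open>Bounded operators are the complex linear elements of \<^typ>\<open>'a \<Rightarrow>\<^sub>L 'b\<close>, the type of bounded real
  linear maps; its norm is the operator norm.\<close>

definition clinear_op :: "('a::chilbert_space \<Rightarrow>\<^sub>L 'b::chilbert_space) \<Rightarrow> bool" where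
  "clinear_op A \<longleftrightarrow> (\<forall>c x. blinfun_apply A (c *\<^sub>C x) = c *\<^sub>C blinfun_apply A x)"

lift_definition scaleC_op ::
  "complex \<Rightarrow> ('a::real_normed_vector \<Rightarrow>\<^sub>L 'b::chilbert_space) \<Rightarrow> ('a \<Rightarrow>\<^sub>L 'b)" (infixr "*\<^sub>O" 75)
  is "\<lambda>c A x. c *\<^sub>C A x"
proof -
  fix c :: complex and A :: "'a \<Rightarrow> 'b"
  assume "bounded_linear A"
  moreover have "bounded_linear (\<lambda>x :: 'b. c *\<^sub>C x)"
    by (rule bounded_linear_intro[where K = "cmod c"])
      (simp_all add: scaleC_add_right scaleR_scaleC scaleC_scaleC norm_scaleC mult.commute)
  ultimately show "bounded_linear (\<lambda>x. c *\<^sub>C A x)"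
    using bounded_linear_compose by blast
qed

definition adj :: "('a::chilbert_space \<Rightarrow>\<^sub>L 'b::chilbert_space) \<Rightarrow> ('b \<Rightarrow>\<^sub>L 'a)" where
  "adj A = (THE B. \<forall>x y. cinner (blinfun_apply A x) y = cinner x (blinfun_apply B y))"

text \<open>For \<^const>\<open>clinear_op\<close> the description in \<^const>\<open>adj\<close> does denote an operator, by the Riesz
  representation theorem.\<close>

lemma Riesz_representation:
  fixes f :: "'a::chilbert_space \<Rightarrow> complex"
  assumes add: "\<And>x y. f (x + y) = f x + f y" and sc: "\<And>c x. f (c *\<^sub>C x) = c * f x"
    and bd: "\<And>x. cmod (f x) \<le> K * norm x"
  shows "\<exists>y. \<forall>x. f x = cinner x y"
proof (cases "\<forall>x. f x = 0")
  case True
  then show ?thesis by (intro exI[of _ 0]) simp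
next
  case False
  then obtain x0 where x0: "f x0 \<noteq> 0" by blast
  define N where "N = {x. f x = 1}"
  have "f (inverse (f x0) *\<^sub>C x0) = 1" using x0 by (simp add: sc)
  then have Nne: "N \<noteq> {}" by (auto simp: N_def)
  define d where "d = (INF x\<in>N. (norm x)\<^sup>2)"
  have bddb: "bdd_below ((\<lambda>x. (norm x)\<^sup>2) ` N)" by (intro bdd_belowI[of _ 0]) auto
  have d_le: "d \<le> (norm x)\<^sup>2" if "x \<in> N" for x
    unfolding d_def using bddb that by (rule cINF_lower)
  have f_lin: "linear f"
    by (rule linearI) (simp_all add: add scaleR_scaleC sc scaleR_conv_of_real)
  have f_diff: "f (x - y) = f x - f y" for x y
    using linear_diff[OF f_lin] .
  have "\<exists>x\<in>N. (norm x)\<^sup>2 < d + inverse (real (Suc n))" for n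
  proof -
    have "d < d + inverse (real (Suc n))" by simp
    then show ?thesis
      unfolding d_def using cINF_less_iff[OF Nne bddb] by blast
  qed
  then obtain X where XN: "\<And>n. X n \<in> N" and Xd: "\<And>n. (norm (X n))\<^sup>2 < d + inverse (real (Suc n))"
    by metis
  have par: "(norm (x - y))\<^sup>2 \<le> 2 * (norm x)\<^sup>2 + 2 * (norm y)\<^sup>2 - 4 * d" if "x \<in> N" "y \<in> N" for x y
  proof -
    have "f ((1/2) *\<^sub>C (x + y)) = 1" using that by (simp add: sc add N_def)
    then have "d \<le> (norm ((1/2) *\<^sub>C (x + y)))\<^sup>2" by (intro d_le) (simp add: N_def)
    then have "4 * d \<le> (norm (x + y))\<^sup>2" by (simp add: norm_scaleC power_divide norm_divide)
    moreover have "(norm (x + y))\<^sup>2 + (norm (x - y))\<^sup>2 = 2 * (norm x)\<^sup>2 + 2 * (norm y)\<^sup>2"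
      using norm_add_sq[of x y] norm_add_sq[of x "- y"] by (simp add: cinner_minus_right)
    ultimately show ?thesis by linarith
  qed
  have "Cauchy X"
  proof (rule metric_CauchyI)
    fix e :: real assume e: "0 < e"
    then obtain M where M: "inverse (real (Suc M)) < e\<^sup>2 / 4"
      using reals_Archimedean[of "e\<^sup>2 / 4"] by auto
    show "\<exists>M. \<forall>m\<ge>M. \<forall>n\<ge>M. dist (X m) (X n) < e"
    proof (intro exI[of _ M] allI impI)
      fix m n assume mn: "M \<le> m" "M \<le> n"
      have i: "inverse (real (Suc k)) \<le> inverse (real (Suc M))" if "M \<le> k" for k
        using that by (intro le_imp_inverse_le) auto
      have "(norm (X m - X n))\<^sup>2 < e\<^sup>2"
        using par[OF XN XN, of m n] Xd[of m] Xd[of n] i[OF mn(1)] i[OF mn(2)] M by linarith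
      then show "dist (X m) (X n) < e"
        using e by (metis dist_norm less_le power2_less_imp_less)
    qed
  qed
  then obtain z where z: "X \<longlonglongrightarrow> z" by (meson Cauchy_convergent convergent_def)
  have f_bl: "bounded_linear f"
    by (rule bounded_linear_intro[where K = K])
      (simp_all add: add scaleR_scaleC sc scaleR_conv_of_real bd mult.commute)
  have "(\<lambda>n. f (X n)) \<longlonglongrightarrow> f z" by (rule bounded_linear.tendsto[OF f_bl z])
  moreover have "(\<lambda>n. f (X n)) = (\<lambda>n. 1)" using XN by (auto simp: N_def)
  ultimately have fz: "f z = 1" by (simp add: LIMSEQ_const_iff)
  have "(\<lambda>n. (norm (X n))\<^sup>2) \<longlonglongrightarrow> (norm z)\<^sup>2" by (intro tendsto_intros z)
  moreover have "(\<lambda>n. d + inverse (real (Suc n))) \<longlonglongrightarrow> d + 0"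
    by (intro tendsto_intros LIMSEQ_inverse_real_of_nat)
  ultimately have nz: "(norm z)\<^sup>2 \<le> d"
    using LIMSEQ_le[of "\<lambda>n. (norm (X n))\<^sup>2" "(norm z)\<^sup>2" "\<lambda>n. d + inverse (real (Suc n))" "d + 0"]
      less_imp_le[OF Xd] by simp
  have orth: "cinner v z = 0" if v: "f v = 0" for v
  proof (cases "v = 0")
    case True
    then show ?thesis by simp
  next
    case False
    define c where "c = - (cnj (cinner v z) / complex_of_real ((norm v)\<^sup>2))"
    have "f (z + c *\<^sub>C v) = 1" using v fz by (simp add: add sc)
    then have "z + c *\<^sub>C v \<in> N" by (simp add: N_def)
    then have "(norm z)\<^sup>2 \<le> (norm (z + c *\<^sub>C v))\<^sup>2"
      using d_le nz by (blast intro: order_trans)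
    moreover have "cinner z v = cnj (cinner v z)" by (rule cinner_commute)
    then have "cinner z (c *\<^sub>C v) = - complex_of_real ((cmod (cinner v z))\<^sup>2 / (norm v)\<^sup>2)"
      by (simp add: cinner_scaleC_right c_def complex_norm_square[symmetric] flip: of_real_power)
    then have "Re (cinner z (c *\<^sub>C v)) = - ((cmod (cinner v z))\<^sup>2 / (norm v)\<^sup>2)" by simp
    moreover have "(norm (c *\<^sub>C v))\<^sup>2 = (cmod (cinner v z))\<^sup>2 / (norm v)\<^sup>2"
      unfolding c_def using False norm_projection_sq[of v "cnj (cinner v z)"] by simp
    ultimately have "(cmod (cinner v z))\<^sup>2 / (norm v)\<^sup>2 \<le> 0"
      unfolding norm_add_sq by simp
    then show ?thesis using False by (simp add: divide_le_0_iff)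
  qed
  have zne: "z \<noteq> 0" using fz linear_0[OF f_lin] by auto
  show ?thesis
  proof (intro exI[of _ "complex_of_real (inverse ((norm z)\<^sup>2)) *\<^sub>C z"] allI)
    fix x
    have "cinner (x - f x *\<^sub>C z) z = 0" by (rule orth) (simp add: f_diff sc fz)
    then have "cinner x z = f x * complex_of_real ((norm z)\<^sup>2)"
      by (simp add: cinner_diff_left cinner_scaleC_left cinner_self)
    then show "f x = cinner x (complex_of_real (inverse ((norm z)\<^sup>2)) *\<^sub>C z)"
      using zne by (simp add: cinner_scaleC_right)
  qed
qed

lemma adj_unique:
  assumes "\<And>x y. cinner (blinfun_apply A x) y = cinner x (blinfun_apply B y)"
  shows "adj A = B"
  unfolding adj_def
proof (rule the_equality)
  show "\<forall>x y. cinner (blinfun_apply A x) y = cinner x (blinfun_apply B y)" using assms by blast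
  fix C assume "\<forall>x y. cinner (blinfun_apply A x) y = cinner x (blinfun_apply C y)"
  then show "C = B"
    using assms by (intro blinfun_eqI cinner_ext) metis
qed

lemma cinner_adj:
  assumes A: "clinear_op A"
  shows "cinner (blinfun_apply A x) y = cinner x (blinfun_apply (adj A) y)"
proof -
  have "\<exists>z. \<forall>x. cinner (blinfun_apply A x) y = cinner x z" for y
  proof (rule Riesz_representation[where K = "norm A * norm y"])
    fix x
    have "cmod (cinner (blinfun_apply A x) y) \<le> norm (blinfun_apply A x) * norm y"
      by (rule Cauchy_Schwarz_cinner)
    also have "\<dots> \<le> (norm A * norm x) * norm y"
      by (intro mult_right_mono norm_blinfun) simp
    finally show "cmod (cinner (blinfun_apply A x) y) \<le> norm A * norm y * norm x"
      by (simp add: ac_simps)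
  qed (use A in \<open>simp_all add: blinfun.add_right cinner_add_left cinner_scaleC_left clinear_op_def\<close>)
  then obtain B where B: "\<And>x y. cinner (blinfun_apply A x) y = cinner x (B y)"
    by metis
  have "bounded_linear B"
  proof (rule bounded_linear_intro[where K = "norm A"])
    fix x y
    show "B (x + y) = B x + B y"
      by (rule cinner_ext) (simp add: B[symmetric] cinner_add_right)
    fix r :: real
    show "B (r *\<^sub>R x) = r *\<^sub>R B x"
      by (rule cinner_ext) (simp add: B[symmetric] cinner_scaleC_right scaleR_scaleC)
    have "(norm (B x))\<^sup>2 = cmod (cinner (B x) (B x))" by (simp add: cinner_self norm_power)
    also have "\<dots> = cmod (cinner (blinfun_apply A (B x)) x)" by (simp add: B)
    also have "\<dots> \<le> norm (blinfun_apply A (B x)) * norm x" by (rule Cauchy_Schwarz_cinner)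
    also have "\<dots> \<le> (norm A * norm (B x)) * norm x"
      by (intro mult_right_mono norm_blinfun) simp
    finally have "norm (B x) * norm (B x) \<le> norm (B x) * (norm x * norm A)"
      by (simp add: power2_eq_square ac_simps)
    then show "norm (B x) \<le> norm x * norm A"
      by (cases "norm (B x) = 0") (simp_all add: mult_le_cancel_left)
  qed
  then have "blinfun_apply (Blinfun B) = B" by (rule bounded_linear_Blinfun_apply)
  then have "adj A = Blinfun B" "blinfun_apply (Blinfun B) = B"
    using B by (auto intro!: adj_unique)
  then show ?thesis using B by simp
qed


section \<open>The Hilbert space of square summable families\<close>

typedef 'i ell2 = "{x :: 'i \<Rightarrow> complex. (\<lambda>i. (cmod (x i))\<^sup>2) summable_on UNIV}"
  morphisms ell2_coord Abs_ell2
  by (intro exI[of _ "\<lambda>_. 0"]) simp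

setup_lifting type_definition_ell2

lemma ell2_sq_add:
  fixes x y :: "'i \<Rightarrow> complex"
  assumes "(\<lambda>i. (cmod (x i))\<^sup>2) summable_on UNIV" "(\<lambda>i. (cmod (y i))\<^sup>2) summable_on UNIV"
  shows "(\<lambda>i. (cmod (x i + y i))\<^sup>2) summable_on UNIV"
proof (rule summable_on_comparison_test)
  show "(\<lambda>i. 2 * (cmod (x i))\<^sup>2 + 2 * (cmod (y i))\<^sup>2) summable_on UNIV"
    by (intro summable_on_add summable_on_cmult_right assms)
  fix i
  have "(cmod (x i + y i))\<^sup>2 \<le> (cmod (x i) + cmod (y i))\<^sup>2"
    by (intro power_mono norm_triangle_ineq) simp
  also have "\<dots> \<le> 2 * (cmod (x i))\<^sup>2 + 2 * (cmod (y i))\<^sup>2"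
    using zero_le_power2[of "cmod (x i) - cmod (y i)"] by (simp add: power2_sum power2_diff)
  finally show "(cmod (x i + y i))\<^sup>2 \<le> 2 * (cmod (x i))\<^sup>2 + 2 * (cmod (y i))\<^sup>2" .
qed simp

lemma ell2_sq_scale:
  fixes x :: "'i \<Rightarrow> complex"
  assumes "(\<lambda>i. (cmod (x i))\<^sup>2) summable_on UNIV"
  shows "(\<lambda>i. (cmod (c * x i))\<^sup>2) summable_on UNIV"
  using assms by (simp add: norm_mult power_mult_distrib summable_on_cmult_right)

lemma ell2_sq_iff:
  fixes x :: "'i \<Rightarrow> complex"
  shows "(\<lambda>i. (cmod (x i))\<^sup>2) summable_on UNIV \<longleftrightarrow> (\<exists>B. \<forall>F. finite F \<longrightarrow> (\<Sum>i\<in>F. (cmod (x i))\<^sup>2) \<le> B)"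
proof
  assume "(\<lambda>i. (cmod (x i))\<^sup>2) summable_on UNIV"
  then have "\<forall>F. finite F \<longrightarrow> (\<Sum>i\<in>F. (cmod (x i))\<^sup>2) \<le> (\<Sum>\<^sub>\<infinity>i. (cmod (x i))\<^sup>2)"
    by (intro allI impI finite_sum_le_infsum) auto
  then show "\<exists>B. \<forall>F. finite F \<longrightarrow> (\<Sum>i\<in>F. (cmod (x i))\<^sup>2) \<le> B" by blast
next
  assume "\<exists>B. \<forall>F. finite F \<longrightarrow> (\<Sum>i\<in>F. (cmod (x i))\<^sup>2) \<le> B"
  then show "(\<lambda>i. (cmod (x i))\<^sup>2) summable_on UNIV"
    by (intro nonneg_bdd_above_summable_on) (auto simp: bdd_above_def)
qed

lemma ell2_cinner_summable:
  fixes x y :: "'i \<Rightarrow> complex"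
  assumes "(\<lambda>i. (cmod (x i))\<^sup>2) summable_on UNIV" "(\<lambda>i. (cmod (y i))\<^sup>2) summable_on UNIV"
  shows "(\<lambda>i. x i * cnj (y i)) summable_on UNIV"
proof (rule abs_summable_summable, rule summable_on_comparison_test)
  show "(\<lambda>i. (cmod (x i))\<^sup>2 + (cmod (y i))\<^sup>2) summable_on UNIV"
    by (intro summable_on_add assms)
  fix i
  show "norm (x i * cnj (y i)) \<le> (cmod (x i))\<^sup>2 + (cmod (y i))\<^sup>2"
    using zero_le_power2[of "cmod (x i) - cmod (y i)"] zero_le_power2[of "cmod (x i)"]
      zero_le_power2[of "cmod (y i)"]
    unfolding power2_diff norm_mult complex_mod_cnj by linarith
qed simp

instantiation ell2 :: (type) real_vector
begin
lift_definition zero_ell2 :: "'a ell2" is "\<lambda>_. 0" by simp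
lift_definition plus_ell2 :: "'a ell2 \<Rightarrow> 'a ell2 \<Rightarrow> 'a ell2" is "\<lambda>x y i. x i + y i"
  by (rule ell2_sq_add)
lift_definition uminus_ell2 :: "'a ell2 \<Rightarrow> 'a ell2" is "\<lambda>x i. - x i" by simp
lift_definition minus_ell2 :: "'a ell2 \<Rightarrow> 'a ell2 \<Rightarrow> 'a ell2" is "\<lambda>x y i. x i - y i"
proof -
  fix x y :: "'a \<Rightarrow> complex"
  assume "(\<lambda>i. (cmod (x i))\<^sup>2) summable_on UNIV" "(\<lambda>i. (cmod (y i))\<^sup>2) summable_on UNIV"
  then show "(\<lambda>i. (cmod (x i - y i))\<^sup>2) summable_on UNIV"
    using ell2_sq_add[of x "\<lambda>i. - y i"] by simp
qed
lift_definition scaleR_ell2 :: "real \<Rightarrow> 'a ell2 \<Rightarrow> 'a ell2" is "\<lambda>r x i. complex_of_real r * x i"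
  by (rule ell2_sq_scale)
instance
  by standard (transfer; force simp: algebra_simps)+
end

lemma norm_ell2_triangle:
  fixes x y :: "'i \<Rightarrow> complex"
  assumes x: "(\<lambda>i. (cmod (x i))\<^sup>2) summable_on UNIV" and y: "(\<lambda>i. (cmod (y i))\<^sup>2) summable_on UNIV"
  shows "sqrt (\<Sum>\<^sub>\<infinity>i. (cmod (x i + y i))\<^sup>2) \<le> sqrt (\<Sum>\<^sub>\<infinity>i. (cmod (x i))\<^sup>2) + sqrt (\<Sum>\<^sub>\<infinity>i. (cmod (y i))\<^sup>2)"
proof (rule real_le_lsqrt)
  let ?a = "sqrt (\<Sum>\<^sub>\<infinity>i. (cmod (x i))\<^sup>2)" and ?b = "sqrt (\<Sum>\<^sub>\<infinity>i. (cmod (y i))\<^sup>2)"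
  have nn: "0 \<le> ?a" "0 \<le> ?b" by (simp_all add: infsum_nonneg)
  then show "0 \<le> ?a + ?b" by simp
  show "(\<Sum>\<^sub>\<infinity>i. (cmod (x i + y i))\<^sup>2) \<le> (?a + ?b)\<^sup>2"
  proof (rule infsum_le_finite_sums)
    show "(\<lambda>i. (cmod (x i + y i))\<^sup>2) summable_on UNIV" using x y by (rule ell2_sq_add)
    fix F :: "'i set" assume F: "finite F"
    have "L2_set (\<lambda>i. cmod (x i + y i)) F \<le> L2_set (\<lambda>i. cmod (x i) + cmod (y i)) F"
      by (rule L2_set_mono) (auto intro: norm_triangle_ineq)
    also have "\<dots> \<le> L2_set (\<lambda>i. cmod (x i)) F + L2_set (\<lambda>i. cmod (y i)) F"
      by (rule L2_set_triangle_ineq)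
    also have "\<dots> \<le> ?a + ?b"
      unfolding L2_set_def using F x y
      by (intro add_mono real_sqrt_le_mono finite_sum_le_infsum) auto
    finally have "(L2_set (\<lambda>i. cmod (x i + y i)) F)\<^sup>2 \<le> (?a + ?b)\<^sup>2"
      by (intro power_mono) auto
    then show "(\<Sum>i\<in>F. (cmod (x i + y i))\<^sup>2) \<le> (?a + ?b)\<^sup>2"
      by (simp add: L2_set_def sum_nonneg)
  qed
qed

instantiation ell2 :: (type) real_normed_vector
begin
lift_definition norm_ell2 :: "'a ell2 \<Rightarrow> real" is "\<lambda>x. sqrt (\<Sum>\<^sub>\<infinity>i. (cmod (x i))\<^sup>2)" .
definition dist_ell2 :: "'a ell2 \<Rightarrow> 'a ell2 \<Rightarrow> real" where "dist_ell2 x y = norm (x - y)"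
definition sgn_ell2 :: "'a ell2 \<Rightarrow> 'a ell2" where "sgn_ell2 x = x /\<^sub>R norm x"
definition uniformity_ell2 :: "('a ell2 \<times> 'a ell2) filter" where
  "uniformity_ell2 = (INF e\<in>{0<..}. principal {(x, y). dist x y < e})"
definition open_ell2 :: "'a ell2 set \<Rightarrow> bool" where
  "open_ell2 U = (\<forall>x\<in>U. \<forall>\<^sub>F (x', y) in uniformity. x' = x \<longrightarrow> y \<in> U)"
instance
proof
  fix x y :: "'a ell2" and r :: real
  show "(norm x = 0) = (x = 0)"
  proof transfer
    fix x :: "'a \<Rightarrow> complex"
    assume x: "(\<lambda>i. (cmod (x i))\<^sup>2) summable_on UNIV"
    show "(sqrt (\<Sum>\<^sub>\<infinity>i. (cmod (x i))\<^sup>2) = 0) = (x = (\<lambda>_. 0))"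
    proof
      assume "sqrt (\<Sum>\<^sub>\<infinity>i. (cmod (x i))\<^sup>2) = 0"
      then have "(\<Sum>\<^sub>\<infinity>i. (cmod (x i))\<^sup>2) \<le> 0" by simp
      then have "(cmod (x i))\<^sup>2 = 0" for i
        using x by (rule nonneg_infsum_le_0D) simp_all
      then show "x = (\<lambda>_. 0)" by auto
    qed simp
  qed
  show "norm (x + y) \<le> norm x + norm y"
    by transfer (rule norm_ell2_triangle)
  show "norm (r *\<^sub>R x) = \<bar>r\<bar> * norm x"
  proof transfer
    fix r :: real and x :: "'a \<Rightarrow> complex"
    have "(\<Sum>\<^sub>\<infinity>i. (cmod (complex_of_real r * x i))\<^sup>2) = (\<Sum>\<^sub>\<infinity>i. r\<^sup>2 * (cmod (x i))\<^sup>2)"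
      by (simp add: norm_mult power_mult_distrib)
    also have "\<dots> = r\<^sup>2 * (\<Sum>\<^sub>\<infinity>i. (cmod (x i))\<^sup>2)"
      by (rule infsum_cmult_right')
    finally show "sqrt (\<Sum>\<^sub>\<infinity>i. (cmod (complex_of_real r * x i))\<^sup>2)
        = \<bar>r\<bar> * sqrt (\<Sum>\<^sub>\<infinity>i. (cmod (x i))\<^sup>2)"
      by (simp add: real_sqrt_mult)
  qed
qed (simp_all add: dist_ell2_def sgn_ell2_def uniformity_ell2_def open_ell2_def)
end

lemma ell2_coord_norm_le: "cmod (ell2_coord x i) \<le> norm x"
proof -
  have "(\<Sum>i\<in>{i}. (cmod (ell2_coord x i))\<^sup>2) \<le> (\<Sum>\<^sub>\<infinity>i. (cmod (ell2_coord x i))\<^sup>2)"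
    using ell2_coord[of x] by (intro finite_sum_le_infsum) auto
  then show ?thesis
    by (simp add: norm_ell2.rep_eq real_le_rsqrt)
qed

instance ell2 :: (type) banach
proof
  fix X :: "nat \<Rightarrow> 'a ell2"
  assume X: "Cauchy X"
  have "Cauchy (\<lambda>n. ell2_coord (X n) i)" for i
  proof (rule metric_CauchyI)
    fix e :: real assume "0 < e"
    then obtain M where "\<forall>m\<ge>M. \<forall>n\<ge>M. dist (X m) (X n) < e" using metric_CauchyD[OF X] by blast
    moreover have "dist (ell2_coord (X m) i) (ell2_coord (X n) i) \<le> dist (X m) (X n)" for m n
      using ell2_coord_norm_le[of "X m - X n" i] by (simp add: dist_norm minus_ell2.rep_eq)
    ultimately show "\<exists>M. \<forall>m\<ge>M. \<forall>n\<ge>M. dist (ell2_coord (X m) i) (ell2_coord (X n) i) < e"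
      by (meson le_less_trans)
  qed
  then have "\<exists>l. (\<lambda>n. ell2_coord (X n) i) \<longlonglongrightarrow> l" for i
    using Cauchy_convergent convergent_def by blast
  then obtain l where l: "\<And>i. (\<lambda>n. ell2_coord (X n) i) \<longlonglongrightarrow> l i" by metis
  have fin: "\<exists>M. \<forall>m\<ge>M. \<forall>F. finite F \<longrightarrow> (\<Sum>i\<in>F. (cmod (ell2_coord (X m) i - l i))\<^sup>2) \<le> e\<^sup>2"
    if e: "0 < e" for e
  proof -
    obtain M where M: "\<forall>m\<ge>M. \<forall>n\<ge>M. dist (X m) (X n) < e" using metric_CauchyD[OF X e] by blast
    show ?thesis
    proof (intro exI[of _ M] allI impI)
      fix m and F :: "'a set" assume m: "M \<le> m" and F: "finite F"
      have lim: "(\<lambda>n. \<Sum>i\<in>F. (cmod (ell2_coord (X m) i - ell2_coord (X n) i))\<^sup>2)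
          \<longlonglongrightarrow> (\<Sum>i\<in>F. (cmod (ell2_coord (X m) i - l i))\<^sup>2)"
        by (intro tendsto_intros l)
      have "(\<Sum>i\<in>F. (cmod (ell2_coord (X m) i - ell2_coord (X n) i))\<^sup>2) \<le> e\<^sup>2" if n: "M \<le> n" for n
      proof -
        have "(\<Sum>i\<in>F. (cmod (ell2_coord (X m - X n) i))\<^sup>2)
            \<le> (\<Sum>\<^sub>\<infinity>i. (cmod (ell2_coord (X m - X n) i))\<^sup>2)"
          using ell2_coord[of "X m - X n"] F by (intro finite_sum_le_infsum) auto
        also have "\<dots> = (norm (X m - X n))\<^sup>2"
          by (simp add: norm_ell2.rep_eq infsum_nonneg)
        also have "\<dots> \<le> e\<^sup>2"
          using M m n by (intro power_mono) (auto simp: dist_norm less_imp_le)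
        finally show ?thesis by (simp add: minus_ell2.rep_eq)
      qed
      then show "(\<Sum>i\<in>F. (cmod (ell2_coord (X m) i - l i))\<^sup>2) \<le> e\<^sup>2"
        by (intro LIMSEQ_le_const2[OF lim]) blast
    qed
  qed
  obtain M1 where M1: "\<forall>F. finite F \<longrightarrow> (\<Sum>i\<in>F. (cmod (ell2_coord (X M1) i - l i))\<^sup>2) \<le> 1\<^sup>2"
    using fin[of 1] by auto
  have "(\<lambda>i. (cmod (ell2_coord (X M1) i - l i))\<^sup>2) summable_on UNIV"
    unfolding ell2_sq_iff using M1 by blast
  then have "(\<lambda>i. (cmod (ell2_coord (X M1) i + - (ell2_coord (X M1) i - l i)))\<^sup>2) summable_on UNIV"
    using ell2_coord[of "X M1"] by (intro ell2_sq_add) (simp_all add: norm_minus_commute)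
  then have ls: "(\<lambda>i. (cmod (l i))\<^sup>2) summable_on UNIV" by simp
  then have coordL: "ell2_coord (Abs_ell2 l) = l" by (simp add: Abs_ell2_inverse)
  have "X \<longlonglongrightarrow> Abs_ell2 l"
  proof (rule metric_LIMSEQ_I)
    fix e :: real assume e: "0 < e"
    then obtain M where
      M: "\<forall>m\<ge>M. \<forall>F. finite F \<longrightarrow> (\<Sum>i\<in>F. (cmod (ell2_coord (X m) i - l i))\<^sup>2) \<le> (e/2)\<^sup>2"
      using fin[of "e/2"] by auto
    show "\<exists>no. \<forall>n\<ge>no. dist (X n) (Abs_ell2 l) < e"
    proof (intro exI[of _ M] allI impI)
      fix n assume "M \<le> n"
      then have "(\<Sum>\<^sub>\<infinity>i. (cmod (ell2_coord (X n - Abs_ell2 l) i))\<^sup>2) \<le> (e/2)\<^sup>2"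
        using M ell2_coord[of "X n - Abs_ell2 l"]
        by (intro infsum_le_finite_sums) (auto simp: minus_ell2.rep_eq coordL)
      then have "norm (X n - Abs_ell2 l) \<le> e/2"
        unfolding norm_ell2.rep_eq using e by (intro real_le_lsqrt) auto
      then show "dist (X n) (Abs_ell2 l) < e" using e by (simp add: dist_norm)
    qed
  qed
  then show "convergent X" by (auto simp: convergent_def)
qed

instantiation ell2 :: (type) chilbert_space
begin
lift_definition scaleC_ell2 :: "complex \<Rightarrow> 'a ell2 \<Rightarrow> 'a ell2" is "\<lambda>c x i. c * x i"
  by (rule ell2_sq_scale)
lift_definition cinner_ell2 :: "'a ell2 \<Rightarrow> 'a ell2 \<Rightarrow> complex" is "\<lambda>x y. \<Sum>\<^sub>\<infinity>i. x i * cnj (y i)" .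
instance
proof
  fix x y z :: "'a ell2" and c d :: complex and r :: real
  show "c *\<^sub>C (x + y) = c *\<^sub>C x + c *\<^sub>C y" by transfer (simp add: algebra_simps)
  show "(c + d) *\<^sub>C x = c *\<^sub>C x + d *\<^sub>C x" by transfer (simp add: algebra_simps)
  show "c *\<^sub>C d *\<^sub>C x = (c * d) *\<^sub>C x" by transfer (simp add: algebra_simps)
  show "r *\<^sub>R x = complex_of_real r *\<^sub>C x" by transfer simp
  show "cinner x y = cnj (cinner y x)"
    by transfer (simp add: infsum_cnj[symmetric] mult.commute del: infsum_cnj)
  show "cinner (x + y) z = cinner x z + cinner y z"
    by transfer (simp add: distrib_right infsum_add ell2_cinner_summable)
  show "cinner (c *\<^sub>C x) y = c * cinner x y"
    by transfer (simp add: infsum_cmult_right' mult.assoc)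
  show "norm x = sqrt (Re (cinner x x))"
  proof transfer
    fix x :: "'a \<Rightarrow> complex"
    assume x: "(\<lambda>i. (cmod (x i))\<^sup>2) summable_on UNIV"
    have "Re (\<Sum>\<^sub>\<infinity>i. x i * cnj (x i)) = (\<Sum>\<^sub>\<infinity>i. Re (x i * cnj (x i)))"
      using ell2_cinner_summable[OF x x] by (rule infsum_Re[symmetric])
    also have "\<dots> = (\<Sum>\<^sub>\<infinity>i. (cmod (x i))\<^sup>2)"
      by (simp only: complex_norm_square[symmetric] Re_complex_of_real)
    finally show "sqrt (\<Sum>\<^sub>\<infinity>i. (cmod (x i))\<^sup>2) = sqrt (Re (\<Sum>\<^sub>\<infinity>i. x i * cnj (x i)))"
      by simp
  qed
qed
end

lift_definition ket :: "'i \<Rightarrow> 'i ell2" is "\<lambda>w i. if i = w then 1 else 0"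
proof -
  fix w :: 'i
  have "(\<lambda>i. (cmod (if i = w then 1 else 0))\<^sup>2) summable_on {w}" by simp
  then show "(\<lambda>i. (cmod (if i = w then 1 else 0))\<^sup>2) summable_on UNIV"
    by (rule summable_on_cong_neutral[THEN iffD1, rotated -1]) auto
qed

text \<open>Meant for injective \<open>g\<close>, where it is the isometry sending the basis vector of \<open>w\<close> to
  that of \<open>g w\<close>; see \<open>shift_op_ket\<close> below.\<close>

lift_definition ell2_shift :: "('i \<Rightarrow> 'j) \<Rightarrow> 'i ell2 \<Rightarrow> 'j ell2"
  is "\<lambda>g x w. if w \<in> range g then x (inv g w) else 0"
proof -
  fix g :: "'i \<Rightarrow> 'j" and x :: "'i \<Rightarrow> complex"
  assume x: "(\<lambda>i. (cmod (x i))\<^sup>2) summable_on UNIV"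
  then have "(\<lambda>i. (cmod (x i))\<^sup>2) summable_on inv g ` range g"
    by (rule summable_on_subset_banach) simp
  then have "((\<lambda>i. (cmod (x i))\<^sup>2) \<circ> inv g) summable_on range g"
    by (subst (asm) summable_on_reindex) (simp_all add: inj_on_inv_into)
  then show "(\<lambda>w. (cmod (if w \<in> range g then x (inv g w) else 0))\<^sup>2) summable_on UNIV"
    by (rule summable_on_cong_neutral[THEN iffD1, rotated -1]) auto
qed

lemma norm_ell2_shift_le: "norm (ell2_shift g x) \<le> norm x"
proof transfer
  fix g :: "'i \<Rightarrow> 'j" and x :: "'i \<Rightarrow> complex"
  assume x: "(\<lambda>i. (cmod (x i))\<^sup>2) summable_on UNIV"
  have "(\<Sum>\<^sub>\<infinity>w. (cmod (if w \<in> range g then x (inv g w) else 0))\<^sup>2)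
      = (\<Sum>\<^sub>\<infinity>w\<in>range g. ((\<lambda>i. (cmod (x i))\<^sup>2) \<circ> inv g) w)"
    by (rule infsum_cong_neutral) auto
  also have "\<dots> = (\<Sum>\<^sub>\<infinity>i\<in>inv g ` range g. (cmod (x i))\<^sup>2)"
    by (rule infsum_reindex[symmetric]) (simp add: inj_on_inv_into)
  also have "\<dots> \<le> (\<Sum>\<^sub>\<infinity>i. (cmod (x i))\<^sup>2)"
    using x summable_on_subset_banach[OF x, of "inv g ` range g"]
    by (intro infsum_mono_neutral) auto
  finally show "sqrt (\<Sum>\<^sub>\<infinity>w. (cmod (if w \<in> range g then x (inv g w) else 0))\<^sup>2)
      \<le> sqrt (\<Sum>\<^sub>\<infinity>i. (cmod (x i))\<^sup>2)"
    by simp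
qed

definition shift_op :: "('i \<Rightarrow> 'j) \<Rightarrow> 'i ell2 \<Rightarrow>\<^sub>L 'j ell2" where
  "shift_op g = Blinfun (ell2_shift g)"

lemma shift_op_apply:
  fixes g :: "'i \<Rightarrow> 'j"
  shows "blinfun_apply (shift_op g) x = ell2_shift g x"
proof -
  have "bounded_linear (ell2_shift g)"
  proof (rule bounded_linear_intro[where K = 1])
    fix x y :: "'i ell2" and r :: real
    show "ell2_shift g (x + y) = ell2_shift g x + ell2_shift g y" by transfer auto
    show "ell2_shift g (r *\<^sub>R x) = r *\<^sub>R ell2_shift g x" by transfer auto
    show "norm (ell2_shift g x) \<le> norm x * 1" by (simp add: norm_ell2_shift_le)
  qed
  then show ?thesis by (simp add: shift_op_def bounded_linear_Blinfun_apply)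
qed

lemma clinear_shift_op: "clinear_op (shift_op g)"
  unfolding clinear_op_def shift_op_apply by (intro allI, transfer) auto

lemma shift_op_ket:
  assumes "inj g"
  shows "blinfun_apply (shift_op g) (ket w) = ket (g w)"
  unfolding shift_op_apply using assms by transfer (auto simp: fun_eq_iff)

lemma cinner_shift_op:
  assumes g: "inj g"
  shows "cinner (blinfun_apply (shift_op g) x) (blinfun_apply (shift_op g) y) = cinner x y"
proof -
  have "cinner (ell2_shift g x) (ell2_shift g y)
      = (\<Sum>\<^sub>\<infinity>w\<in>range g. ell2_coord x (inv g w) * cnj (ell2_coord y (inv g w)))"
    unfolding cinner_ell2.rep_eq ell2_shift.rep_eq by (rule infsum_cong_neutral) auto
  also have "\<dots> = (\<Sum>\<^sub>\<infinity>i. ell2_coord x i * cnj (ell2_coord y i))"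
    by (subst infsum_reindex[OF g]) (simp add: o_def g)
  finally show ?thesis by (simp add: shift_op_apply cinner_ell2.rep_eq)
qed

lemma cinner_shift_op_disjoint:
  assumes "range g \<inter> range h = {}"
  shows "cinner (blinfun_apply (shift_op g) x) (blinfun_apply (shift_op h) y) = 0"
  unfolding shift_op_apply cinner_ell2.rep_eq ell2_shift.rep_eq
  using assms by (intro infsum_0) auto

lemma shift_op_compose:
  fixes g :: "'j \<Rightarrow> 'k" and h :: "'i \<Rightarrow> 'j"
  assumes g: "inj g" and h: "inj h"
  shows "shift_op g o\<^sub>L shift_op h = shift_op (g \<circ> h)"
proof (rule blinfun_eqI)
  fix x
  have "ell2_shift g (ell2_shift h x) = ell2_shift (g \<circ> h) x"
  proof (transfer fixing: g h, rule ext)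
    fix x :: "'i \<Rightarrow> complex" and w
    show "(if w \<in> range g then if inv g w \<in> range h then x (inv h (inv g w)) else 0 else 0)
        = (if w \<in> range (g \<circ> h) then x (inv (g \<circ> h) w) else 0)"
    proof (cases "w \<in> range (g \<circ> h)")
      case True
      then obtain v where v: "w = g (h v)" by auto
      have "inv (g \<circ> h) ((g \<circ> h) v) = v" by (rule inv_f_f) (rule inj_compose[OF g h])
      then show ?thesis using v g h by simp
    next
      case False
      then show ?thesis using g by (auto simp: image_iff)
    qed
  qed
  then show "blinfun_apply (shift_op g o\<^sub>L shift_op h) x = blinfun_apply (shift_op (g \<circ> h)) x"
    by (simp add: shift_op_apply)
qed


section \<open>The semigroup of a single vertex 2-graph\<close>

text \<open>The index sets \<open>{1,\<dots>,m}\<close> and \<open>{1,\<dots>,n}\<close> are finite types \<^typ>\<open>'m\<close> and \<^typ>\<open>'n\<close>. The pair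
  \<open>(u, v)\<close> stands for the semigroup element \<open>e\<^sub>u f\<^sub>v\<close>; every element has exactly one such
  factorisation. The generators are \<open>Inl i\<close> for \<open>e\<^sub>i\<close> and \<open>Inr j\<close> for \<open>f\<^sub>j\<close>.
  \<open>push_f \<theta> j u = (u', j')\<close> says \<open>f\<^sub>j e\<^sub>u = e\<^sub>u\<^sub>' f\<^sub>j\<^sub>'\<close>. It uses the
  relations \<open>e\<^sub>i f\<^sub>j = f\<^sub>j\<^sub>' e\<^sub>i\<^sub>'\<close>, \<open>\<theta> (i, j) = (i', j')\<close>, from right to left, hence the inverse of \<open>\<theta>\<close>.\<close>

type_synonym ('m, 'n) tg = "'m list \<times> 'n list"

fun push_f :: "('m \<times> 'n \<Rightarrow> 'm \<times> 'n) \<Rightarrow> 'n \<Rightarrow> 'm list \<Rightarrow> 'm list \<times> 'n" where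
  "push_f \<theta> j [] = ([], j)"
| "push_f \<theta> j (i # u) =
    (case inv \<theta> (i, j) of (i', j') \<Rightarrow> case push_f \<theta> j' u of (u', j'') \<Rightarrow> (i' # u', j''))"

fun gen_mult :: "('m \<times> 'n \<Rightarrow> 'm \<times> 'n) \<Rightarrow> 'm + 'n \<Rightarrow> ('m, 'n) tg \<Rightarrow> ('m, 'n) tg" where
  "gen_mult \<theta> (Inl i) (u, v) = (i # u, v)"
| "gen_mult \<theta> (Inr j) (u, v) = (case push_f \<theta> j u of (u', j') \<Rightarrow> (u', j' # v))"

text \<open>This model is the semigroup presented by the commutation relations: two words in the generators
  are congruent iff they multiply out to the same pair.\<close>

inductive tg_cong :: "('m \<times> 'n \<Rightarrow> 'm \<times> 'n) \<Rightarrow> ('m + 'n) list \<Rightarrow> ('m + 'n) list \<Rightarrow> bool"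
  for \<theta> where
  commute: "\<theta> (i, j) = (i', j') \<Longrightarrow> tg_cong \<theta> (x @ [Inl i, Inr j] @ y) (x @ [Inr j', Inl i'] @ y)"
| refl: "tg_cong \<theta> x x"
| sym: "tg_cong \<theta> x y \<Longrightarrow> tg_cong \<theta> y x"
| trans: "tg_cong \<theta> x y \<Longrightarrow> tg_cong \<theta> y z \<Longrightarrow> tg_cong \<theta> x z"

definition tg_eval :: "('m \<times> 'n \<Rightarrow> 'm \<times> 'n) \<Rightarrow> ('m + 'n) list \<Rightarrow> ('m, 'n) tg" where
  "tg_eval \<theta> x = foldr (gen_mult \<theta>) x ([], [])"

lemma gen_mult_commute:
  assumes "bij \<theta>" "\<theta> (i, j) = (i', j')"
  shows "gen_mult \<theta> (Inl i) (gen_mult \<theta> (Inr j) w) = gen_mult \<theta> (Inr j') (gen_mult \<theta> (Inl i') w)"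
proof -
  obtain u v where w: "w = (u, v)" by (cases w)
  have "inv \<theta> (i', j') = (i, j)" using assms by (metis bij_inv_eq_iff)
  then show ?thesis unfolding w by (simp split: prod.split)
qed

lemma tg_eval_normal_form: "tg_eval \<theta> (map Inl u @ map Inr v) = (u, v)"
proof -
  have "foldr (gen_mult \<theta>) (map Inr v) ([], []) = ([], v)" by (induction v) auto
  moreover have "foldr (gen_mult \<theta>) (map Inl u) ([], v) = (u, v)" by (induction u) auto
  ultimately show ?thesis by (simp add: tg_eval_def)
qed

lemma tg_cong_Cons: "tg_cong \<theta> x y \<Longrightarrow> tg_cong \<theta> (g # x) (g # y)"
proof (induction rule: tg_cong.induct)
  case (commute i j i' j' x y)
  then show ?case using tg_cong.commute[of \<theta> i j i' j' "g # x" y] by simp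
qed (auto intro: tg_cong.intros)

lemma tg_cong_append: "tg_cong \<theta> x y \<Longrightarrow> tg_cong \<theta> (x @ z) (y @ z)"
proof (induction rule: tg_cong.induct)
  case (commute i j i' j' x y)
  then show ?case using tg_cong.commute[of \<theta> i j i' j' x "y @ z"] by simp
qed (auto intro: tg_cong.intros)

lemma tg_cong_push_f:
  assumes "bij \<theta>" "push_f \<theta> j u = (u', j')"
  shows "tg_cong \<theta> (Inr j # map Inl u) (map Inl u' @ [Inr j'])"
  using assms(2)
proof (induction u arbitrary: j u' j')
  case Nil
  then show ?case by (simp add: tg_cong.refl)
next
  case (Cons i u)
  obtain i0 j0 where ij: "inv \<theta> (i, j) = (i0, j0)" by fastforce
  obtain u1 j1 where uj: "push_f \<theta> j0 u = (u1, j1)" by fastforce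
  have u': "u' = i0 # u1" "j' = j1" using Cons.prems by (auto simp: ij uj)
  have "\<theta> (i0, j0) = (i, j)" using assms(1) ij by (metis bij_inv_eq_iff)
  then have "tg_cong \<theta> ([] @ [Inr j, Inl i] @ map Inl u) ([] @ [Inl i0, Inr j0] @ map Inl u)"
    by (intro tg_cong.sym[OF tg_cong.commute])
  then have 1: "tg_cong \<theta> (Inr j # Inl i # map Inl u) (Inl i0 # Inr j0 # map Inl u)"
    by simp
  have 2: "tg_cong \<theta> (Inl i0 # Inr j0 # map Inl u) (Inl i0 # map Inl u1 @ [Inr j1])"
    by (intro tg_cong_Cons Cons.IH uj)
  from tg_cong.trans[OF 1 2] show ?case by (simp add: u')
qed

lemma tg_cong_eval:
  assumes "bij \<theta>" "tg_eval \<theta> x = (u, v)"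
  shows "tg_cong \<theta> x (map Inl u @ map Inr v)"
  using assms(2)
proof (induction x arbitrary: u v)
  case Nil
  then show ?case by (simp add: tg_eval_def tg_cong.refl)
next
  case (Cons g x)
  obtain u0 v0 where uv: "tg_eval \<theta> x = (u0, v0)" by fastforce
  have 1: "tg_cong \<theta> (g # x) (g # map Inl u0 @ map Inr v0)"
    by (intro tg_cong_Cons Cons.IH uv)
  have 2: "gen_mult \<theta> g (u0, v0) = (u, v)" using Cons.prems uv by (simp add: tg_eval_def)
  show ?case
  proof (cases g)
    case (Inl i)
    then show ?thesis using 1 2 by auto
  next
    case (Inr j)
    obtain u1 j1 where p: "push_f \<theta> j u0 = (u1, j1)" by fastforce
    then have "u = u1" "v = j1 # v0" using 2 Inr by auto
    moreover have "tg_cong \<theta> ((Inr j # map Inl u0) @ map Inr v0) ((map Inl u1 @ [Inr j1]) @ map Inr v0)"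
      by (intro tg_cong_append tg_cong_push_f assms(1) p)
    ultimately show ?thesis using 1 Inr by (auto intro: tg_cong.trans)
  qed
qed

theorem tg_presentation:
  assumes "bij \<theta>"
  shows "tg_cong \<theta> x y \<longleftrightarrow> tg_eval \<theta> x = tg_eval \<theta> y"
proof
  assume "tg_cong \<theta> x y"
  then show "tg_eval \<theta> x = tg_eval \<theta> y"
    by (induction rule: tg_cong.induct) (simp_all add: tg_eval_def gen_mult_commute[OF assms])
next
  assume eq: "tg_eval \<theta> x = tg_eval \<theta> y"
  obtain u v where uv: "tg_eval \<theta> x = (u, v)" by fastforce
  then have "tg_eval \<theta> y = (u, v)" using eq by simp
  then show "tg_cong \<theta> x y"
    using tg_cong_eval[OF assms] uv tg_cong.trans tg_cong.sym by metis
qed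

lemma push_f_inj:
  assumes "bij \<theta>" "push_f \<theta> j u = push_f \<theta> k w"
  shows "j = k \<and> u = w"
  using assms(2)
proof (induction u arbitrary: j k w)
  case Nil
  then show ?case by (cases w) (auto split: prod.splits)
next
  case (Cons i u)
  obtain i2 w2 where w: "w = i2 # w2"
    using Cons.prems by (cases w) (auto split: prod.splits)
  obtain i0 j0 where a: "inv \<theta> (i, j) = (i0, j0)" by fastforce
  obtain i1 j1 where b: "inv \<theta> (i2, k) = (i1, j1)" by fastforce
  have "i0 = i1 \<and> push_f \<theta> j0 u = push_f \<theta> j1 w2"
    using Cons.prems by (auto simp: w a b split: prod.splits)
  then have "i0 = i1" "j0 = j1" "u = w2" using Cons.IH by auto
  moreover from this have "(i, j) = (i2, k)"
    using assms(1) a b by (metis bij_inv_eq_iff)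
  ultimately show ?case using w by simp
qed

lemma gen_mult_Inr_eq:
  assumes "bij \<theta>" "gen_mult \<theta> (Inr j) w = gen_mult \<theta> (Inr k) w'"
  shows "j = k \<and> w = w'"
proof -
  obtain u v u' v' where w: "w = (u, v)" "w' = (u', v')" by (cases w, cases w')
  have "push_f \<theta> j u = push_f \<theta> k u'" "v = v'"
    using assms(2) by (auto simp: w split: prod.splits)
  then show ?thesis using push_f_inj[OF assms(1)] w by blast
qed

lemma inj_gen_mult:
  assumes "bij \<theta>"
  shows "inj (gen_mult \<theta> g)"
proof (cases g)
  case (Inl i)
  then show ?thesis by (auto intro!: injI)
next
  case (Inr j)
  then show ?thesis using gen_mult_Inr_eq[OF assms] by (auto intro!: injI)
qed


section \<open>Isometric representations and the algebras they generate\<close>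

definition isometric_representation ::
  "('m \<times> 'n \<Rightarrow> 'm \<times> 'n) \<Rightarrow> ('m \<Rightarrow> 'h::chilbert_space \<Rightarrow>\<^sub>L 'h) \<Rightarrow> ('n \<Rightarrow> 'h \<Rightarrow>\<^sub>L 'h) \<Rightarrow> bool" where
  "isometric_representation \<theta> S T \<longleftrightarrow>
    (\<forall>i. clinear_op (S i)) \<and> (\<forall>j. clinear_op (T j)) \<and>
    (\<forall>i j. adj (S i) o\<^sub>L S j = (if i = j then id_blinfun else 0)) \<and>
    (\<forall>k l. adj (T k) o\<^sub>L T l = (if k = l then id_blinfun else 0)) \<and>
    (\<forall>i j i' j'. \<theta> (i, j) = (i', j') \<longrightarrow> S i o\<^sub>L T j = T j' o\<^sub>L S i')"

definition word_op :: "('i \<Rightarrow> 'h::real_normed_vector \<Rightarrow>\<^sub>L 'h) \<Rightarrow> 'i list \<Rightarrow> 'h \<Rightarrow>\<^sub>L 'h" where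
  "word_op V u = foldr (\<lambda>i A. V i o\<^sub>L A) u id_blinfun"

definition rep_op :: "('m \<Rightarrow> 'h::real_normed_vector \<Rightarrow>\<^sub>L 'h) \<Rightarrow> ('n \<Rightarrow> 'h \<Rightarrow>\<^sub>L 'h) \<Rightarrow> ('m, 'n) tg \<Rightarrow> 'h \<Rightarrow>\<^sub>L 'h"
  where "rep_op S T w = word_op S (fst w) o\<^sub>L word_op T (snd w)"

definition unital_subalgebra :: "('h::chilbert_space \<Rightarrow>\<^sub>L 'h) set \<Rightarrow> bool" where
  "unital_subalgebra \<A> \<longleftrightarrow>
    (\<forall>A\<in>\<A>. clinear_op A) \<and> id_blinfun \<in> \<A> \<and>
    (\<forall>A\<in>\<A>. \<forall>B\<in>\<A>. A + B \<in> \<A> \<and> A o\<^sub>L B \<in> \<A>) \<and> (\<forall>c. \<forall>A\<in>\<A>. c *\<^sub>O A \<in> \<A>)"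

text \<open>The weak operator topology is the coarsest topology for which all \<open>A \<mapsto> \<langle>A x, y\<rangle>\<close> are continuous.\<close>

definition wot :: "('h::chilbert_space \<Rightarrow>\<^sub>L 'h) topology" where
  "wot = topology_generated_by {{A. cinner (blinfun_apply A x) y \<in> U} | x y U. open U}"

text \<open>The weak* topology comes from the predual of trace class operators. As the trace class operators
  are the sums of rank one operators given by two square summable sequences of vectors, it is the coarsest
  topology for which the functionals \<open>A \<mapsto> \<Sum>k. \<langle>A x\<^sub>k, y\<^sub>k\<rangle>\<close> are continuous. On a WOT-closed
  (hence weak*-closed) subalgebra the weak* topology is the subspace topology.\<close>

definition weak_star :: "('h::chilbert_space \<Rightarrow>\<^sub>L 'h) topology" where
  "weak_star = topology_generated_by
    {{A. (\<Sum>k. cinner (blinfun_apply A (x k)) (y k)) \<in> U} | x y U.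
      summable (\<lambda>k::nat. (norm (x k))\<^sup>2) \<and> summable (\<lambda>k. (norm (y k))\<^sup>2) \<and> open U}"

definition norm_closed_alg :: "('m \<Rightarrow> 'h::chilbert_space \<Rightarrow>\<^sub>L 'h) \<Rightarrow> ('n \<Rightarrow> 'h \<Rightarrow>\<^sub>L 'h) \<Rightarrow> ('h \<Rightarrow>\<^sub>L 'h) set"
  where "norm_closed_alg S T = closure (unital_subalgebra hull (range S \<union> range T))"

definition two_graph_alg :: "('m \<Rightarrow> 'h::chilbert_space \<Rightarrow>\<^sub>L 'h) \<Rightarrow> ('n \<Rightarrow> 'h \<Rightarrow>\<^sub>L 'h) \<Rightarrow> ('h \<Rightarrow>\<^sub>L 'h) set"
  where "two_graph_alg S T =
    (\<lambda>\<A>. unital_subalgebra \<A> \<and> closedin wot \<A>) hull (range S \<union> range T)"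

definition left_regular_E :: "('m \<times> 'n \<Rightarrow> 'm \<times> 'n) \<Rightarrow> 'm \<Rightarrow> ('m, 'n) tg ell2 \<Rightarrow>\<^sub>L ('m, 'n) tg ell2" where
  "left_regular_E \<theta> i = shift_op (gen_mult \<theta> (Inl i))"

definition left_regular_F :: "('m \<times> 'n \<Rightarrow> 'm \<times> 'n) \<Rightarrow> 'n \<Rightarrow> ('m, 'n) tg ell2 \<Rightarrow>\<^sub>L ('m, 'n) tg ell2" where
  "left_regular_F \<theta> j = shift_op (gen_mult \<theta> (Inr j))"

lemma left_regular_ket:
  assumes "bij \<theta>"
  shows "blinfun_apply (left_regular_E \<theta> i) (ket w) = ket (gen_mult \<theta> (Inl i) w)"
    and "blinfun_apply (left_regular_F \<theta> j) (ket w) = ket (gen_mult \<theta> (Inr j) w)"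
  by (simp_all add: left_regular_E_def left_regular_F_def shift_op_ket inj_gen_mult[OF assms])

lemma adj_compose_eqI:
  fixes A B C :: "'h::chilbert_space \<Rightarrow>\<^sub>L 'h"
  assumes "clinear_op A" "\<And>x y. cinner (blinfun_apply A x) (blinfun_apply B y) = cinner x (blinfun_apply C y)"
  shows "adj A o\<^sub>L B = C"
proof (intro blinfun_eqI cinner_ext)
  fix x y
  show "cinner x (blinfun_apply (adj A o\<^sub>L B) y) = cinner x (blinfun_apply C y)"
    using cinner_adj[OF assms(1), of x "blinfun_apply B y"] assms(2) by simp
qed

lemma isometric_representation_left_regular:
  assumes "bij \<theta>"
  shows "isometric_representation \<theta> (left_regular_E \<theta>) (left_regular_F \<theta>)"
  unfolding isometric_representation_def
proof (intro conjI allI impI)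
  note inj = inj_gen_mult[OF assms]
  show cE: "clinear_op (left_regular_E \<theta> i)" and cF: "clinear_op (left_regular_F \<theta> j)" for i j
    by (simp_all add: left_regular_E_def left_regular_F_def clinear_shift_op)
  show "adj (left_regular_E \<theta> i) o\<^sub>L left_regular_E \<theta> j = (if i = j then id_blinfun else 0)" for i j
  proof (rule adj_compose_eqI[OF cE])
    fix x y
    have "range (gen_mult \<theta> (Inl i)) \<inter> range (gen_mult \<theta> (Inl j)) = {}" if "i \<noteq> j"
      using that by auto
    then show "cinner (blinfun_apply (left_regular_E \<theta> i) x) (blinfun_apply (left_regular_E \<theta> j) y)
        = cinner x (blinfun_apply (if i = j then id_blinfun else 0) y)"
      by (auto simp: left_regular_E_def cinner_shift_op[OF inj] cinner_shift_op_disjoint)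
  qed
  show "adj (left_regular_F \<theta> i) o\<^sub>L left_regular_F \<theta> j = (if i = j then id_blinfun else 0)" for i j
  proof (rule adj_compose_eqI[OF cF])
    fix x y
    have "range (gen_mult \<theta> (Inr i)) \<inter> range (gen_mult \<theta> (Inr j)) = {}" if "i \<noteq> j"
      unfolding disjoint_iff using that gen_mult_Inr_eq[OF assms] by (metis rangeE)
    then show "cinner (blinfun_apply (left_regular_F \<theta> i) x) (blinfun_apply (left_regular_F \<theta> j) y)
        = cinner x (blinfun_apply (if i = j then id_blinfun else 0) y)"
      by (auto simp: left_regular_F_def cinner_shift_op[OF inj] cinner_shift_op_disjoint)
  qed
  fix i j i' j' assume "\<theta> (i, j) = (i', j')"
  then have "gen_mult \<theta> (Inl i) \<circ> gen_mult \<theta> (Inr j) = gen_mult \<theta> (Inr j') \<circ> gen_mult \<theta> (Inl i')"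
    using gen_mult_commute[OF assms] by (auto simp del: gen_mult.simps)
  then show "left_regular_E \<theta> i o\<^sub>L left_regular_F \<theta> j = left_regular_F \<theta> j' o\<^sub>L left_regular_E \<theta> i'"
    by (simp add: left_regular_E_def left_regular_F_def shift_op_compose inj)
qed

abbreviation alg_A :: "('m \<times> 'n \<Rightarrow> 'm \<times> 'n) \<Rightarrow> (('m, 'n) tg ell2 \<Rightarrow>\<^sub>L ('m, 'n) tg ell2) set" where
  "alg_A \<theta> \<equiv> norm_closed_alg (left_regular_E \<theta>) (left_regular_F \<theta>)"

abbreviation alg_L :: "('m \<times> 'n \<Rightarrow> 'm \<times> 'n) \<Rightarrow> (('m, 'n) tg ell2 \<Rightarrow>\<^sub>L ('m, 'n) tg ell2) set" where
  "alg_L \<theta> \<equiv> two_graph_alg (left_regular_E \<theta>) (left_regular_F \<theta>)"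


section \<open>Rigid and analytic representations\<close>

text \<open>The norm of the \<open>k \<times> k\<close> operator matrix \<open>(A i j)\<close>, with indices below \<open>k\<close>, acting on the
  \<open>k\<close>-fold Hilbert space direct sum.\<close>

definition matrix_norm :: "nat \<Rightarrow> (nat \<Rightarrow> nat \<Rightarrow> 'a::real_normed_vector \<Rightarrow>\<^sub>L 'b::real_normed_vector) \<Rightarrow> real"
  where "matrix_norm k A =
    (SUP x\<in>{x :: nat \<Rightarrow> 'a. L2_set (\<lambda>j. norm (x j)) {..<k} \<le> 1}.
      L2_set (\<lambda>i. norm (\<Sum>j<k. blinfun_apply (A i j) (x j))) {..<k})"

lemma matrix_norm_bdd_above:
  fixes A :: "nat \<Rightarrow> nat \<Rightarrow> 'a::real_normed_vector \<Rightarrow>\<^sub>L 'b::real_normed_vector"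
  shows "bdd_above ((\<lambda>x. L2_set (\<lambda>i. norm (\<Sum>j<k. blinfun_apply (A i j) (x j))) {..<k})
    ` {x. L2_set (\<lambda>j. norm (x j)) {..<k} \<le> 1})"
proof (intro bdd_aboveI2)
  fix x :: "nat \<Rightarrow> 'a" assume "x \<in> {x. L2_set (\<lambda>j. norm (x j)) {..<k} \<le> 1}"
  then have x: "norm (x j) \<le> 1" if "j < k" for j
    using member_le_L2_set[of "{..<k}" j "\<lambda>j. norm (x j)"] that by auto
  have "norm (\<Sum>j<k. blinfun_apply (A i j) (x j)) \<le> (\<Sum>j<k. norm (A i j))" for i
  proof (rule sum_norm_le)
    fix j assume "j \<in> {..<k}"
    then have "norm (A i j) * norm (x j) \<le> norm (A i j) * 1"
      by (intro mult_left_mono x) auto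
    then show "norm (blinfun_apply (A i j) (x j)) \<le> norm (A i j)"
      using norm_blinfun[of "A i j" "x j"] by linarith
  qed
  then show "L2_set (\<lambda>i. norm (\<Sum>j<k. blinfun_apply (A i j) (x j))) {..<k}
      \<le> L2_set (\<lambda>i. \<Sum>j<k. norm (A i j)) {..<k}"
    by (intro L2_set_mono) auto
qed

definition completely_bounded_on ::
  "('h::chilbert_space \<Rightarrow>\<^sub>L 'h) set \<Rightarrow> (('h \<Rightarrow>\<^sub>L 'h) \<Rightarrow> ('k::chilbert_space \<Rightarrow>\<^sub>L 'k)) \<Rightarrow> bool" where
  "completely_bounded_on \<A> \<phi> \<longleftrightarrow>
    (\<exists>C. \<forall>k A. (\<forall>i<k. \<forall>j<k. A i j \<in> \<A>) \<longrightarrow> matrix_norm k (\<lambda>i j. \<phi> (A i j)) \<le> C * matrix_norm k A)"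

definition completely_isometric_on ::
  "('h::chilbert_space \<Rightarrow>\<^sub>L 'h) set \<Rightarrow> (('h \<Rightarrow>\<^sub>L 'h) \<Rightarrow> ('k::chilbert_space \<Rightarrow>\<^sub>L 'k)) \<Rightarrow> bool" where
  "completely_isometric_on \<A> \<phi> \<longleftrightarrow>
    (\<forall>k A. (\<forall>i<k. \<forall>j<k. A i j \<in> \<A>) \<longrightarrow> matrix_norm k (\<lambda>i j. \<phi> (A i j)) = matrix_norm k A)"

definition algebra_isomorphism ::
  "('h::chilbert_space \<Rightarrow>\<^sub>L 'h) set \<Rightarrow> ('k::chilbert_space \<Rightarrow>\<^sub>L 'k) set \<Rightarrow>
    (('h \<Rightarrow>\<^sub>L 'h) \<Rightarrow> ('k \<Rightarrow>\<^sub>L 'k)) \<Rightarrow> bool" where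
  "algebra_isomorphism \<A> \<B> \<phi> \<longleftrightarrow>
    bij_betw \<phi> \<A> \<B> \<and> \<phi> id_blinfun = id_blinfun \<and>
    (\<forall>A\<in>\<A>. \<forall>B\<in>\<A>. \<phi> (A + B) = \<phi> A + \<phi> B \<and> \<phi> (A o\<^sub>L B) = \<phi> A o\<^sub>L \<phi> B) \<and>
    (\<forall>c. \<forall>A\<in>\<A>. \<phi> (c *\<^sub>O A) = c *\<^sub>O \<phi> A)"

definition canonical ::
  "('m \<times> 'n \<Rightarrow> 'm \<times> 'n) \<Rightarrow> ('m \<Rightarrow> 'h::chilbert_space \<Rightarrow>\<^sub>L 'h) \<Rightarrow> ('n \<Rightarrow> 'h \<Rightarrow>\<^sub>L 'h) \<Rightarrow>
    (('h \<Rightarrow>\<^sub>L 'h) \<Rightarrow> (('m, 'n) tg ell2 \<Rightarrow>\<^sub>L ('m, 'n) tg ell2)) \<Rightarrow> bool" where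
  "canonical \<theta> S T \<phi> \<longleftrightarrow>
    (\<forall>i. \<phi> (S i) = left_regular_E \<theta> i) \<and> (\<forall>j. \<phi> (T j) = left_regular_F \<theta> j)"

definition rigid ::
  "('m \<times> 'n \<Rightarrow> 'm \<times> 'n) \<Rightarrow> ('m \<Rightarrow> 'h::chilbert_space \<Rightarrow>\<^sub>L 'h) \<Rightarrow> ('n \<Rightarrow> 'h \<Rightarrow>\<^sub>L 'h) \<Rightarrow> bool" where
  "rigid \<theta> S T \<longleftrightarrow>
    (\<exists>\<phi>. algebra_isomorphism (norm_closed_alg S T) (alg_A \<theta>) \<phi> \<and> canonical \<theta> S T \<phi> \<and>
      completely_isometric_on (norm_closed_alg S T) \<phi>)"

definition analytic_isomorphism ::
  "('m \<times> 'n \<Rightarrow> 'm \<times> 'n) \<Rightarrow> ('m \<Rightarrow> 'h::chilbert_space \<Rightarrow>\<^sub>L 'h) \<Rightarrow> ('n \<Rightarrow> 'h \<Rightarrow>\<^sub>L 'h) \<Rightarrow>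
    (('h \<Rightarrow>\<^sub>L 'h) \<Rightarrow> (('m, 'n) tg ell2 \<Rightarrow>\<^sub>L ('m, 'n) tg ell2)) \<Rightarrow> bool" where
  "analytic_isomorphism \<theta> S T \<phi> \<longleftrightarrow>
    algebra_isomorphism (two_graph_alg S T) (alg_L \<theta>) \<phi> \<and> canonical \<theta> S T \<phi> \<and>
    completely_bounded_on (two_graph_alg S T) \<phi> \<and>
    completely_bounded_on (alg_L \<theta>) (inv_into (two_graph_alg S T) \<phi>) \<and>
    homeomorphic_map (subtopology weak_star (two_graph_alg S T)) (subtopology weak_star (alg_L \<theta>)) \<phi>"

definition analytic ::
  "('m \<times> 'n \<Rightarrow> 'm \<times> 'n) \<Rightarrow> ('m \<Rightarrow> 'h::chilbert_space \<Rightarrow>\<^sub>L 'h) \<Rightarrow> ('n \<Rightarrow> 'h \<Rightarrow>\<^sub>L 'h) \<Rightarrow> bool" where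
  "analytic \<theta> S T \<longleftrightarrow> (\<exists>\<phi>. analytic_isomorphism \<theta> S T \<phi>)"


section \<open>Wandering vectors\<close>

definition wandering :: "('m \<Rightarrow> 'h::chilbert_space \<Rightarrow>\<^sub>L 'h) \<Rightarrow> ('n \<Rightarrow> 'h \<Rightarrow>\<^sub>L 'h) \<Rightarrow> 'h \<Rightarrow> bool" where
  "wandering S T \<zeta> \<longleftrightarrow> norm \<zeta> = 1 \<and>
    (\<forall>u w. cinner (blinfun_apply (rep_op S T u) \<zeta>) (blinfun_apply (rep_op S T w) \<zeta>)
      = (if u = w then 1 else 0))"

definition cyclic_subspace :: "('h::chilbert_space \<Rightarrow>\<^sub>L 'h) set \<Rightarrow> 'h \<Rightarrow> 'h set" where
  "cyclic_subspace \<A> \<zeta> = closure ((\<lambda>A. blinfun_apply A \<zeta>) ` \<A>)"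

definition closed_csubspace :: "'h::chilbert_space set \<Rightarrow> bool" where
  "closed_csubspace M \<longleftrightarrow>
    closed M \<and> 0 \<in> M \<and> (\<forall>x\<in>M. \<forall>y\<in>M. x + y \<in> M) \<and> (\<forall>c. \<forall>x\<in>M. c *\<^sub>C x \<in> M)"

definition closed_join :: "('j \<Rightarrow> 'h::chilbert_space set) \<Rightarrow> 'j set \<Rightarrow> 'h set" where
  "closed_join M J = closed_csubspace hull (\<Union>j\<in>J. M j)"

end

theory Submission
  imports Defs
begin

text \<open>A wandering vector \<open>\<zeta>\<^sub>j\<close> gives an isometry \<open>U\<^sub>j\<close> of \<open>\<ell>\<^sup>2\<close> onto \<open>\<M>\<^sub>j\<close> which intertwines the left regular
  representation with \<open>(S, T)\<close>. Compression by \<open>U\<^sub>j\<close> maps the 2-graph algebra into \<open>\<L>\<^sub>\<theta>\<close>, does not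
  depend on \<open>j\<close>, and is injective because the \<open>\<M>\<^sub>j\<close> span. The Cesaro means of \<open>B \<in> \<L>\<^sub>\<theta>\<close> are polynomials
  converging to \<open>B\<close>, and taking them is completely contractive. By rigidity the same polynomials in \<open>(S, T)\<close>
  stay bounded; they converge weakly on the span of the \<open>\<M>\<^sub>j\<close>, hence everywhere, and their limit is the
  preimage of \<open>B\<close>. The same approximation in matrices gives the complete isometry.

  For the weak* continuity of the inverse, a weak* continuous functional on the 2-graph algebra, transported
  to \<open>\<L>\<^sub>\<theta>\<close>, is approximated in norm by its composites with the Cesaro means. A separation argument in
  finitely many Fourier coefficients approximates these by finite rank functionals of controlled trace norm,
  and iterating produces a representing pair of square summable sequences.\<close>


section \<open>Operators on complex Hilbert spaces\<close>

text \<open>Were the \<open>\<M>\<^sub>j\<close> mutually orthogonal, \<open>(S, T)\<close> would be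
  a multiple of the left regular representation and the conclusion immediate. They may overlap, so
  convergence on each of them reaches the closed span only through a uniform bound. The isometries
  give one inequality: a polynomial has at least the norm in \<open>(S, T)\<close> that it has in
  the left regular representation. Rigidity is the opposite one. Partial Fourier sums lack a uniform
  bound, whereas Fejer weights turn the means into averages of compressions. The degree is the total
  length of a word, so each degree has finitely many words. The vectors defining a functional on the
  2-graph algebra need not lie in any \<open>\<M>\<^sub>j\<close> and cannot simply be pulled back
  to \<open>\<ell>\<^sup>2\<close>. New ones are found by approximation, which has to be uniform on
  the unit ball so that errors are measured in norm. Each round divides the error bound by 4 and
  costs no more than the bound before it, which keeps the total cost finite.\<close>

lemma scaleC_zero_left [simp]: "0 *\<^sub>C (x::'a::chilbert_space) = 0"
  using scaleR_scaleC[of 0 x] by simp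

lemma scaleC_zero_right [simp]: "c *\<^sub>C (0::'a::chilbert_space) = 0"
  using scaleC_add_right[of c 0 "0::'a"] by simp

lemma scaleC_minus_right: "c *\<^sub>C (- x) = - (c *\<^sub>C (x::'a::chilbert_space))"
  using scaleC_add_right[of c x "- x"] by (simp add: eq_neg_iff_add_eq_0 add.commute)

lemma scaleC_diff_right: "c *\<^sub>C (x - y) = c *\<^sub>C x - c *\<^sub>C (y::'a::chilbert_space)"
  using scaleC_add_right[of c x "- y"] by (simp add: scaleC_minus_right)

lemma scaleC_sum_right: "c *\<^sub>C (\<Sum>i\<in>A. f i) = (\<Sum>i\<in>A. c *\<^sub>C (f i::'a::chilbert_space))"
  by (induction A rule: infinite_finite_induct) (simp_all add: scaleC_add_right)

lemma cinner_sum_left: "cinner (\<Sum>i\<in>A. f i) (y::'a::chilbert_space) = (\<Sum>i\<in>A. cinner (f i) y)"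
  by (induction A rule: infinite_finite_induct) (simp_all add: cinner_add_left)

lemma cinner_sum_right: "cinner (y::'a::chilbert_space) (\<Sum>i\<in>A. f i) = (\<Sum>i\<in>A. cinner y (f i))"
  by (induction A rule: infinite_finite_induct) (simp_all add: cinner_add_right)

lemma cinner_ext_left: "(\<And>z. cinner x z = cinner y z) \<Longrightarrow> x = (y :: 'a::chilbert_space)"
  by (rule cinner_ext) (metis cinner_commute)

lemma bounded_bilinear_cinner: "bounded_bilinear (cinner :: 'a::chilbert_space \<Rightarrow> 'a \<Rightarrow> complex)"
proof
  show "\<exists>K. \<forall>a b :: 'a. norm (cinner a b) \<le> norm a * norm b * K"
    using Cauchy_Schwarz_cinner by (intro exI[of _ 1]) auto
qed (simp_all add: cinner_add_left cinner_add_right scaleR_scaleC cinner_scaleC_left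
    cinner_scaleC_right scaleR_conv_of_real)

lemma blinfun_scaleC_op [simp]: "blinfun_apply (c *\<^sub>O A) x = c *\<^sub>C blinfun_apply A x"
  by (simp add: scaleC_op.rep_eq)

lemma blinfun_sum_left: "blinfun_apply (\<Sum>i\<in>I. A i) x = (\<Sum>i\<in>I. blinfun_apply (A i) x)"
  by (induction I rule: infinite_finite_induct) (simp_all add: blinfun.add_left)

lemma blinfun_compose_assoc: "(A o\<^sub>L B) o\<^sub>L C = A o\<^sub>L (B o\<^sub>L C)"
  by (rule blinfun_eqI) simp

lemma clinear_opD: "clinear_op A \<Longrightarrow> blinfun_apply A (c *\<^sub>C x) = c *\<^sub>C blinfun_apply A x"
  by (simp add: clinear_op_def)

lemma clinear_op_id [intro]: "clinear_op id_blinfun"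
  and clinear_op_zero [intro]: "clinear_op 0"
  and clinear_op_compose [intro]: "clinear_op B \<Longrightarrow> clinear_op C \<Longrightarrow> clinear_op (B o\<^sub>L C)"
  and clinear_op_add [intro]: "clinear_op A \<Longrightarrow> clinear_op A' \<Longrightarrow> clinear_op (A + A')"
  and clinear_op_scaleC [intro]: "clinear_op A \<Longrightarrow> clinear_op (c *\<^sub>O A)"
  by (simp_all add: clinear_op_def blinfun.add_left scaleC_add_right scaleC_scaleC mult.commute)

lemma clinear_op_adj [intro]:
  assumes "clinear_op A" shows "clinear_op (adj A)"
  unfolding clinear_op_def
  by (intro allI cinner_ext) (simp add: cinner_adj[OF assms, symmetric] cinner_scaleC_right)

lemma cinner_adj_left:
  assumes "clinear_op A"
  shows "cinner (blinfun_apply (adj A) x) y = cinner x (blinfun_apply A y)"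
  using cinner_adj[OF assms, of y x] by (metis cinner_commute)

lemma cmod_cinner_blinfun_le:
  "cmod (cinner (blinfun_apply A x) y) \<le> norm A * norm x * norm (y::'a::chilbert_space)"
  by (rule order_trans[OF Cauchy_Schwarz_cinner]) (intro mult_right_mono norm_blinfun norm_ge_zero)

lemma norm_cinner_isometry:
  assumes "\<And>x y. cinner (blinfun_apply U x) (blinfun_apply U y) = cinner x y"
  shows "norm (blinfun_apply U x) = norm x"
  by (simp add: norm_eq_sqrt_cinner assms)

lemma adj_isometry_left:
  assumes "clinear_op U" "\<And>x y. cinner (blinfun_apply U x) (blinfun_apply U y) = cinner x y"
  shows "adj U o\<^sub>L U = id_blinfun"
  by (intro blinfun_eqI cinner_ext) (simp add: cinner_adj[OF assms(1), symmetric] assms(2))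

section \<open>Closed subspaces defined by uniform convergence, and weak limits of operators\<close>

lemma closed_csubspaceI:
  assumes "closed M" "0 \<in> M" "\<And>x y. x \<in> M \<Longrightarrow> y \<in> M \<Longrightarrow> x + y \<in> M" "\<And>c x. x \<in> M \<Longrightarrow> c *\<^sub>C x \<in> M"
  shows "closed_csubspace M"
  using assms by (simp add: closed_csubspace_def)

lemma closed_csubspace_sum:
  assumes "closed_csubspace M" "\<And>i. i \<in> I \<Longrightarrow> f i \<in> M"
  shows "(\<Sum>i\<in>I. f i) \<in> M"
  using assms by (induction I rule: infinite_finite_induct) (auto simp: closed_csubspace_def)

text \<open>The bound by \<open>C * g b * norm x\<close> is uniform in \<open>N\<close>, which makes
  the set closed. Convergence to zero, uniform over \<open>b\<close>, thus needs checking on a total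
  set of vectors only. It is used with \<open>b\<close> an operator and \<open>g\<close> its norm,
  and with \<open>b\<close> an index shift and \<open>g\<close> constantly 1.\<close>

lemma closed_csubspace_uniform_null:
  fixes f :: "nat \<Rightarrow> 'b \<Rightarrow> 'a::chilbert_space \<Rightarrow> real"
  assumes add: "\<And>N b x y. b \<in> K \<Longrightarrow> f N b (x + y) \<le> f N b x + f N b y"
    and scale: "\<And>N b c x. b \<in> K \<Longrightarrow> f N b (c *\<^sub>C x) = cmod c * f N b x"
    and bound: "\<And>N b x. b \<in> K \<Longrightarrow> f N b x \<le> C * g b * norm x"
    and g: "\<And>b. b \<in> K \<Longrightarrow> 0 \<le> g b"
  shows "closed_csubspace {x. \<forall>\<epsilon>>0. \<forall>\<^sub>F N in sequentially. \<forall>b\<in>K. f N b x \<le> \<epsilon> * g b}"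
    (is "closed_csubspace ?X")
proof (rule closed_csubspaceI)
  \<comment> \<open>\<open>C\<close> may be zero or negative, while the closedness argument divides
    by the constant.\<close>
  define D where "D = max C 1"
  have D: "D > 0" and bound': "\<And>N b x. b \<in> K \<Longrightarrow> f N b x \<le> D * g b * norm x"
  proof -
    show "D > 0" by (simp add: D_def)
    fix N b and x :: 'a assume "b \<in> K"
    then have "C * g b * norm x \<le> D * g b * norm x"
      by (intro mult_right_mono) (auto simp: D_def g)
    then show "f N b x \<le> D * g b * norm x" using bound[OF \<open>b \<in> K\<close>, of N x] by linarith
  qed
  have add2: "f N b z \<le> (\<epsilon>1 + \<epsilon>2) * g b"
    if "b \<in> K" "f N b x \<le> \<epsilon>1 * g b" "f N b y \<le> \<epsilon>2 * g b" "z = x + y" for N b \<epsilon>1 \<epsilon>2 and x y z :: 'a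
    using that add[OF that(1), of N x y] by (simp add: distrib_right)
  have "f N b 0 \<le> \<epsilon> * g b" if "b \<in> K" "\<epsilon> > 0" for N b \<epsilon>
  proof -
    have "0 \<le> \<epsilon> * g b" using g[OF that(1)] that(2) by simp
    then show ?thesis using bound'[OF that(1), of N 0] by simp
  qed
  then show "0 \<in> ?X" by auto
  show "x + y \<in> ?X" if "x \<in> ?X" "y \<in> ?X" for x y :: 'a
  proof (intro CollectI allI impI)
    fix \<epsilon> :: real assume "\<epsilon> > 0"
    then have e2: "\<epsilon>/2 > 0" by simp
    have "\<forall>\<^sub>F N in sequentially. \<forall>b\<in>K. f N b x \<le> \<epsilon>/2 * g b" using that(1) e2 by blast
    moreover have "\<forall>\<^sub>F N in sequentially. \<forall>b\<in>K. f N b y \<le> \<epsilon>/2 * g b" using that(2) e2 by blast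
    ultimately show "\<forall>\<^sub>F N in sequentially. \<forall>b\<in>K. f N b (x + y) \<le> \<epsilon> * g b"
    proof eventually_elim
      case (elim N)
      then show ?case
        using add2[of _ N x "\<epsilon>/2" y "\<epsilon>/2" "x + y"] by simp
    qed
  qed
  show "c *\<^sub>C x \<in> ?X" if "x \<in> ?X" for c and x :: 'a
  proof (intro CollectI allI impI)
    fix \<epsilon> :: real assume \<epsilon>: "\<epsilon> > 0"
    define \<delta> where "\<delta> = \<epsilon> / (cmod c + 1)"
    have c1: "cmod c + 1 > 0" using norm_ge_zero[of c] by linarith
    have "\<delta> > 0" using \<epsilon> c1 by (simp add: \<delta>_def)
    have "cmod c * \<delta> = cmod c / (cmod c + 1) * \<epsilon>" by (simp add: \<delta>_def)
    also have "\<dots> \<le> 1 * \<epsilon>"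
      using \<epsilon> c1 by (intro mult_right_mono) (auto simp: divide_le_eq)
    finally have d: "cmod c * \<delta> \<le> \<epsilon>" by simp
    have "\<forall>\<^sub>F N in sequentially. \<forall>b\<in>K. f N b x \<le> \<delta> * g b" using that \<open>\<delta> > 0\<close> by blast
    then show "\<forall>\<^sub>F N in sequentially. \<forall>b\<in>K. f N b (c *\<^sub>C x) \<le> \<epsilon> * g b"
    proof eventually_elim
      case (elim N)
      show ?case
      proof
        fix b assume b: "b \<in> K"
        have "cmod c * f N b x \<le> cmod c * (\<delta> * g b)"
          using elim b by (intro mult_left_mono) auto
        also have "\<dots> \<le> \<epsilon> * g b"
          using d g[OF b] by (metis mult.assoc mult_right_mono)
        finally show "f N b (c *\<^sub>C x) \<le> \<epsilon> * g b" using scale[OF b] by simp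
      qed
    qed
  qed
  show "closed ?X"
    unfolding closed_sequential_limits
  proof (intro allI impI, elim conjE, intro CollectI allI impI)
    fix X and x :: 'a and \<epsilon> :: real assume X: "\<forall>n. X n \<in> ?X" and lim: "X \<longlonglongrightarrow> x" and \<epsilon>: "\<epsilon> > 0"
    have "\<epsilon> / (2 * D) > 0" using \<epsilon> D by simp
    then obtain n where n: "norm (x - X n) < \<epsilon> / (2 * D)"
      using metric_LIMSEQ_D[OF lim] by (metis dist_norm dist_commute order_refl)
    have "D * norm (x - X n) \<le> \<epsilon> / 2" using n D by (simp add: field_simps)
    then have d: "D * g b * norm (x - X n) \<le> \<epsilon>/2 * g b" if "b \<in> K" for b
      using mult_right_mono[OF _ g[OF that]] by (fastforce simp: ac_simps)
    have "\<forall>\<^sub>F N in sequentially. \<forall>b\<in>K. f N b (X n) \<le> \<epsilon>/2 * g b"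
      using X half_gt_zero[OF \<epsilon>] by blast
    then show "\<forall>\<^sub>F N in sequentially. \<forall>b\<in>K. f N b x \<le> \<epsilon> * g b"
    proof eventually_elim
      case (elim N)
      show ?case
      proof
        fix b assume b: "b \<in> K"
        have "f N b x \<le> (\<epsilon>/2 + \<epsilon>/2) * g b"
          by (rule add2[OF b, where x = "X n" and y = "x - X n"])
            (use elim b bound'[OF b, of N "x - X n"] d[OF b] in auto)
        then show "f N b x \<le> \<epsilon> * g b" by simp
      qed
    qed
  qed
qed

text \<open>The limits form a bounded sesquilinear form. Riesz represents it in its first argument,
  which yields \<open>Z\<close> with \<open>b x y = cinner x (Z y)\<close>; the weak limit is
  therefore the adjoint of \<open>Z\<close>.\<close>

lemma weak_limit_operator:
  fixes A :: "nat \<Rightarrow> 'a::chilbert_space \<Rightarrow>\<^sub>L 'a"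
  assumes cl: "\<And>N. clinear_op (A N)" and bd: "\<And>N. norm (A N) \<le> C"
    and conv: "\<And>x y. convergent (\<lambda>N. cinner (blinfun_apply (A N) x) y)"
  shows "\<exists>B. clinear_op B \<and> (\<forall>x y. (\<lambda>N. cinner (blinfun_apply (A N) x) y) \<longlonglongrightarrow> cinner (blinfun_apply B x) y)"
proof -
  define b where "b x y = lim (\<lambda>N. cinner (blinfun_apply (A N) x) y)" for x y
  have b: "(\<lambda>N. cinner (blinfun_apply (A N) x) y) \<longlonglongrightarrow> b x y" for x y
    using conv by (simp add: b_def convergent_LIMSEQ_iff)
  have b_add: "b (x + x') y = b x y + b x' y" for x x' y
    by (rule LIMSEQ_unique[OF b])
      (use tendsto_add[OF b b] in \<open>simp add: blinfun.add_right cinner_add_left\<close>)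
  have b_scale: "b (c *\<^sub>C x) y = c * b x y" for c x y
    by (rule LIMSEQ_unique[OF b])
      (use tendsto_mult[OF tendsto_const b] in \<open>simp add: clinear_opD[OF cl] cinner_scaleC_left\<close>)
  have b_add': "b x (y + y') = b x y + b x y'" for x y y'
    by (rule LIMSEQ_unique[OF b]) (use tendsto_add[OF b b] in \<open>simp add: cinner_add_right\<close>)
  have b_scale': "b x (c *\<^sub>C y) = cnj c * b x y" for c x y
    by (rule LIMSEQ_unique[OF b]) (use tendsto_mult[OF tendsto_const b] in \<open>simp add: cinner_scaleC_right\<close>)
  have b_bound: "cmod (b x y) \<le> C * norm x * norm y" for x y
  proof (rule LIMSEQ_le_const2[OF tendsto_norm[OF b]], intro exI allI impI)
    fix N
    have "cmod (cinner (blinfun_apply (A N) x) y) \<le> norm (A N) * norm x * norm y"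
      by (rule cmod_cinner_blinfun_le)
    also have "\<dots> \<le> C * norm x * norm y" by (intro mult_right_mono bd) auto
    finally show "cmod (cinner (blinfun_apply (A N) x) y) \<le> C * norm x * norm y" .
  qed
  have "\<exists>z. \<forall>x. b x y = cinner x z" for y
    by (rule Riesz_representation[where K = "C * norm y"])
      (simp_all add: b_add b_scale b_bound[THEN order_trans] mult.commute mult.left_commute)
  then obtain Z where Z: "\<And>x y. b x y = cinner x (Z y)" by metis
  have "bounded_linear Z"
  proof (rule bounded_linear_intro[where K = C])
    fix x y :: 'a and r :: real
    show "Z (x + y) = Z x + Z y"
      by (rule cinner_ext) (simp add: Z[symmetric] cinner_add_right b_add')
    show "Z (r *\<^sub>R x) = r *\<^sub>R Z x"
      by (rule cinner_ext) (simp add: Z[symmetric] cinner_scaleC_right scaleR_scaleC b_scale')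
    have "(norm (Z x))\<^sup>2 = cmod (b (Z x) x)" by (simp add: Z cinner_self norm_power)
    also have "\<dots> \<le> C * norm (Z x) * norm x" by (rule b_bound)
    finally have "norm (Z x) * norm (Z x) \<le> norm (Z x) * (norm x * C)"
      by (simp add: power2_eq_square ac_simps)
    moreover have "0 \<le> C" using bd[of 0] norm_ge_zero[of "A 0"] by linarith
    ultimately show "norm (Z x) \<le> norm x * C"
      by (cases "norm (Z x) = 0") (simp_all add: mult_le_cancel_left)
  qed
  then have Z': "blinfun_apply (Blinfun Z) = Z" by (rule bounded_linear_Blinfun_apply)
  have clZ: "clinear_op (Blinfun Z)"
    unfolding clinear_op_def Z'
    by (intro allI cinner_ext) (simp add: Z[symmetric] cinner_scaleC_right b_scale')
  show ?thesis
    using b clZ by (intro exI[of _ "adj (Blinfun Z)"]) (auto simp: cinner_adj_left Z' Z[symmetric])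
qed

text \<open>Reads membership in the subspace of \<open>closed_csubspace_uniform_null\<close>, with
  the shifts \<open>k\<close> as index set, as the Cauchy property.\<close>

lemma convergent_of_uniform_null:
  fixes f :: "nat \<Rightarrow> complex"
  assumes "\<forall>\<epsilon>>0. \<forall>\<^sub>F N in sequentially. \<forall>k. cmod (f N - f (N + k)) \<le> \<epsilon>"
  shows "convergent f"
  unfolding Cauchy_convergent_iff[symmetric]
proof (rule metric_CauchyI)
  fix e :: real assume "e > 0"
  then obtain N where N: "cmod (f N - f (N + k)) \<le> e/3" for k
    using assms[rule_format, of "e/3"] by (auto simp: eventually_sequentially)
  have "dist (f m) (f n) < e" if "m \<ge> N" "n \<ge> N" for m n
  proof -
    have "dist (f m) (f n) \<le> dist (f N) (f m) + dist (f N) (f n)" by (metis dist_commute dist_triangle)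
    also have "\<dots> \<le> e/3 + e/3"
      using N[of "m - N"] N[of "n - N"] that by (intro add_mono) (simp_all add: dist_norm)
    finally show ?thesis using \<open>e > 0\<close> by simp
  qed
  then show "\<exists>M. \<forall>m\<ge>M. \<forall>n\<ge>M. dist (f m) (f n) < e" by blast
qed

text \<open>Moving a near-minimiser of the distance to \<open>z\<close> slightly towards another point of \<open>K\<close>
  hardly decreases the distance; expanding the square gives the separating vector, without
  completeness of \<open>K\<close>.\<close>

lemma approximate_separation:
  fixes K :: "'a::chilbert_space set"
  assumes ne: "K \<noteq> {}" and cvx: "\<And>x y t. x \<in> K \<Longrightarrow> y \<in> K \<Longrightarrow> 0 \<le> t \<Longrightarrow> t \<le> 1 \<Longrightarrow> x + t *\<^sub>R (y - x) \<in> K"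
    and bd: "\<And>x. x \<in> K \<Longrightarrow> norm x \<le> R" and far: "\<And>x. x \<in> K \<Longrightarrow> d \<le> norm (z - x)" and d: "d > 0"
  shows "\<exists>h. \<exists>\<eta>>0. \<forall>x\<in>K. Re (cinner x h) \<le> Re (cinner z h) - \<eta>"
proof -
  define m where "m = (INF x\<in>K. (norm (z - x))\<^sup>2)"
  have bddb: "bdd_below ((\<lambda>x. (norm (z - x))\<^sup>2) ` K)" by (intro bdd_belowI[of _ 0]) auto
  have m_le: "m \<le> (norm (z - x))\<^sup>2" if "x \<in> K" for x
    unfolding m_def using bddb that by (rule cINF_lower)
  have md: "d\<^sup>2 \<le> m"
    unfolding m_def using far d by (intro cINF_greatest ne power_mono) auto
  have R: "R \<ge> 0" using ne bd norm_ge_zero order_trans by blast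
  \<comment> \<open>With this step size the quadratic term \<open>t * (4 * R\<^sup>2)\<close> stays
    below \<open>d\<^sup>2 / 2\<close>; the added 1 covers \<open>R = 0\<close>.\<close>
  define t where "t = min 1 (d\<^sup>2 / (8 * R\<^sup>2 + 1))"
  have R8: "0 < 8 * R\<^sup>2 + 1" using zero_le_power2[of R] by linarith
  have t: "0 < t" "t \<le> 1" using R8 d unfolding t_def by (auto intro: divide_pos_pos)
  have "t * (8 * R\<^sup>2 + 1) \<le> d\<^sup>2 / (8 * R\<^sup>2 + 1) * (8 * R\<^sup>2 + 1)"
    using R8 by (intro mult_right_mono) (auto simp: t_def)
  also have "\<dots> = d\<^sup>2" using R8 by simp
  finally have tR: "t * (4 * R\<^sup>2) \<le> d\<^sup>2 / 2" using t(1) unfolding distrib_left by linarith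
  \<comment> \<open>The slack is proportional to \<open>t\<close>, so it survives the later division
    by \<open>t\<close> as a fixed fraction of \<open>d\<^sup>2\<close>.\<close>
  have "\<exists>x\<in>K. (norm (z - x))\<^sup>2 < m + t * d\<^sup>2 / 2"
  proof -
    have "m < m + t * d\<^sup>2 / 2" using t d by simp
    then show ?thesis unfolding m_def using cINF_less_iff[OF ne bddb] by blast
  qed
  then obtain x0 where x0: "x0 \<in> K" "(norm (z - x0))\<^sup>2 < m + t * d\<^sup>2 / 2" by blast
  define h where "h = z - x0"
  show ?thesis
  proof (intro exI[of _ h] exI[of _ "d\<^sup>2/2"] conjI ballI)
    show "0 < d\<^sup>2/2" using d by simp
    fix x assume x: "x \<in> K"
    have "m \<le> (norm (z - (x0 + t *\<^sub>R (x - x0))))\<^sup>2"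
      using t by (intro m_le cvx x x0) auto
    also have "z - (x0 + t *\<^sub>R (x - x0)) = h + (- complex_of_real t) *\<^sub>C (x - x0)"
      by (metis (no_types, lifting) add_diff_cancel_left add_uminus_conv_diff diff_diff_add h_def
          of_real_minus scaleR_minus_left scaleR_scaleC)
    also have "(norm \<dots>)\<^sup>2 = (norm h)\<^sup>2 - 2 * t * Re (cinner (x - x0) h) + t\<^sup>2 * (norm (x - x0))\<^sup>2"
      unfolding norm_add_sq using t cinner_commute[of "x - x0" h]
      by (simp add: cinner_scaleC_right norm_scaleC power_mult_distrib)
    also have "(norm (x - x0))\<^sup>2 \<le> (2 * R)\<^sup>2"
      using norm_triangle_ineq4[of x x0] bd[OF x] bd[OF x0(1)] by (intro power_mono) auto
    finally have "2 * t * Re (cinner (x - x0) h) \<le> t * d\<^sup>2 / 2 + t * (t * (4 * R\<^sup>2))"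
      using x0(2) t by (simp add: h_def power2_eq_square mult_left_mono ac_simps)
    also have "\<dots> \<le> t * d\<^sup>2 / 2 + t * (d\<^sup>2 / 2)"
      using t tR by (intro add_left_mono mult_left_mono) auto
    finally have "t * (2 * Re (cinner (x - x0) h)) \<le> t * d\<^sup>2" by simp
    then have "2 * Re (cinner (x - x0) h) \<le> d\<^sup>2" using t by simp
    moreover have "Re (cinner (z - x0) h) \<ge> d\<^sup>2"
      using m_le[OF x0(1)] md by (simp add: h_def cinner_self)
    ultimately show "Re (cinner x h) \<le> Re (cinner z h) - d\<^sup>2/2"
      by (simp add: cinner_diff_left)
  qed
qed


section \<open>Square summable families\<close>

lemma ell2_coord_add [simp]: "ell2_coord (x + y) i = ell2_coord x i + ell2_coord y i"
  by (simp add: plus_ell2.rep_eq)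

lemma ell2_coord_diff [simp]: "ell2_coord (x - y) i = ell2_coord x i - ell2_coord y i"
  by (simp add: minus_ell2.rep_eq)

lemma ell2_coord_scaleC [simp]: "ell2_coord (c *\<^sub>C x) i = c * ell2_coord x i"
  by (simp add: scaleC_ell2.rep_eq)

lemma ell2_coord_zero [simp]: "ell2_coord 0 i = 0"
  by (simp add: zero_ell2.rep_eq)

lemma ell2_coord_sum: "ell2_coord (\<Sum>k\<in>A. f k) i = (\<Sum>k\<in>A. ell2_coord (f k) i)"
  by (induction A rule: infinite_finite_induct) simp_all

lemma ell2_coord_ket: "ell2_coord (ket w) i = (if i = w then 1 else 0)"
  by (simp add: ket.rep_eq)

lemma cinner_ket_right: "cinner x (ket w) = ell2_coord x w"
proof -
  have "(\<Sum>\<^sub>\<infinity>i. ell2_coord x i * cnj (ell2_coord (ket w) i)) = (\<Sum>\<^sub>\<infinity>i\<in>{w}. ell2_coord x i)"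
    by (rule infsum_cong_neutral) (auto simp: ell2_coord_ket)
  then show ?thesis by (simp add: cinner_ell2.rep_eq)
qed

lemma cinner_ket_left: "cinner (ket w) x = cnj (ell2_coord x w)"
  by (metis cinner_commute cinner_ket_right)

lemma norm_ket [simp]: "norm (ket w) = 1"
  by (simp add: norm_eq_sqrt_cinner cinner_ket_right ell2_coord_ket)

lemma ell2_eqI: "(\<And>i. ell2_coord x i = ell2_coord y i) \<Longrightarrow> x = y"
  by (metis ell2_coord_inject ext)

text \<open>The coordinates of \<open>adj A y\<close> are inner products of \<open>y\<close> with
  the values of \<open>A\<close> on basis vectors. So the adjoints agree pointwise, without a
  density argument.\<close>

lemma clinear_op_eq_on_ket:
  assumes "clinear_op A" "clinear_op B" "\<And>w. blinfun_apply A (ket w) = blinfun_apply B (ket w)"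
  shows "A = (B :: 'i ell2 \<Rightarrow>\<^sub>L 'h::chilbert_space)"
proof -
  have "blinfun_apply (adj A) y = blinfun_apply (adj B) y" for y
    by (rule ell2_eqI) (metis assms cinner_ket_right cinner_adj_left)
  then have "cinner (blinfun_apply A x) y = cinner (blinfun_apply B x) y" for x y
    using assms by (simp add: cinner_adj)
  then show ?thesis by (intro blinfun_eqI cinner_ext) (metis cinner_commute)
qed

text \<open>For finite \<open>F\<close> this is the orthogonal projection onto the span of the
  \<open>ket w\<close> with \<open>w\<close> in \<open>F\<close>.\<close>

definition fin_part :: "'i set \<Rightarrow> 'i ell2 \<Rightarrow> 'i ell2" where
  "fin_part F x = (\<Sum>w\<in>F. ell2_coord x w *\<^sub>C ket w)"

lemma ell2_coord_fin_part:
  "finite F \<Longrightarrow> ell2_coord (fin_part F x) i = (if i \<in> F then ell2_coord x i else 0)"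
  by (simp add: fin_part_def ell2_coord_sum ell2_coord_ket if_distrib cong: if_cong)

lemma norm_fin_part_sq: "finite F \<Longrightarrow> (norm (fin_part F x))\<^sup>2 = (\<Sum>w\<in>F. (cmod (ell2_coord x w))\<^sup>2)"
proof -
  assume F: "finite F"
  have "complex_of_real ((norm (fin_part F x))\<^sup>2) = cinner (fin_part F x) (fin_part F x)"
    by (simp add: cinner_self)
  also have "\<dots> = (\<Sum>w\<in>F. cinner (fin_part F x) (ell2_coord x w *\<^sub>C ket w))"
    by (subst (2) fin_part_def) (simp add: cinner_sum_right)
  also have "\<dots> = (\<Sum>w\<in>F. complex_of_real ((cmod (ell2_coord x w))\<^sup>2))"
    using F by (intro sum.cong) (simp_all add: cinner_scaleC_right cinner_ket_right
        ell2_coord_fin_part mult.commute[of _ "cnj _"] complex_norm_square del: of_real_power)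
  finally show ?thesis by (metis of_real_eq_iff of_real_sum)
qed

lemma norm_ell2_sq: "(norm x)\<^sup>2 = (\<Sum>\<^sub>\<infinity>w. (cmod (ell2_coord x w))\<^sup>2)"
  by (simp add: norm_ell2.rep_eq infsum_nonneg)

lemma norm_fin_part_le: "finite F \<Longrightarrow> norm (fin_part F x) \<le> norm x"
proof -
  assume F: "finite F"
  have "(norm (fin_part F x))\<^sup>2 \<le> (norm x)\<^sup>2"
    unfolding norm_fin_part_sq[OF F] norm_ell2_sq[of x]
    using F ell2_coord[of x] by (intro finite_sum_le_infsum) auto
  then show ?thesis by (rule power2_le_imp_le) simp
qed

text \<open>The remainder is orthogonal to the finite part, so by Pythagoras its squared norm is the
  tail of the coordinate sum. Quantifying over all larger \<open>G\<close> gives convergence along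
  the filter of finite sets.\<close>

lemma fin_part_approx:
  assumes "\<epsilon> > 0"
  shows "\<exists>F. finite F \<and> (\<forall>G. finite G \<longrightarrow> F \<subseteq> G \<longrightarrow> norm (x - fin_part G x) < \<epsilon>)"
proof -
  have "((\<lambda>w. (cmod (ell2_coord x w))\<^sup>2) has_sum (norm x)\<^sup>2) UNIV"
    using ell2_coord[of x] by (simp add: norm_ell2_sq)
  then have "\<forall>\<^sub>F F in finite_subsets_at_top UNIV. dist (\<Sum>w\<in>F. (cmod (ell2_coord x w))\<^sup>2) ((norm x)\<^sup>2) < \<epsilon>\<^sup>2"
    unfolding has_sum_def by (rule tendstoD) (use assms in simp)
  then obtain F where F: "finite F"
    "\<And>G. finite G \<Longrightarrow> F \<subseteq> G \<Longrightarrow> dist (\<Sum>w\<in>G. (cmod (ell2_coord x w))\<^sup>2) ((norm x)\<^sup>2) < \<epsilon>\<^sup>2"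
    by (auto simp: eventually_finite_subsets_at_top)
  have "norm (x - fin_part G x) < \<epsilon>" if G: "finite G" "F \<subseteq> G" for G
  proof -
    have "cinner (fin_part G x) (x - fin_part G x) = 0"
      using G by (subst (1) fin_part_def)
        (simp add: cinner_sum_left cinner_scaleC_left cinner_ket_left ell2_coord_fin_part)
    then have "(norm x)\<^sup>2 = (norm (fin_part G x))\<^sup>2 + (norm (x - fin_part G x))\<^sup>2"
      using norm_add_sq[of "fin_part G x" "x - fin_part G x"] by simp
    then have "(norm (x - fin_part G x))\<^sup>2 < \<epsilon>\<^sup>2"
      using F(2)[OF G] norm_fin_part_sq[OF G(1), of x] by (simp add: dist_real_def)
    then show ?thesis using assms by (metis less_le power2_less_imp_less)
  qed
  then show ?thesis using F(1) by blast
qed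

lemma fin_part_tendsto: "((\<lambda>F. fin_part F x) \<longlongrightarrow> x) (finite_subsets_at_top UNIV)"
proof (rule tendstoI)
  fix e :: real assume "e > 0"
  then show "\<forall>\<^sub>F F in finite_subsets_at_top UNIV. dist (fin_part F x) x < e"
    using fin_part_approx[of e x] by (auto simp: eventually_finite_subsets_at_top dist_norm norm_minus_commute)
qed

lemma closed_csubspace_ket:
  assumes X: "closed_csubspace X" and k: "\<And>w. ket w \<in> X"
  shows "(x :: 'i ell2) \<in> X"
proof -
  have "fin_part F x \<in> X" for F
    unfolding fin_part_def using X k by (intro closed_csubspace_sum) (auto simp: closed_csubspace_def)
  moreover have "\<exists>F. dist (fin_part F x) x < e" if "e > 0" for e
    using fin_part_approx[OF that, of x] by (metis dist_commute dist_norm order_refl)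
  ultimately have "x \<in> closure X" unfolding closure_approachable by blast
  then show ?thesis using X by (simp add: closed_csubspace_def)
qed

text \<open>Bessel's inequality makes the coefficient map \<open>V\<close> bounded, and the isometry
  is its adjoint. This avoids summing a possibly uncountable family in the target space.\<close>

lemma isometry_of_orthonormal_family:
  fixes e :: "'i \<Rightarrow> 'h::chilbert_space"
  assumes on: "\<And>v w. cinner (e v) (e w) = (if v = w then 1 else 0)"
  shows "\<exists>U :: 'i ell2 \<Rightarrow>\<^sub>L 'h. clinear_op U \<and> (\<forall>w. blinfun_apply U (ket w) = e w) \<and>
    (\<forall>x y. cinner (blinfun_apply U x) (blinfun_apply U y) = cinner x y)"
proof -
  have bessel: "(\<Sum>w\<in>F. (cmod (cinner y (e w)))\<^sup>2) \<le> (norm y)\<^sup>2" if F: "finite F" for F y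
  proof -
    define p where "p = (\<Sum>w\<in>F. cinner y (e w) *\<^sub>C e w)"
    have pe: "cinner p (e w) = (if w \<in> F then cinner y (e w) else 0)" for w
      using F by (simp add: p_def cinner_sum_left cinner_scaleC_left on if_distrib cong: if_cong)
    have "cinner p (y - p) = (\<Sum>w\<in>F. cinner y (e w) * cinner (e w) (y - p))"
      by (subst (1) p_def) (simp add: cinner_sum_left cinner_scaleC_left)
    also have "\<dots> = 0"
    proof (intro sum.neutral ballI)
      fix w assume "w \<in> F"
      have "cinner (e w) (y - p) = cnj (cinner (y - p) (e w))" by (rule cinner_commute)
      then show "cinner y (e w) * cinner (e w) (y - p) = 0"
        using \<open>w \<in> F\<close> by (simp add: cinner_diff_left pe)
    qed
    finally have "(norm y)\<^sup>2 = (norm p)\<^sup>2 + (norm (y - p))\<^sup>2"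
      using norm_add_sq[of p "y - p"] by simp
    moreover have "complex_of_real ((norm p)\<^sup>2) = (\<Sum>w\<in>F. complex_of_real ((cmod (cinner y (e w)))\<^sup>2))"
    proof -
      have "cinner p p = (\<Sum>w\<in>F. cinner p (cinner y (e w) *\<^sub>C e w))"
        by (subst (2) p_def) (simp add: cinner_sum_right)
      also have "\<dots> = (\<Sum>w\<in>F. complex_of_real ((cmod (cinner y (e w)))\<^sup>2))"
        by (intro sum.cong)
          (simp_all add: cinner_scaleC_right pe mult.commute[of _ "cnj _"] complex_norm_square del: of_real_power)
      finally show ?thesis by (simp add: cinner_self)
    qed
    then have "(norm p)\<^sup>2 = (\<Sum>w\<in>F. (cmod (cinner y (e w)))\<^sup>2)"
      by (metis of_real_eq_iff of_real_sum)
    ultimately show ?thesis using zero_le_power2[of "norm (y - p)"] by linarith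
  qed
  have sq: "(\<lambda>w. (cmod (cinner y (e w)))\<^sup>2) summable_on UNIV" for y
    unfolding ell2_sq_iff using bessel by blast
  define V where "V y = Abs_ell2 (\<lambda>w. cinner y (e w))" for y
  have V: "ell2_coord (V y) w = cinner y (e w)" for y w
    unfolding V_def by (subst Abs_ell2_inverse) (simp_all add: sq)
  have "bounded_linear V"
  proof (rule bounded_linear_intro[where K = 1])
    fix x y :: 'h and r :: real
    show "V (x + y) = V x + V y" by (rule ell2_eqI) (simp add: V cinner_add_left)
    show "V (r *\<^sub>R x) = r *\<^sub>R V x"
      by (rule ell2_eqI) (simp add: V scaleR_scaleC cinner_scaleC_left)
    have "(norm (V x))\<^sup>2 \<le> (norm x)\<^sup>2"
      unfolding norm_ell2_sq V by (rule infsum_le_finite_sums) (use sq bessel in auto)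
    then have "norm (V x) \<le> norm x" by (rule power2_le_imp_le) simp
    then show "norm (V x) \<le> norm x * 1" by simp
  qed
  then have V': "blinfun_apply (Blinfun V) = V" by (rule bounded_linear_Blinfun_apply)
  have cV: "clinear_op (Blinfun V)"
    unfolding clinear_op_def V' by (intro allI ell2_eqI) (simp add: V cinner_scaleC_left)
  define U where "U = adj (Blinfun V)"
  have UV: "cinner y (blinfun_apply U x) = cinner (V y) x" for x y
    using cinner_adj[OF cV, of y x] by (simp add: U_def V')
  have VU: "V (blinfun_apply U x) = x" for x
  proof (rule ell2_eqI)
    fix w
    have "V (e w) = ket w" by (rule ell2_eqI) (simp add: V on ell2_coord_ket eq_commute)
    then have "cinner (e w) (blinfun_apply U x) = cnj (ell2_coord x w)"
      by (simp add: UV cinner_ket_left)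
    then show "ell2_coord (V (blinfun_apply U x)) w = ell2_coord x w"
      by (metis V cinner_commute complex_cnj_cnj)
  qed
  have "blinfun_apply U (ket w) = e w" for w
    by (rule cinner_ext) (simp add: UV cinner_ket_right V)
  moreover have "cinner (blinfun_apply U x) (blinfun_apply U y) = cinner x y" for x y
    by (simp add: UV VU)
  moreover have "clinear_op U" unfolding U_def using cV by blast
  ultimately show ?thesis by blast
qed


section \<open>Matrix norms as bounds of sesquilinear forms\<close>

lemma matrix_norm_nonneg: "0 \<le> matrix_norm k A"
  unfolding matrix_norm_def
  by (rule cSUP_upper2[OF matrix_norm_bdd_above, of "\<lambda>_. 0"]) (auto simp: L2_set_def)

lemma matrix_norm_apply_le:
  "L2_set (\<lambda>i. norm (\<Sum>j<k. blinfun_apply (A i j) (x j))) {..<k} \<le> matrix_norm k A * L2_set (\<lambda>j. norm (x j)) {..<k}"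
proof (cases "L2_set (\<lambda>j. norm (x j)) {..<k} = 0")
  case True
  then have "x j = 0" if "j < k" for j
    using that by (simp add: L2_set_eq_0_iff)
  then have "(\<Sum>j<k. blinfun_apply (A i j) (x j)) = 0" for i by simp
  then show ?thesis using True by (simp add: L2_set_def)
next
  case False
  define r where "r = L2_set (\<lambda>j. norm (x j)) {..<k}"
  have r: "r > 0" using False by (simp add: r_def order_less_le L2_set_nonneg)
  have "L2_set (\<lambda>i. norm (\<Sum>j<k. blinfun_apply (A i j) (x j /\<^sub>R r))) {..<k} \<le> matrix_norm k A"
    unfolding matrix_norm_def
  proof (rule cSUP_upper[OF _ matrix_norm_bdd_above], rule CollectI)
    have "L2_set (\<lambda>j. norm (x j /\<^sub>R r)) {..<k} = inverse r * r"
      unfolding norm_scaleR r_def by (subst L2_set_right_distrib) (use r in \<open>auto simp: r_def\<close>)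
    then show "L2_set (\<lambda>j. norm (x j /\<^sub>R r)) {..<k} \<le> 1" using r by simp
  qed
  also have "L2_set (\<lambda>i. norm (\<Sum>j<k. blinfun_apply (A i j) (x j /\<^sub>R r))) {..<k}
      = inverse r * L2_set (\<lambda>i. norm (\<Sum>j<k. blinfun_apply (A i j) (x j))) {..<k}"
    using r by (subst L2_set_right_distrib)
      (simp_all add: blinfun.scaleR_right flip: scaleR_sum_right)
  finally show ?thesis using r by (simp add: field_simps r_def)
qed

text \<open>The form of the operator matrix on the \<open>k\<close>-fold direct sum. It passes to
  weak limits and to isometric changes of vectors, so matrix norms are compared through it.\<close>

definition matrix_form ::
  "nat \<Rightarrow> (nat \<Rightarrow> nat \<Rightarrow> 'a::chilbert_space \<Rightarrow>\<^sub>L 'b::chilbert_space) \<Rightarrow> (nat \<Rightarrow> 'a) \<Rightarrow> (nat \<Rightarrow> 'b) \<Rightarrow> complex" where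
  "matrix_form k A x y = (\<Sum>i<k. \<Sum>j<k. cinner (blinfun_apply (A i j) (x j)) (y i))"

lemma matrix_form_le:
  "cmod (matrix_form k A x y) \<le> matrix_norm k A * L2_set (\<lambda>j. norm (x j)) {..<k} * L2_set (\<lambda>i. norm (y i)) {..<k}"
proof -
  have "cmod (matrix_form k A x y) = cmod (\<Sum>i<k. cinner (\<Sum>j<k. blinfun_apply (A i j) (x j)) (y i))"
    by (simp add: matrix_form_def cinner_sum_left)
  also have "\<dots> \<le> (\<Sum>i<k. norm (\<Sum>j<k. blinfun_apply (A i j) (x j)) * norm (y i))"
    by (intro sum_norm_le Cauchy_Schwarz_cinner)
  also have "\<dots> \<le> L2_set (\<lambda>i. norm (\<Sum>j<k. blinfun_apply (A i j) (x j))) {..<k} * L2_set (\<lambda>i. norm (y i)) {..<k}"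
    using L2_set_mult_ineq[of "\<lambda>i. norm (\<Sum>j<k. blinfun_apply (A i j) (x j))" "\<lambda>i. norm (y i)" "{..<k}"] by simp
  also have "\<dots> \<le> matrix_norm k A * L2_set (\<lambda>j. norm (x j)) {..<k} * L2_set (\<lambda>i. norm (y i)) {..<k}"
    by (intro mult_right_mono matrix_norm_apply_le L2_set_nonneg)
  finally show ?thesis .
qed

text \<open>Testing the form against the image of \<open>x\<close> gives the squared norm of that
  image, and one factor cancels.\<close>

lemma matrix_norm_leI:
  fixes A :: "nat \<Rightarrow> nat \<Rightarrow> 'a::chilbert_space \<Rightarrow>\<^sub>L 'b::chilbert_space"
  assumes M: "0 \<le> M"
    and le: "\<And>x y. cmod (matrix_form k A x y) \<le> M * L2_set (\<lambda>j. norm (x j)) {..<k} * L2_set (\<lambda>i. norm (y i)) {..<k}"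
  shows "matrix_norm k A \<le> M"
  unfolding matrix_norm_def
proof (rule cSUP_least)
  have ne_empty: "C \<noteq> {}" if "x \<in> C" for x and C :: "(nat \<Rightarrow> 'a) set" using that by auto
  have "(\<lambda>_. 0 :: 'a) \<in> {x. L2_set (\<lambda>j. norm (x j)) {..<k} \<le> 1}" by (simp add: L2_set_def)
  then show "{x :: nat \<Rightarrow> 'a. L2_set (\<lambda>j. norm (x j)) {..<k} \<le> 1} \<noteq> {}" by (rule ne_empty)
  fix x :: "nat \<Rightarrow> 'a" assume "x \<in> {x. L2_set (\<lambda>j. norm (x j)) {..<k} \<le> 1}"
  then have x: "L2_set (\<lambda>j. norm (x j)) {..<k} \<le> 1" by simp
  define z where "z i = (\<Sum>j<k. blinfun_apply (A i j) (x j))" for i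
  define Z where "Z = L2_set (\<lambda>i. norm (z i)) {..<k}"
  have "matrix_form k A x z = (\<Sum>i<k. cinner (z i) (z i))"
    unfolding matrix_form_def by (subst (2) z_def) (simp only: cinner_sum_left)
  also have "\<dots> = complex_of_real (\<Sum>i<k. (norm (z i))\<^sup>2)"
    by (simp only: cinner_self of_real_sum)
  also have "(\<Sum>i<k. (norm (z i))\<^sup>2) = Z\<^sup>2"
    by (simp add: Z_def L2_set_def sum_nonneg)
  finally have "cmod (matrix_form k A x z) = Z\<^sup>2" by (simp only: norm_of_real abs_power2)
  then have "Z\<^sup>2 \<le> M * L2_set (\<lambda>j. norm (x j)) {..<k} * Z"
    using le[of x z] by (simp only: Z_def)
  also have "\<dots> \<le> M * 1 * Z"
    using M x by (intro mult_right_mono mult_left_mono) (auto simp: Z_def L2_set_nonneg)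
  finally have "Z * Z \<le> M * Z" by (simp add: power2_eq_square)
  moreover have "Z \<ge> 0" by (simp add: Z_def L2_set_nonneg)
  ultimately have "Z \<le> M" using M by (metis mult_le_cancel_right order_le_less)
  then show "L2_set (\<lambda>i. norm (\<Sum>j<k. blinfun_apply (A i j) (x j))) {..<k} \<le> M"
    by (simp add: Z_def z_def)
qed

lemma matrix_norm_1:
  fixes A :: "'a::chilbert_space \<Rightarrow>\<^sub>L 'b::chilbert_space"
  shows "matrix_norm 1 (\<lambda>_ _. A) = norm A"
proof (rule antisym)
  show "matrix_norm 1 (\<lambda>_ _. A) \<le> norm A"
    by (rule matrix_norm_leI) (simp_all add: matrix_form_def L2_set_def cmod_cinner_blinfun_le)
  show "norm A \<le> matrix_norm 1 (\<lambda>_ _. A)"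
    by (rule norm_blinfun_bound[OF matrix_norm_nonneg])
      (use matrix_norm_apply_le[where k = 1 and A = "\<lambda>_ _. A" and x = "\<lambda>_. x" for x] in \<open>simp add: L2_set_def\<close>)
qed


lemma norm_le_cinner:
  fixes A :: "'a::chilbert_space \<Rightarrow>\<^sub>L 'b::chilbert_space"
  assumes "0 \<le> M" "\<And>x y. cmod (cinner (blinfun_apply A x) y) \<le> M * norm x * norm y"
  shows "norm A \<le> M"
proof -
  have "matrix_norm 1 (\<lambda>_ _. A) \<le> M"
    by (rule matrix_norm_leI) (simp_all add: matrix_form_def L2_set_def assms)
  then show ?thesis unfolding matrix_norm_1 .
qed

text \<open>Entries outside the block are unconstrained, so an identity valid only on an algebra can
  be applied just inside the block.\<close>

lemma matrix_norm_cong: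
  assumes "\<And>i j. i < k \<Longrightarrow> j < k \<Longrightarrow> A i j = B i j"
  shows "matrix_norm k A = matrix_norm k B"
proof -
  have "(\<Sum>j<k. blinfun_apply (A i j) (x j)) = (\<Sum>j<k. blinfun_apply (B i j) (x j))" if "i < k" for i x
    by (rule sum.cong) (simp_all add: assms that)
  then have "L2_set (\<lambda>i. norm (\<Sum>j<k. blinfun_apply (A i j) (x j))) {..<k}
      = L2_set (\<lambda>i. norm (\<Sum>j<k. blinfun_apply (B i j) (x j))) {..<k}" for x
    by (intro L2_set_cong) simp_all
  then show ?thesis by (simp add: matrix_norm_def)
qed


section \<open>The weak operator topology\<close>

lemma topspace_wot [simp]: "topspace wot = UNIV"
  unfolding wot_def topology_generated_by_topspace by (auto intro!: exI[of _ UNIV])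

lemma continuous_map_wot: "continuous_map wot euclidean (\<lambda>A. cinner (blinfun_apply A x) y)"
  unfolding continuous_map_def topspace_wot
  by (auto simp: wot_def intro!: topology_generated_by_Basis)

text \<open>Complex linearity, commutation and intertwining are all brought into this form, with
  matrix coefficients on both sides.\<close>

lemma closedin_wot_equations:
  assumes "\<And>i. i \<in> I \<Longrightarrow> continuous_map wot euclidean (f i)" "\<And>i. i \<in> I \<Longrightarrow> continuous_map wot euclidean (g i)"
  shows "closedin wot {A. \<forall>i\<in>I. f i A = (g i A :: complex)}"
proof -
  have eq: "closedin wot {A. f i A = g i A}" if "i \<in> I" for i
    using closedin_continuous_maps_eq[OF _ assms(1)[OF that] assms(2)[OF that]] by simp
  have "{A. \<forall>i\<in>I. f i A = g i A} = (if I = {} then UNIV else (\<Inter>i\<in>I. {A. f i A = g i A}))" by auto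
  then show ?thesis using eq closedin_topspace[of wot] by (auto intro!: closedin_INT)
qed

text \<open>Moving \<open>C\<close> to the other side as its adjoint shows that preimages of
  subbasic sets are subbasic. With \<open>C = adj (U j0)\<close> and \<open>D = U j0\<close> this is
  the continuity of the compression.\<close>

lemma continuous_map_wot_sandwich:
  fixes C :: "'h::chilbert_space \<Rightarrow>\<^sub>L 'k::chilbert_space" and D :: "'k \<Rightarrow>\<^sub>L 'h"
  assumes "clinear_op C"
  shows "continuous_map wot wot (\<lambda>A. C o\<^sub>L A o\<^sub>L D)"
  unfolding continuous_map_def
proof (intro conjI allI impI)
  show "(\<lambda>A :: 'h \<Rightarrow>\<^sub>L 'h. C o\<^sub>L A o\<^sub>L D) \<in> topspace wot \<rightarrow> topspace wot" by simp
  fix U :: "('k \<Rightarrow>\<^sub>L 'k) set" assume "openin wot U"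
  then have "generate_topology_on {{A. cinner (blinfun_apply A x) y \<in> U} | x y U. open U} U"
    by (simp add: wot_def openin_topology_generated_by_iff)
  then have "openin wot {A :: 'h \<Rightarrow>\<^sub>L 'h. C o\<^sub>L A o\<^sub>L D \<in> U}"
  proof (induction rule: generate_topology_on.induct)
    case (Int a b)
    have "{A :: 'h \<Rightarrow>\<^sub>L 'h. C o\<^sub>L A o\<^sub>L D \<in> a \<inter> b}
        = {A :: 'h \<Rightarrow>\<^sub>L 'h. C o\<^sub>L A o\<^sub>L D \<in> a} \<inter> {A :: 'h \<Rightarrow>\<^sub>L 'h. C o\<^sub>L A o\<^sub>L D \<in> b}" by auto
    then show ?case using Int by auto
  next
    case (UN K)
    have "{A :: 'h \<Rightarrow>\<^sub>L 'h. C o\<^sub>L A o\<^sub>L D \<in> \<Union>K} = (\<Union>k\<in>K. {A :: 'h \<Rightarrow>\<^sub>L 'h. C o\<^sub>L A o\<^sub>L D \<in> k})" by auto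
    then show ?case using UN by auto
  next
    case (Basis s)
    then obtain x y V where s: "s = {A. cinner (blinfun_apply A x) y \<in> V}" "open V" by blast
    have "{A :: 'h \<Rightarrow>\<^sub>L 'h. C o\<^sub>L A o\<^sub>L D \<in> s}
        = {A. cinner (blinfun_apply A (blinfun_apply D x)) (blinfun_apply (adj C) y) \<in> V}"
      by (auto simp: s cinner_adj[OF assms])
    then show ?case
      using continuous_map_wot[of "blinfun_apply D x" "blinfun_apply (adj C) y"] s(2)
      by (simp add: continuous_map_def)
  qed auto
  then show "openin wot {A \<in> topspace wot. C o\<^sub>L A o\<^sub>L D \<in> U}" by simp
qed

text \<open>Open sets are generated from subbasic ones, and being eventually inside passes through
  finite intersections and arbitrary unions.\<close>

lemma closedin_wot_limit:
  assumes cl: "closedin wot \<A>" and mem: "\<And>N. A N \<in> \<A>"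
    and lim: "\<And>x y. (\<lambda>N. cinner (blinfun_apply (A N) x) y) \<longlonglongrightarrow> cinner (blinfun_apply B x) y"
  shows "B \<in> \<A>"
proof (rule ccontr)
  assume B: "B \<notin> \<A>"
  have "openin wot (- \<A>)" using cl by (simp add: closedin_def Compl_eq_Diff_UNIV)
  then have "generate_topology_on {{A. cinner (blinfun_apply A x) y \<in> U} | x y U. open U} (- \<A>)"
    by (simp add: wot_def openin_topology_generated_by_iff)
  then have "B \<in> - \<A> \<longrightarrow> (\<forall>\<^sub>F N in sequentially. A N \<in> - \<A>)"
  proof (induction rule: generate_topology_on.induct)
    case (Int a b)
    then show ?case by (auto simp: eventually_conj_iff)
  next
    case (UN K)
    show ?case
    proof
      assume "B \<in> \<Union>K"
      then obtain k where "k \<in> K" "B \<in> k" by blast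
      then have "\<forall>\<^sub>F N in sequentially. A N \<in> k" using UN by blast
      then show "\<forall>\<^sub>F N in sequentially. A N \<in> \<Union>K" by eventually_elim (use \<open>k \<in> K\<close> in blast)
    qed
  next
    case (Basis s)
    then obtain x y U where s: "s = {A. cinner (blinfun_apply A x) y \<in> U}" "open U" by blast
    show ?case using topological_tendstoD[OF lim s(2)] s(1) by auto
  qed simp
  then show False using B mem by auto
qed

text \<open>The operator type contains all bounded real linear maps, so complex linearity is itself
  a condition whose closedness has to be shown.\<close>

lemma closedin_wot_clinear: "closedin wot {A :: 'h::chilbert_space \<Rightarrow>\<^sub>L 'h. clinear_op A}"
proof -
  have "{A :: 'h \<Rightarrow>\<^sub>L 'h. clinear_op A} = {A. \<forall>(c, x, y)\<in>UNIV.
      cinner (blinfun_apply A (c *\<^sub>C x)) y = cinner (blinfun_apply A x) (cnj c *\<^sub>C y)}"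
    by (auto simp: clinear_op_def cinner_scaleC_left cinner_scaleC_right)
      (intro cinner_ext, metis cinner_commute cinner_scaleC_left)
  also have "closedin wot \<dots>"
    using closedin_wot_equations[of UNIV "\<lambda>(c, x, y) A. cinner (blinfun_apply A (c *\<^sub>C x)) y"
        "\<lambda>(c, x, y) A. cinner (blinfun_apply A x) (cnj c *\<^sub>C y)"]
    by (simp add: case_prod_beta continuous_map_wot)
  finally show ?thesis .
qed

section \<open>The algebras generated by a representation\<close>

lemma two_graph_alg_gen: "S i \<in> two_graph_alg S T" "T j \<in> two_graph_alg S T"
  using hull_subset[of "range S \<union> range T" "\<lambda>\<A>. unital_subalgebra \<A> \<and> closedin wot \<A>"]
  by (auto simp: two_graph_alg_def)

lemma two_graph_alg_minimal:
  assumes "unital_subalgebra \<A>" "closedin wot \<A>" "\<And>i. S i \<in> \<A>" "\<And>j. T j \<in> \<A>"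
  shows "two_graph_alg S T \<subseteq> \<A>"
  unfolding two_graph_alg_def using assms by (intro hull_minimal) auto

lemma unital_subalgebra_clinear: "unital_subalgebra {A. clinear_op A}"
  by (auto simp: unital_subalgebra_def)

lemma unital_subalgebraD:
  assumes "unital_subalgebra \<A>"
  shows "A \<in> \<A> \<Longrightarrow> clinear_op A" "id_blinfun \<in> \<A>" "A \<in> \<A> \<Longrightarrow> B \<in> \<A> \<Longrightarrow> A + B \<in> \<A>"
    "A \<in> \<A> \<Longrightarrow> B \<in> \<A> \<Longrightarrow> A o\<^sub>L B \<in> \<A>" "A \<in> \<A> \<Longrightarrow> c *\<^sub>O A \<in> \<A>"
  using assms unfolding unital_subalgebra_def by blast+

text \<open>The empty intersection would consist of all real linear operators. In both applications
  the algebra of complex linear operators witnesses that \<open>C\<close> is not empty.\<close>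

lemma unital_subalgebra_Inter:
  assumes sub: "\<And>\<A>. \<A> \<in> C \<Longrightarrow> unital_subalgebra \<A>" and ne: "C \<noteq> {}"
  shows "unital_subalgebra (\<Inter>C)"
  unfolding unital_subalgebra_def
proof (intro conjI ballI allI)
  show "clinear_op A" if "A \<in> \<Inter>C" for A
    using that ne unital_subalgebraD(1)[OF sub] by blast
qed (use unital_subalgebraD[OF sub] in blast)+

lemma two_graph_alg:
  assumes "\<And>i. clinear_op (S i)" "\<And>j. clinear_op (T j)"
  shows unital_subalgebra_two_graph_alg: "unital_subalgebra (two_graph_alg S T)"
    and closedin_two_graph_alg: "closedin wot (two_graph_alg S T)"
proof -
  let ?C = "{\<A>. (unital_subalgebra \<A> \<and> closedin wot \<A>) \<and> range S \<union> range T \<subseteq> \<A>}"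
  have eq: "two_graph_alg S T = \<Inter>?C" by (simp add: two_graph_alg_def hull_def)
  have "{A. clinear_op A} \<in> ?C"
    using unital_subalgebra_clinear closedin_wot_clinear assms by auto
  then have ne: "?C \<noteq> {}" by blast
  show "unital_subalgebra (two_graph_alg S T)"
    unfolding eq by (rule unital_subalgebra_Inter[OF _ ne]) simp
  show "closedin wot (two_graph_alg S T)"
    unfolding eq by (rule closedin_Inter[OF ne]) simp
qed

lemma unital_subalgebra_hull:
  assumes "\<And>i. clinear_op (S i)" "\<And>j. clinear_op (T j)"
  shows "unital_subalgebra (unital_subalgebra hull (range S \<union> range T))"
  unfolding hull_def
proof (rule unital_subalgebra_Inter)
  have "{A. clinear_op A} \<in> {\<A>. unital_subalgebra \<A> \<and> range S \<union> range T \<subseteq> \<A>}"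
    using unital_subalgebra_clinear assms by auto
  then show "{\<A>. unital_subalgebra \<A> \<and> range S \<union> range T \<subseteq> \<A>} \<noteq> {}" by blast
qed simp

lemma word_op_simps [simp]: "word_op V [] = id_blinfun" "word_op V (i # u) = V i o\<^sub>L word_op V u"
  by (simp_all add: word_op_def)

lemma unital_subalgebra_word_op:
  assumes "unital_subalgebra \<A>" "\<And>i. V i \<in> \<A>"
  shows "word_op V u \<in> \<A>"
  by (induction u) (simp_all add: assms unital_subalgebraD[OF assms(1)])

lemma unital_subalgebra_rep_op:
  assumes "unital_subalgebra \<A>" "\<And>i. S i \<in> \<A>" "\<And>j. T j \<in> \<A>"
  shows "rep_op S T w \<in> \<A>"
  unfolding rep_op_def
  by (intro unital_subalgebraD(4)[OF assms(1)] unital_subalgebra_word_op assms)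

lemma unital_subalgebra_sum:
  assumes \<A>: "unital_subalgebra \<A>" and "\<And>w. w \<in> W \<Longrightarrow> A w \<in> \<A>"
  shows "(\<Sum>w\<in>W. A w) \<in> \<A>"
  using assms(2)
proof (induction W rule: infinite_finite_induct)
  have "0 *\<^sub>O id_blinfun = (0 :: 'a \<Rightarrow>\<^sub>L 'a)" by (rule blinfun_eqI) simp
  then have z: "0 \<in> \<A>" using unital_subalgebraD(2,5)[OF \<A>] by metis
  then show "\<And>W. infinite W \<Longrightarrow> sum A W \<in> \<A>" "sum A {} \<in> \<A>" by simp_all
qed (simp add: unital_subalgebraD[OF \<A>])


section \<open>The semigroup of a single vertex 2-graph\<close>

definition tg_mult :: "('m \<times> 'n \<Rightarrow> 'm \<times> 'n) \<Rightarrow> ('m, 'n) tg \<Rightarrow> ('m, 'n) tg \<Rightarrow> ('m, 'n) tg" where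
  "tg_mult \<theta> w v = foldr (gen_mult \<theta>) (map Inl (fst w) @ map Inr (snd w)) v"

definition tg_len :: "('m, 'n) tg \<Rightarrow> nat" where
  "tg_len w = length (fst w) + length (snd w)"

abbreviation tg_one :: "('m, 'n) tg" where "tg_one \<equiv> ([], [])"

lemma tg_mult_one_right [simp]: "tg_mult \<theta> w tg_one = w"
  using tg_eval_normal_form[of \<theta> "fst w" "snd w"] by (simp add: tg_mult_def tg_eval_def)

lemma tg_mult_one_left [simp]: "tg_mult \<theta> tg_one w = w"
  by (simp add: tg_mult_def)

text \<open>The generators act through the commutation relations, so congruent words act alike, and
  each word is congruent to the normal form of its value. Associativity rests on this.\<close>

lemma foldr_gen_mult_eq_tg_mult:
  assumes "bij \<theta>"
  shows "foldr (gen_mult \<theta>) x v = tg_mult \<theta> (tg_eval \<theta> x) v"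
proof -
  have cong: "foldr (gen_mult \<theta>) y v = foldr (gen_mult \<theta>) z v" if "tg_cong \<theta> y z" for y z
    using that by (induction rule: tg_cong.induct) (simp_all add: gen_mult_commute[OF assms])
  show ?thesis
    unfolding tg_mult_def using tg_cong_eval[OF assms, of x] by (intro cong) (metis prod.collapse)
qed

lemma gen_mult_tg_mult:
  assumes "bij \<theta>"
  shows "gen_mult \<theta> g (tg_mult \<theta> w v) = tg_mult \<theta> (gen_mult \<theta> g w) v"
proof -
  let ?x = "map Inl (fst w) @ map Inr (snd w)"
  have "tg_eval \<theta> (g # ?x) = gen_mult \<theta> g w"
    using tg_eval_normal_form[of \<theta> "fst w" "snd w"] by (simp add: tg_eval_def)
  then show ?thesis
    using foldr_gen_mult_eq_tg_mult[OF assms, of "g # ?x" v] by (simp add: tg_mult_def)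
qed

lemma foldr_gen_mult_tg_mult:
  assumes "bij \<theta>"
  shows "foldr (gen_mult \<theta>) x (tg_mult \<theta> w v) = tg_mult \<theta> (foldr (gen_mult \<theta>) x w) v"
  by (induction x) (simp_all add: gen_mult_tg_mult[OF assms])

lemma tg_mult_assoc:
  assumes "bij \<theta>"
  shows "tg_mult \<theta> u (tg_mult \<theta> w v) = tg_mult \<theta> (tg_mult \<theta> u w) v"
  using foldr_gen_mult_tg_mult[OF assms, of _ w v] by (simp only: tg_mult_def[of \<theta> u])

text \<open>The relations exchange one \<open>e\<close> and one \<open>f\<close>, so pushing
  preserves the number of letters. This makes total length a grading.\<close>

lemma tg_len_gen_mult: "tg_len (gen_mult \<theta> g w) = Suc (tg_len w)"
proof -
  have push: "length (fst (push_f \<theta> j u)) = length u" for j u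
    by (induction \<theta> j u rule: push_f.induct) (auto split: prod.split)
  obtain u v where w: "w = (u, v)" by (cases w)
  show ?thesis
  proof (cases g)
    case (Inr j)
    then show ?thesis using push[of j u] by (cases "push_f \<theta> j u") (simp add: w tg_len_def)
  qed (simp add: w tg_len_def)
qed

lemma tg_len_mult: "tg_len (tg_mult \<theta> w v) = tg_len w + tg_len v"
proof -
  have "tg_len (foldr (gen_mult \<theta>) x v) = length x + tg_len v" for x
    by (induction x) (simp_all add: tg_len_gen_mult)
  from this[of "map Inl (fst w) @ map Inr (snd w)"] show ?thesis
    by (simp add: tg_mult_def) (simp add: tg_len_def)
qed

lemma finite_tg_len_less: "finite {w :: ('m::finite, 'n::finite) tg. tg_len w < N}"
proof (rule finite_subset)
  show "{w :: ('m, 'n) tg. tg_len w < N} \<subseteq> {u. length u \<le> N} \<times> {v. length v \<le> N}"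
    by (auto simp: tg_len_def)
  show "finite ({u :: 'm list. length u \<le> N} \<times> {v :: 'n list. length v \<le> N})"
    using finite_lists_length_le[of "UNIV :: 'm set" N] finite_lists_length_le[of "UNIV :: 'n set" N] by simp
qed

text \<open>Pushing \<open>e\<^sub>i\<close> to the left through a word in the \<open>f\<^sub>j\<close> is invertible, so it
  suffices to compare normal forms.\<close>

lemma tg_mult_gen_cancel:
  assumes \<theta>: "bij \<theta>" and eq: "tg_mult \<theta> w (gen_mult \<theta> g tg_one) = tg_mult \<theta> w' (gen_mult \<theta> g tg_one)"
  shows "w = w'"
proof -
  obtain u v u' v' where w: "w = (u, v)" "w' = (u', v')" by (cases w, cases w')
  have foldr_Inl: "foldr (gen_mult \<theta>) (map Inl a) p = (a @ fst p, snd p)" for a p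
    by (induction a) (cases p; auto)+
  show ?thesis
  proof (cases g)
    case (Inl i)
    \<comment> \<open>This is the product \<open>f\<^sub>b e\<^sub>i\<close>; its normal form has
      one \<open>e\<close> letter in front of as many \<open>f\<close> letters as \<open>b\<close>
      has.\<close>
    let ?F = "\<lambda>b. foldr (gen_mult \<theta>) (map Inr b) ([i], [])"
    have len: "length (fst (?F b)) = 1 \<and> length (snd (?F b)) = length b" for b
    proof (induction b)
      case (Cons j b)
      obtain i1 b1 where "?F b = ([i1], b1)" "length b1 = length b"
        using Cons by (cases "?F b") (auto simp: length_Suc_conv)
      then show ?case by (auto split: prod.splits)
    qed simp
    have F_inj: "b = b'" if "?F b = ?F b'" for b b'
      using that
    proof (induction b arbitrary: b')
      case Nil
      then show ?case using len[of "[]"] len[of b'] by auto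
    next
      case (Cons j b)
      obtain j' c where b': "b' = j' # c"
        using Cons.prems len[of "j # b"] len[of b'] by (cases b') auto
      have "gen_mult \<theta> (Inr j) (?F b) = gen_mult \<theta> (Inr j') (?F c)" using Cons.prems b' by simp
      then have "j = j'" "?F b = ?F c" using gen_mult_Inr_eq[OF \<theta>] by blast+
      then show ?case using Cons.IH b' by simp
    qed
    have "u @ fst (?F v) = u' @ fst (?F v')" "snd (?F v) = snd (?F v')"
      using eq unfolding tg_mult_def w Inl by (simp_all add: foldr_Inl)
    \<comment> \<open>\<open>fst (?F v)\<close> is a single letter, so the two concatenations split
      uniquely.\<close>
    then have "u = u'" "?F v = ?F v'"
      using len[of v] len[of v'] by (auto simp: prod_eq_iff)
    then show ?thesis using F_inj w by simp
  next
    case (Inr j)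
    have foldr_Inr: "foldr (gen_mult \<theta>) (map Inr b) ([], c) = ([], b @ c)" for b c
      by (induction b) auto
    show ?thesis using eq unfolding tg_mult_def w Inr by (simp add: foldr_Inl foldr_Inr)
  qed
qed

text \<open>Right cancellation of one generator, iterated along a spelling of \<open>v\<close>. It
  makes \<open>right_shift\<close> an isometry and lets matrix entries be indexed by the unique
  \<open>w\<close> with \<open>q = w p\<close>.\<close>

lemma inj_tg_mult:
  assumes \<theta>: "bij \<theta>"
  shows "inj (\<lambda>w. tg_mult \<theta> w v)"
proof (rule injI)
  have "w = w'" if "tg_mult \<theta> w (foldr (gen_mult \<theta>) x tg_one) = tg_mult \<theta> w' (foldr (gen_mult \<theta>) x tg_one)" for w w' x
    using that
  proof (induction x arbitrary: w w')
    case (Cons g x)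
    have "foldr (gen_mult \<theta>) (g # x) tg_one = tg_mult \<theta> (gen_mult \<theta> g tg_one) (foldr (gen_mult \<theta>) x tg_one)"
      by (simp add: gen_mult_tg_mult[OF \<theta>, symmetric])
    then have "tg_mult \<theta> (tg_mult \<theta> w (gen_mult \<theta> g tg_one)) (foldr (gen_mult \<theta>) x tg_one)
        = tg_mult \<theta> (tg_mult \<theta> w' (gen_mult \<theta> g tg_one)) (foldr (gen_mult \<theta>) x tg_one)"
      using Cons.prems by (simp only: tg_mult_assoc[OF \<theta>, symmetric])
    then have "tg_mult \<theta> w (gen_mult \<theta> g tg_one) = tg_mult \<theta> w' (gen_mult \<theta> g tg_one)"
      by (rule Cons.IH)
    then show ?case by (rule tg_mult_gen_cancel[OF \<theta>])
  qed simp
  then show "w = w'" if "tg_mult \<theta> w v = tg_mult \<theta> w' v" for w w'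
    using that tg_eval_normal_form[of \<theta> "fst v" "snd v"] by (metis prod.collapse tg_eval_def)
qed


section \<open>The left regular algebra and right multiplication\<close>

lemma clinear_left_regular [simp]:
  "clinear_op (left_regular_E \<theta> i)" "clinear_op (left_regular_F \<theta> j)"
  by (simp_all add: left_regular_E_def left_regular_F_def clinear_shift_op)

lemmas alg_L_subalgebra =
  unital_subalgebra_two_graph_alg[where S = "left_regular_E \<theta>" and T = "left_regular_F \<theta>" for \<theta>,
    OF clinear_left_regular]

abbreviation reg_op :: "('m \<times> 'n \<Rightarrow> 'm \<times> 'n) \<Rightarrow> ('m, 'n) tg \<Rightarrow> ('m, 'n) tg ell2 \<Rightarrow>\<^sub>L ('m, 'n) tg ell2" where
  "reg_op \<theta> \<equiv> rep_op (left_regular_E \<theta>) (left_regular_F \<theta>)"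

lemma reg_op_ket:
  assumes "bij \<theta>"
  shows "blinfun_apply (reg_op \<theta> w) (ket v) = ket (tg_mult \<theta> w v)"
proof -
  have "blinfun_apply (word_op (left_regular_E \<theta>) u) (ket p) = ket (foldr (gen_mult \<theta>) (map Inl u) p)" for u p
    by (induction u) (simp_all add: left_regular_ket[OF assms])
  moreover have "blinfun_apply (word_op (left_regular_F \<theta>) u) (ket p) = ket (foldr (gen_mult \<theta>) (map Inr u) p)" for u p
    by (induction u) (simp_all add: left_regular_ket[OF assms])
  ultimately show ?thesis by (simp add: rep_op_def tg_mult_def)
qed

text \<open>Left and right multiplications commute by associativity, so for bijective
  \<open>\<theta>\<close> these isometries lie in the commutant of
  \<open>alg_L \<theta>\<close>.\<close>

definition right_shift :: "('m \<times> 'n \<Rightarrow> 'm \<times> 'n) \<Rightarrow> ('m, 'n) tg \<Rightarrow> ('m, 'n) tg ell2 \<Rightarrow>\<^sub>L ('m, 'n) tg ell2" where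
  "right_shift \<theta> v = shift_op (\<lambda>w. tg_mult \<theta> w v)"

lemma clinear_right_shift [simp]: "clinear_op (right_shift \<theta> v)"
  by (simp add: right_shift_def clinear_shift_op)

lemma alg_L_commute_right_shift:
  assumes \<theta>: "bij \<theta>" and B: "B \<in> alg_L \<theta>"
  shows "B o\<^sub>L right_shift \<theta> v = right_shift \<theta> v o\<^sub>L B"
proof -
  let ?R = "right_shift \<theta> v"
  let ?X = "{B. clinear_op B \<and> B o\<^sub>L ?R = ?R o\<^sub>L B}"
  have comm: "shift_op (gen_mult \<theta> g) o\<^sub>L ?R = ?R o\<^sub>L shift_op (gen_mult \<theta> g)" for g
    unfolding right_shift_def
    by (simp add: shift_op_compose inj_gen_mult[OF \<theta>] inj_tg_mult[OF \<theta>] comp_def gen_mult_tg_mult[OF \<theta>])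
  have "alg_L \<theta> \<subseteq> ?X"
  proof (rule two_graph_alg_minimal)
    show "unital_subalgebra ?X"
      unfolding unital_subalgebra_def
    proof (intro conjI ballI allI)
      fix A B assume "A \<in> ?X" "B \<in> ?X"
      then have A: "clinear_op A" "\<And>x. blinfun_apply A (blinfun_apply ?R x) = blinfun_apply ?R (blinfun_apply A x)"
        and B: "clinear_op B" "\<And>x. blinfun_apply B (blinfun_apply ?R x) = blinfun_apply ?R (blinfun_apply B x)"
        by (auto dest!: arg_cong[where f = blinfun_apply] simp: fun_eq_iff)
      show "A + B \<in> ?X" "A o\<^sub>L B \<in> ?X"
        by (auto intro!: blinfun_eqI A B simp: blinfun.add_left blinfun.add_right A B)
    next
      fix A c assume "A \<in> ?X"
      then have A: "clinear_op A" "\<And>x. blinfun_apply A (blinfun_apply ?R x) = blinfun_apply ?R (blinfun_apply A x)"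
        by (auto dest!: arg_cong[where f = blinfun_apply] simp: fun_eq_iff)
      show "c *\<^sub>O A \<in> ?X" by (auto intro!: blinfun_eqI A simp: A clinear_opD[OF clinear_right_shift])
    qed (auto intro: blinfun_eqI)
    \<comment> \<open>Moving \<open>?R\<close> to the other side as its adjoint leaves only matrix
      coefficients of \<open>B\<close>, which shows the condition to be WOT-closed.\<close>
    have "B \<in> ?X \<longleftrightarrow> clinear_op B \<and> (\<forall>(x, y)\<in>UNIV. cinner (blinfun_apply B (blinfun_apply ?R x)) y
        = cinner (blinfun_apply B x) (blinfun_apply (adj ?R) y))" for B
    proof -
      have "B o\<^sub>L ?R = ?R o\<^sub>L B"
        if "\<And>x y. cinner (blinfun_apply B (blinfun_apply ?R x)) y = cinner (blinfun_apply B x) (blinfun_apply (adj ?R) y)"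
        using that by (intro blinfun_eqI cinner_ext_left) (simp add: cinner_adj)
      moreover have "cinner (blinfun_apply B (blinfun_apply ?R x)) y = cinner (blinfun_apply B x) (blinfun_apply (adj ?R) y)"
        if "B o\<^sub>L ?R = ?R o\<^sub>L B" for x y
        using arg_cong[OF that, of "\<lambda>A. blinfun_apply A x"] by (simp add: cinner_adj[symmetric])
      ultimately show ?thesis by auto
    qed
    then have X: "?X = {B. clinear_op B} \<inter> {B. \<forall>p\<in>UNIV. cinner (blinfun_apply B (blinfun_apply ?R (fst p))) (snd p)
        = cinner (blinfun_apply B (fst p)) (blinfun_apply (adj ?R) (snd p))}" by auto
    show "closedin wot ?X"
      unfolding X by (intro closedin_Int closedin_wot_clinear closedin_wot_equations continuous_map_wot)
  qed (use comm in \<open>simp_all add: left_regular_E_def left_regular_F_def clinear_shift_op\<close>)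
  then show ?thesis using B by blast
qed

definition fourier_coeff :: "(('m, 'n) tg ell2 \<Rightarrow>\<^sub>L ('m, 'n) tg ell2) \<Rightarrow> ('m, 'n) tg \<Rightarrow> complex" where
  "fourier_coeff B w = cinner (blinfun_apply B (ket tg_one)) (ket w)"

lemma cmod_fourier_coeff_le: "cmod (fourier_coeff B w) \<le> norm B"
  using cmod_cinner_blinfun_le[of B "ket tg_one" "ket w"] by (simp add: fourier_coeff_def)

text \<open>\<open>ket p\<close> is the right translate of \<open>ket tg_one\<close> by
  \<open>p\<close>, and \<open>B\<close> commutes with right translation. So the matrix of
  \<open>B\<close> is of Toeplitz type and is determined by its first column.\<close>

lemma alg_L_ket:
  assumes \<theta>: "bij \<theta>" and B: "B \<in> alg_L \<theta>"
  shows "cinner (blinfun_apply B (ket p)) (ket (tg_mult \<theta> w p)) = fourier_coeff B w"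
    and "q \<notin> range (\<lambda>w. tg_mult \<theta> w p) \<Longrightarrow> cinner (blinfun_apply B (ket p)) (ket q) = 0"
proof -
  note inj = inj_tg_mult[OF \<theta>]
  have R: "blinfun_apply (right_shift \<theta> p) (ket v) = ket (tg_mult \<theta> v p)" for v
    by (simp add: right_shift_def shift_op_ket inj)
  have "blinfun_apply B (blinfun_apply (right_shift \<theta> p) (ket tg_one))
      = blinfun_apply (right_shift \<theta> p) (blinfun_apply B (ket tg_one))"
    using alg_L_commute_right_shift[OF \<theta> B, of p] by (metis blinfun_apply_blinfun_compose)
  then have Bp: "blinfun_apply B (ket p) = blinfun_apply (right_shift \<theta> p) (blinfun_apply B (ket tg_one))"
    by (simp add: R)
  show "cinner (blinfun_apply B (ket p)) (ket (tg_mult \<theta> w p)) = fourier_coeff B w"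
    unfolding Bp fourier_coeff_def R[symmetric] unfolding right_shift_def by (rule cinner_shift_op[OF inj])
  show "cinner (blinfun_apply B (ket p)) (ket q) = 0" if "q \<notin> range (\<lambda>w. tg_mult \<theta> w p)"
    unfolding Bp cinner_ket_right right_shift_def shift_op_apply ell2_shift.rep_eq using that by simp
qed


section \<open>Cesaro means\<close>

text \<open>Fejer weights in the total length. The coefficients \<open>b\<close> are a separate
  argument so that the same polynomial can be evaluated at \<open>(S, T)\<close> and at the left
  regular representation.\<close>

definition cesaro :: "('m::finite \<Rightarrow> 'h::chilbert_space \<Rightarrow>\<^sub>L 'h) \<Rightarrow> ('n::finite \<Rightarrow> 'h \<Rightarrow>\<^sub>L 'h) \<Rightarrow> nat \<Rightarrow>
    (('m, 'n) tg \<Rightarrow> complex) \<Rightarrow> 'h \<Rightarrow>\<^sub>L 'h" where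
  "cesaro S T N b = (\<Sum>w | tg_len w < N. (complex_of_real (real (N - tg_len w) / real N) * b w) *\<^sub>O rep_op S T w)"

abbreviation reg_cesaro :: "('m::finite \<times> 'n::finite \<Rightarrow> 'm \<times> 'n) \<Rightarrow> nat \<Rightarrow> (('m, 'n) tg ell2 \<Rightarrow>\<^sub>L ('m, 'n) tg ell2)
    \<Rightarrow> (('m, 'n) tg ell2 \<Rightarrow>\<^sub>L ('m, 'n) tg ell2)" where
  "reg_cesaro \<theta> N B \<equiv> cesaro (left_regular_E \<theta>) (left_regular_F \<theta>) N (fourier_coeff B)"

lemma cesaro_in_subalgebra:
  assumes "unital_subalgebra \<A>" "\<And>i. S i \<in> \<A>" "\<And>j. T j \<in> \<A>"
  shows "cesaro S T N b \<in> \<A>"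
  unfolding cesaro_def
  by (intro unital_subalgebra_sum[OF assms(1)] unital_subalgebraD(5)[OF assms(1)]
      unital_subalgebra_rep_op assms)

lemma reg_cesaro_in_alg_L: "cesaro (left_regular_E \<theta>) (left_regular_F \<theta>) N b \<in> alg_L \<theta>"
  by (intro cesaro_in_subalgebra alg_L_subalgebra two_graph_alg_gen)

text \<open>On \<open>alg_L \<theta>\<close> the mean is a Schur multiplier in the difference of
  degrees. The subtraction is truncated; when \<open>q\<close> is shorter than \<open>p\<close> the
  factor does not matter because the entry is zero.\<close>

lemma reg_cesaro_ket:
  assumes \<theta>: "bij \<theta>" and B: "B \<in> alg_L \<theta>"
  shows "cinner (blinfun_apply (reg_cesaro \<theta> N B) (ket p)) (ket q)
    = complex_of_real (real (N - (tg_len q - tg_len p)) / real N) * cinner (blinfun_apply B (ket p)) (ket q)"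
proof -
  have lhs: "cinner (blinfun_apply (reg_cesaro \<theta> N B) (ket p)) (ket q)
      = (\<Sum>w | tg_len w < N. if tg_mult \<theta> w p = q
          then complex_of_real (real (N - tg_len w) / real N) * fourier_coeff B w else 0)"
    unfolding cesaro_def blinfun_sum_left cinner_sum_left
    by (intro sum.cong) (auto simp: cinner_scaleC_left reg_op_ket[OF \<theta>] cinner_ket_right ell2_coord_ket)
  show ?thesis
  proof (cases "q \<in> range (\<lambda>w. tg_mult \<theta> w p)")
    case True
    then obtain w where q: "q = tg_mult \<theta> w p" by blast
    have "tg_mult \<theta> v p = q \<longleftrightarrow> w = v" for v
      using inj_tg_mult[OF \<theta>, THEN injD] q by blast
    then have "cinner (blinfun_apply (reg_cesaro \<theta> N B) (ket p)) (ket q)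
        = (if tg_len w < N then complex_of_real (real (N - tg_len w) / real N) * fourier_coeff B w else 0)"
      unfolding lhs by (simp only: sum.delta'[OF finite_tg_len_less] mem_Collect_eq)
    moreover have "tg_len q - tg_len p = tg_len w" by (simp add: q tg_len_mult)
    ultimately show ?thesis using alg_L_ket(1)[OF \<theta> B, of p w] by (simp add: q)
  next
    case False
    then have "cinner (blinfun_apply (reg_cesaro \<theta> N B) (ket p)) (ket q) = 0"
      unfolding lhs by (intro sum.neutral) auto
    then show ?thesis using alg_L_ket(2)[OF \<theta> B False] by simp
  qed
qed

text \<open>The degrees run through the interval of length \<open>N\<close> ending at
  \<open>a\<close>. Writing its lower end as \<open>a < tg_len w + N\<close> avoids truncated
  subtraction for small \<open>a\<close>.\<close>

definition window :: "nat \<Rightarrow> ('m, 'n) tg set \<Rightarrow> nat \<Rightarrow> ('m, 'n) tg set" where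
  "window N F a = {w \<in> F. tg_len w \<le> a \<and> a < tg_len w + N}"

lemma finite_window [simp]: "finite F \<Longrightarrow> finite (window N F a)"
  by (simp add: window_def)

lemma cinner_fin_part:
  assumes "clinear_op A"
  shows "cinner (blinfun_apply A (fin_part F x)) (fin_part G y)
    = (\<Sum>p\<in>F. \<Sum>q\<in>G. ell2_coord x p * cnj (ell2_coord y q) * cinner (blinfun_apply A (ket p)) (ket q))"
proof -
  have "cinner (blinfun_apply A (fin_part F x)) (fin_part G y)
      = (\<Sum>p\<in>F. ell2_coord x p * cinner (blinfun_apply A (ket p)) (fin_part G y))"
    by (simp add: fin_part_def[of F] blinfun.sum_right clinear_opD[OF assms] cinner_sum_left cinner_scaleC_left)
  then show ?thesis
    by (simp add: fin_part_def[of G] cinner_sum_right cinner_scaleC_right sum_distrib_left mult.assoc)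
qed

text \<open>The two degrees \<open>d \<le> d'\<close> lie in \<open>N - (d' - d)\<close> common windows of length \<open>N\<close>, so the
  Cesaro mean is the average of the compressions to windows.\<close>

lemma reg_cesaro_window:
  assumes \<theta>: "bij \<theta>" and B: "B \<in> alg_L \<theta>" and F: "finite F" and M: "\<And>w. w \<in> F \<Longrightarrow> tg_len w + N \<le> M" and N: "N > 0"
  shows "of_nat N * cinner (blinfun_apply (reg_cesaro \<theta> N B) (fin_part F x)) (fin_part F y)
    = (\<Sum>a<M. cinner (blinfun_apply B (fin_part (window N F a) x)) (fin_part (window N F a) y))"
proof -
  have clB: "clinear_op B" using B unital_subalgebraD(1)[OF alg_L_subalgebra] by blast
  have clC: "clinear_op (reg_cesaro \<theta> N B)"
    using reg_cesaro_in_alg_L unital_subalgebraD(1)[OF alg_L_subalgebra] by blast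
  define c where "c p q = ell2_coord x p * cnj (ell2_coord y q) * cinner (blinfun_apply B (ket p)) (ket q)" for p q
  have "(\<Sum>a<M. cinner (blinfun_apply B (fin_part (window N F a) x)) (fin_part (window N F a) y))
      = (\<Sum>a<M. \<Sum>p\<in>F. \<Sum>q\<in>F. if p \<in> window N F a \<and> q \<in> window N F a then c p q else 0)"
    unfolding cinner_fin_part[OF clB] c_def[symmetric]
  proof (rule sum.cong[OF HOL.refl])
    fix a
    have w: "window N F a = {w \<in> F. w \<in> window N F a}" by (auto simp: window_def)
    show "(\<Sum>p\<in>window N F a. sum (c p) (window N F a))
        = (\<Sum>p\<in>F. \<Sum>q\<in>F. if p \<in> window N F a \<and> q \<in> window N F a then c p q else 0)"
      by (subst (1 2) w, subst (1 2) sum.inter_filter[OF F]) (auto intro!: sum.cong)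
  qed
  also have "\<dots> = (\<Sum>p\<in>F. \<Sum>q\<in>F. \<Sum>a<M. if p \<in> window N F a \<and> q \<in> window N F a then c p q else 0)"
    by (subst sum.swap, rule sum.cong[OF HOL.refl], rule sum.swap)
  also have "\<dots> = (\<Sum>p\<in>F. \<Sum>q\<in>F. of_nat (N - (tg_len q - tg_len p)) * c p q)"
  proof (intro sum.cong HOL.refl)
    fix p q assume pq: "p \<in> F" "q \<in> F"
    show "(\<Sum>a<M. if p \<in> window N F a \<and> q \<in> window N F a then c p q else 0)
        = of_nat (N - (tg_len q - tg_len p)) * c p q"
    proof (cases "tg_len p \<le> tg_len q")
      case True
      \<comment> \<open>A window contains both words iff it ends no earlier than the longer one and
        begins no later than the shorter one. \<open>M\<close> is large enough that none of these
        windows is cut off.\<close>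
      have "{a \<in> {..<M}. p \<in> window N F a \<and> q \<in> window N F a} = {tg_len q..<tg_len p + N}"
        using pq M[OF pq(1)] True by (auto simp: window_def)
      then show ?thesis
        using True by (simp add: sum.inter_filter[symmetric]) (simp add: diff_diff_eq2 add.commute)
    next
      case False
      then have "q \<notin> range (\<lambda>w. tg_mult \<theta> w p)" by (auto simp: tg_len_mult)
      then have "c p q = 0" using alg_L_ket(2)[OF \<theta> B] by (simp add: c_def)
      then show ?thesis by (auto intro: sum.neutral)
    qed
  qed
  also have "\<dots> = of_nat N * cinner (blinfun_apply (reg_cesaro \<theta> N B) (fin_part F x)) (fin_part F y)"
    unfolding cinner_fin_part[OF clC] reg_cesaro_ket[OF \<theta> B] sum_distrib_left c_def
    using N by (intro sum.cong) simp_all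
  finally show ?thesis by simp
qed

text \<open>Each word of \<open>F\<close> lies in exactly \<open>N\<close> of the windows, so its
  coordinate is counted \<open>N\<close> times.\<close>

lemma sum_window_norm:
  assumes F: "finite F" and M: "\<And>w. w \<in> F \<Longrightarrow> tg_len w + N \<le> M"
  shows "(\<Sum>a<M. (norm (fin_part (window N F a) x))\<^sup>2) = real N * (norm (fin_part F x))\<^sup>2"
proof -
  have "(\<Sum>a<M. (norm (fin_part (window N F a) x))\<^sup>2)
      = (\<Sum>a<M. \<Sum>w\<in>F. if w \<in> window N F a then (cmod (ell2_coord x w))\<^sup>2 else 0)"
  proof (rule sum.cong[OF HOL.refl])
    fix a
    have w: "window N F a = {w \<in> F. w \<in> window N F a}" by (auto simp: window_def)
    show "(norm (fin_part (window N F a) x))\<^sup>2 = (\<Sum>w\<in>F. if w \<in> window N F a then (cmod (ell2_coord x w))\<^sup>2 else 0)"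
      using F unfolding norm_fin_part_sq[OF finite_window[OF F]] by (subst w, subst sum.inter_filter) auto
  qed
  also have "\<dots> = (\<Sum>w\<in>F. \<Sum>a<M. if w \<in> window N F a then (cmod (ell2_coord x w))\<^sup>2 else 0)"
    by (rule sum.swap)
  also have "\<dots> = (\<Sum>w\<in>F. real N * (cmod (ell2_coord x w))\<^sup>2)"
  proof (intro sum.cong HOL.refl)
    fix w assume w: "w \<in> F"
    have "{a \<in> {..<M}. w \<in> window N F a} = {tg_len w..<tg_len w + N}"
      using w M[OF w] by (auto simp: window_def)
    then show "(\<Sum>a<M. if w \<in> window N F a then (cmod (ell2_coord x w))\<^sup>2 else 0) = real N * (cmod (ell2_coord x w))\<^sup>2"
      by (simp add: sum.inter_filter[symmetric])
  qed
  finally show ?thesis by (simp add: norm_fin_part_sq[OF F] sum_distrib_left)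
qed

text \<open>\<open>N\<close> times the mean is a sum of window compressions of \<open>B\<close>.
  Cauchy-Schwarz over the windows gives a factor \<open>sqrt N\<close> for each of \<open>x\<close>
  and \<open>y\<close>, and these cancel the \<open>N\<close>. The windows must be finite in number,
  hence the reduction to finite parts.\<close>

lemma matrix_norm_reg_cesaro_le:
  fixes \<theta> :: "'a::finite \<times> 'b::finite \<Rightarrow> 'a \<times> 'b"
  assumes \<theta>: "bij \<theta>" and B: "\<And>i j. i < k \<Longrightarrow> j < k \<Longrightarrow> B i j \<in> alg_L \<theta>"
  shows "matrix_norm k (\<lambda>i j. reg_cesaro \<theta> N (B i j)) \<le> matrix_norm k B"
proof (rule matrix_norm_leI[OF matrix_norm_nonneg])
  fix x y :: "nat \<Rightarrow> ('a, 'b) tg ell2"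
  let ?C = "\<lambda>i j. reg_cesaro \<theta> N (B i j)"
  let ?X = "L2_set (\<lambda>j. norm (x j)) {..<k}" and ?Y = "L2_set (\<lambda>j. norm (y j)) {..<k}"
  have fin: "cmod (matrix_form k ?C (\<lambda>j. fin_part F (x j)) (\<lambda>i. fin_part F (y i))) \<le> matrix_norm k B * ?X * ?Y"
    if F: "finite F" for F
  proof (cases "N = 0")
    case True
    then have "?C i j = 0" for i j by (simp add: cesaro_def)
    then show ?thesis by (simp add: matrix_form_def matrix_norm_nonneg L2_set_nonneg)
  next
    case False
    then have N: "N > 0" by simp
    define M where "M = Max (insert 0 (tg_len ` F)) + N"
    have M: "tg_len w + N \<le> M" if "w \<in> F" for w
      using F that by (auto simp: M_def intro!: Max_ge)
    define s where "s x a = L2_set (\<lambda>j. norm (fin_part (window N F a) (x j))) {..<k}" for x a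
    have L2s: "L2_set (s x) {..<M} \<le> sqrt (real N) * L2_set (\<lambda>j. norm (x j)) {..<k}" for x
    proof -
      have "(L2_set (s x) {..<M})\<^sup>2 = (\<Sum>a<M. \<Sum>j<k. (norm (fin_part (window N F a) (x j)))\<^sup>2)"
        by (simp add: L2_set_def s_def sum_nonneg)
      also have "\<dots> = (\<Sum>j<k. real N * (norm (fin_part F (x j)))\<^sup>2)"
        by (subst sum.swap) (simp add: sum_window_norm[OF F M])
      also have "\<dots> \<le> (\<Sum>j<k. real N * (norm (x j))\<^sup>2)"
        by (intro sum_mono mult_left_mono power_mono norm_fin_part_le F) auto
      also have "\<dots> = (sqrt (real N) * L2_set (\<lambda>j. norm (x j)) {..<k})\<^sup>2"
        by (simp add: power_mult_distrib L2_set_def sum_nonneg sum_distrib_left)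
      finally show ?thesis by (rule power2_le_imp_le) (simp add: L2_set_nonneg)
    qed
    have "of_nat N * matrix_form k ?C (\<lambda>j. fin_part F (x j)) (\<lambda>i. fin_part F (y i))
        = (\<Sum>i<k. \<Sum>j<k. \<Sum>a<M. cinner (blinfun_apply (B i j) (fin_part (window N F a) (x j))) (fin_part (window N F a) (y i)))"
      unfolding matrix_form_def sum_distrib_left
      by (intro sum.cong HOL.refl reg_cesaro_window[OF \<theta> _ F M N] B) auto
    also have "\<dots> = (\<Sum>a<M. matrix_form k B (\<lambda>j. fin_part (window N F a) (x j)) (\<lambda>i. fin_part (window N F a) (y i)))"
      unfolding matrix_form_def
      by (rule HOL.trans[OF sum.cong[OF HOL.refl sum.swap] sum.swap])
    finally have "real N * cmod (matrix_form k ?C (\<lambda>j. fin_part F (x j)) (\<lambda>i. fin_part F (y i)))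
        = cmod (\<Sum>a<M. matrix_form k B (\<lambda>j. fin_part (window N F a) (x j)) (\<lambda>i. fin_part (window N F a) (y i)))"
      by (auto simp: norm_mult dest: arg_cong[where f = cmod])
    also have "\<dots> \<le> (\<Sum>a<M. matrix_norm k B * (s x a * s y a))"
      unfolding s_def mult.assoc[symmetric] by (intro sum_norm_le matrix_form_le)
    also have "\<dots> = matrix_norm k B * (\<Sum>a<M. \<bar>s x a\<bar> * \<bar>s y a\<bar>)"
      by (simp add: sum_distrib_left s_def L2_set_nonneg)
    also have "\<dots> \<le> matrix_norm k B * (L2_set (s x) {..<M} * L2_set (s y) {..<M})"
      by (intro mult_left_mono L2_set_mult_ineq matrix_norm_nonneg)
    also have "\<dots> \<le> matrix_norm k B * ((sqrt (real N) * ?X) * (sqrt (real N) * ?Y))"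
      by (intro mult_left_mono mult_mono L2s matrix_norm_nonneg) (auto simp: L2_set_nonneg)
    also have "\<dots> = (sqrt (real N) * sqrt (real N)) * (matrix_norm k B * ?X * ?Y)"
      by (simp only: ac_simps)
    also have "sqrt (real N) * sqrt (real N) = real N" by simp
    finally show ?thesis using N by simp
  qed
  have "((\<lambda>F. cmod (matrix_form k ?C (\<lambda>j. fin_part F (x j)) (\<lambda>i. fin_part F (y i)))) \<longlongrightarrow> cmod (matrix_form k ?C x y))
      (finite_subsets_at_top UNIV)"
    unfolding matrix_form_def
    by (intro tendsto_norm tendsto_sum bounded_bilinear.tendsto[OF bounded_bilinear_cinner]
        blinfun.tendsto tendsto_const fin_part_tendsto)
  then show "cmod (matrix_form k ?C x y) \<le> matrix_norm k B * ?X * ?Y"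
    by (rule tendsto_upperbound[OF _ eventually_finite_subsets_at_top_weakI[OF fin] finite_subsets_at_top_neq_bot])
qed

lemma norm_reg_cesaro_le:
  assumes "bij \<theta>" "B \<in> alg_L \<theta>"
  shows "norm (reg_cesaro \<theta> N B) \<le> norm B"
  using matrix_norm_reg_cesaro_le[OF assms(1), of 1 "\<lambda>_ _. B" N] assms(2)
  unfolding matrix_norm_1 by simp


text \<open>On basis vectors the error is at most \<open>d / N\<close> times \<open>norm B\<close>,
  with \<open>d\<close> the difference of degrees, whatever \<open>B\<close> is. Two applications of
  \<open>closed_csubspace_uniform_null\<close>, one per argument, extend this to all vectors.
  Uniformity in \<open>B\<close> later turns weak convergence into norm approximation of
  functionals.\<close>

lemma reg_cesaro_uniform:
  fixes \<theta> :: "'m::finite \<times> 'n::finite \<Rightarrow> 'm \<times> 'n"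
  assumes \<theta>: "bij \<theta>" and \<epsilon>: "\<epsilon> > 0"
  shows "\<forall>\<^sub>F N in sequentially. \<forall>B\<in>alg_L \<theta>. cmod (cinner (blinfun_apply (B - reg_cesaro \<theta> N B) x) y) \<le> \<epsilon> * norm B"
proof -
  define f where "f N B x y = cmod (cinner (blinfun_apply (B - reg_cesaro \<theta> N B) x) y)" for N B x y
  define U where "U x y \<longleftrightarrow> (\<forall>\<epsilon>>0. \<forall>\<^sub>F N in sequentially. \<forall>B\<in>alg_L \<theta>. f N B x y \<le> \<epsilon> * norm B)" for x y
  have cl: "clinear_op (B - reg_cesaro \<theta> N B)" if "B \<in> alg_L \<theta>" for N B
  proof -
    have "clinear_op B" "clinear_op (reg_cesaro \<theta> N B)"
      using that reg_cesaro_in_alg_L unital_subalgebraD(1)[OF alg_L_subalgebra] by blast+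
    then show ?thesis by (simp add: clinear_op_def blinfun.diff_left scaleC_diff_right)
  qed
  have bound: "f N B x y \<le> 2 * norm B * norm x * norm y" if "B \<in> alg_L \<theta>" for N B x y
  proof -
    have "f N B x y \<le> norm (B - reg_cesaro \<theta> N B) * norm x * norm y"
      unfolding f_def by (rule cmod_cinner_blinfun_le)
    also have "norm (B - reg_cesaro \<theta> N B) \<le> 2 * norm B"
      using norm_triangle_ineq4[of B "reg_cesaro \<theta> N B"] norm_reg_cesaro_le[OF \<theta> that, of N] by linarith
    finally show ?thesis by (simp add: mult_right_mono)
  qed
  have sub1: "closed_csubspace {x. U x y}" for y
    unfolding U_def
  proof (rule closed_csubspace_uniform_null[where C = "2 * norm y"])
    fix N B x x' c assume B: "B \<in> alg_L \<theta>"
    show "f N B (x + x') y \<le> f N B x y + f N B x' y"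
      by (simp add: f_def blinfun.add_right cinner_add_left norm_triangle_ineq)
    show "f N B (c *\<^sub>C x) y = cmod c * f N B x y"
      by (simp add: f_def clinear_opD[OF cl[OF B]] cinner_scaleC_left norm_mult)
    show "f N B x y \<le> 2 * norm y * norm B * norm x" using bound[OF B] by (simp add: ac_simps)
  qed simp
  have sub2: "closed_csubspace {y. U x y}" for x
    unfolding U_def
  proof (rule closed_csubspace_uniform_null[where C = "2 * norm x"])
    fix N B y y' c assume B: "B \<in> alg_L \<theta>"
    show "f N B x (y + y') \<le> f N B x y + f N B x y'"
      by (simp add: f_def cinner_add_right norm_triangle_ineq)
    show "f N B x (c *\<^sub>C y) = cmod c * f N B x y"
      by (simp add: f_def cinner_scaleC_right norm_mult)
    show "f N B x y \<le> 2 * norm x * norm B * norm y" using bound[OF B] by (simp add: ac_simps)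
  qed simp
  have ket: "U (ket p) (ket q)" for p q
    unfolding U_def
  proof (intro allI impI)
    fix \<epsilon> :: real assume \<epsilon>: "\<epsilon> > 0"
    define d where "d = tg_len q - tg_len p"
    obtain N0 where N0: "real d / \<epsilon> < real N0" using reals_Archimedean2 by blast
    show "\<forall>\<^sub>F N in sequentially. \<forall>B\<in>alg_L \<theta>. f N B (ket p) (ket q) \<le> \<epsilon> * norm B"
      unfolding eventually_sequentially
    proof (intro exI allI impI ballI)
      fix N B assume N: "max 1 N0 \<le> N" and B: "B \<in> alg_L \<theta>"
      have N': "N > 0" "real d < \<epsilon> * real N"
        using N N0 \<epsilon> by (auto simp: divide_less_eq mult.commute intro: less_le_trans)
      let ?t = "1 - real (N - d) / real N"
      have "cinner (blinfun_apply (B - reg_cesaro \<theta> N B) (ket p)) (ket q)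
          = complex_of_real ?t * cinner (blinfun_apply B (ket p)) (ket q)"
        by (simp add: blinfun.diff_left cinner_diff_left reg_cesaro_ket[OF \<theta> B] d_def algebra_simps)
      then have "f N B (ket p) (ket q) = \<bar>?t\<bar> * cmod (cinner (blinfun_apply B (ket p)) (ket q))"
        by (simp only: f_def norm_mult norm_of_real)
      also have "\<dots> \<le> \<epsilon> * norm B"
      proof (rule mult_mono)
        have t: "?t = (real N - real (N - d)) / real N" using N' by (simp add: diff_divide_distrib)
        have "\<bar>?t\<bar> = (real N - real (N - d)) / real N" unfolding t by simp
        also have "\<dots> \<le> real d / real N" by (intro divide_right_mono) linarith+
        also have "\<dots> \<le> \<epsilon>" using N' by (simp add: divide_le_eq)
        finally show "\<bar>?t\<bar> \<le> \<epsilon>" .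
        show "cmod (cinner (blinfun_apply B (ket p)) (ket q)) \<le> norm B"
          using cmod_cinner_blinfun_le[of B "ket p" "ket q"] by simp
      qed (use \<epsilon> in auto)
      finally show "f N B (ket p) (ket q) \<le> \<epsilon> * norm B" .
    qed
  qed
  have "U (ket p) y" for p y using closed_csubspace_ket[OF sub2, of "ket p" y] ket by blast
  then have "U x y" using closed_csubspace_ket[OF sub1, of y x] by blast
  then show ?thesis using \<epsilon> unfolding U_def f_def by blast
qed


lemma reg_cesaro_tendsto:
  assumes \<theta>: "bij \<theta>" and B: "B \<in> alg_L \<theta>"
  shows "(\<lambda>N. cinner (blinfun_apply (reg_cesaro \<theta> N B) x) y) \<longlonglongrightarrow> cinner (blinfun_apply B x) y"
proof (rule tendstoI)
  fix e :: real assume e: "e > 0"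
  define \<delta> where "\<delta> = e / (norm B + 1)"
  have nB: "norm B + 1 > 0" using norm_ge_zero[of B] by linarith
  have \<delta>: "\<delta> > 0" using e nB by (simp add: \<delta>_def)
  have "\<delta> * norm B < \<delta> * (norm B + 1)" using \<delta> by (intro mult_strict_left_mono) auto
  also have "\<dots> = e" using nB by (simp add: \<delta>_def)
  finally have \<delta>B: "\<delta> * norm B < e" .
  from reg_cesaro_uniform[OF \<theta> \<delta>, of x y]
  show "\<forall>\<^sub>F N in sequentially. dist (cinner (blinfun_apply (reg_cesaro \<theta> N B) x) y) (cinner (blinfun_apply B x) y) < e"
  proof eventually_elim
    case (elim N)
    then have "cmod (cinner (blinfun_apply (B - reg_cesaro \<theta> N B) x) y) < e"
      using B \<delta>B by (intro le_less_trans[OF _ \<delta>B]) blast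
    then show ?case by (simp add: dist_norm norm_minus_commute blinfun.diff_left cinner_diff_left)
  qed
qed


section \<open>Finite rank functionals\<close>

definition pair_functional :: "('a::chilbert_space \<times> 'a) list \<Rightarrow> ('a \<Rightarrow>\<^sub>L 'a) \<Rightarrow> complex" where
  "pair_functional xs B = (\<Sum>(u, v)\<leftarrow>xs. cinner (blinfun_apply B u) v)"

text \<open>By the inequality of arithmetic and geometric means this dominates the norm of the
  functional. It also bounds both square sums directly, so bounded cost yields two square summable
  sequences.\<close>

definition pair_cost :: "('a::chilbert_space \<times> 'a) list \<Rightarrow> real" where
  "pair_cost xs = (\<Sum>(u, v)\<leftarrow>xs. ((norm u)\<^sup>2 + (norm v)\<^sup>2) / 2)"

lemma pair_functional_simps [simp]:
  "pair_functional [] B = 0"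
  "pair_functional ((u, v) # xs) B = cinner (blinfun_apply B u) v + pair_functional xs B"
  "pair_functional (xs @ ys) B = pair_functional xs B + pair_functional ys B"
  by (simp_all add: pair_functional_def)

lemma pair_cost_simps [simp]:
  "pair_cost [] = 0"
  "pair_cost ((u, v) # xs) = ((norm u)\<^sup>2 + (norm v)\<^sup>2) / 2 + pair_cost xs"
  "pair_cost (xs @ ys) = pair_cost xs + pair_cost ys"
  by (simp_all add: pair_cost_def)

lemma pair_functional_linear:
  "pair_functional xs (A + B) = pair_functional xs A + pair_functional xs B"
  "pair_functional xs (A - B) = pair_functional xs A - pair_functional xs B"
  "pair_functional xs (c *\<^sub>O A) = c * pair_functional xs A"
  by (induction xs) (auto simp: blinfun.add_left blinfun.diff_left cinner_add_left cinner_diff_left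
      cinner_scaleC_left distrib_left)

lemma cmod_pair_functional_le: "cmod (pair_functional xs B) \<le> pair_cost xs * norm B"
proof (induction xs)
  case (Cons p xs)
  obtain u v where p: "p = (u, v)" by (cases p)
  have "cmod (cinner (blinfun_apply B u) v) \<le> norm B * (norm u * norm v)"
    using cmod_cinner_blinfun_le[of B u v] by (simp add: mult.assoc)
  also have "\<dots> \<le> norm B * (((norm u)\<^sup>2 + (norm v)\<^sup>2) / 2)"
    using zero_le_power2[of "norm u - norm v"] by (intro mult_left_mono) (auto simp: power2_diff)
  finally have "cmod (cinner (blinfun_apply B u) v) \<le> ((norm u)\<^sup>2 + (norm v)\<^sup>2) / 2 * norm B"
    by (simp only: mult.commute)
  moreover have "cmod (cinner (blinfun_apply B u) v + pair_functional xs B)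
      \<le> cmod (cinner (blinfun_apply B u) v) + cmod (pair_functional xs B)" by (rule norm_triangle_ineq)
  ultimately show ?case using Cons unfolding p pair_functional_simps pair_cost_simps distrib_right by linarith
qed simp

text \<open>The square root on each side makes both functional and cost scale by \<open>t\<close>;
  concatenating scaled lists then gives convex combinations.\<close>

definition pair_scale :: "real \<Rightarrow> ('a::chilbert_space \<times> 'a) list \<Rightarrow> ('a \<times> 'a) list" where
  "pair_scale t xs = map (\<lambda>(u, v). (complex_of_real (sqrt t) *\<^sub>C u, complex_of_real (sqrt t) *\<^sub>C v)) xs"

lemma pair_functional_scale:
  assumes "t \<ge> 0" "clinear_op B"
  shows "pair_functional (pair_scale t xs) B = complex_of_real t * pair_functional xs B"
proof -
  have [simp]: "complex_of_real (sqrt t) * (complex_of_real (sqrt t) * z) = complex_of_real t * z" for z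
    using assms(1) by (metis (no_types) mult.assoc of_real_mult real_sqrt_mult_self abs_of_nonneg)
  show ?thesis
    by (induction xs) (auto simp: pair_scale_def clinear_opD[OF assms(2)] cinner_scaleC_left cinner_scaleC_right
        distrib_left)
qed

lemma pair_cost_scale:
  assumes "t \<ge> 0"
  shows "pair_cost (pair_scale t xs) = t * pair_cost xs"
  using assms by (induction xs)
    (auto simp: pair_scale_def norm_scaleC power_mult_distrib algebra_simps add_divide_distrib)

text \<open>Finite support keeps the number of windows finite in
  \<open>pair_functional_cesaro\<close>.\<close>

definition fin_pairs :: "('i ell2 \<times> 'i ell2) list \<Rightarrow> bool" where
  "fin_pairs xs \<longleftrightarrow> (\<forall>(u, v)\<in>set xs. \<exists>F. finite F \<and> fin_part F u = u \<and> fin_part F v = v)"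

lemma fin_part_scaleC: "fin_part F (c *\<^sub>C x) = c *\<^sub>C fin_part F x"
  by (simp add: fin_part_def scaleC_sum_right scaleC_scaleC)

lemma fin_pairs_append [simp]: "fin_pairs (xs @ ys) \<longleftrightarrow> fin_pairs xs \<and> fin_pairs ys"
  by (simp add: fin_pairs_def ball_Un)

lemma fin_pairs_scale: "fin_pairs xs \<Longrightarrow> fin_pairs (pair_scale t xs)"
  unfolding fin_pairs_def pair_scale_def by (fastforce simp: fin_part_scaleC)

text \<open>The mean is an average of window compressions, and these can be moved onto the vectors.
  Every coordinate occurs in \<open>N\<close> windows of weight \<open>1 / N\<close>, so the cost
  does not change.\<close>

lemma pair_functional_cesaro:
  fixes \<theta> :: "'m::finite \<times> 'n::finite \<Rightarrow> 'm \<times> 'n"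
  assumes \<theta>: "bij \<theta>" and N: "N > 0" and xs: "fin_pairs xs"
  shows "\<exists>ys. pair_cost ys = pair_cost xs \<and>
    (\<forall>B\<in>alg_L \<theta>. pair_functional ys B = pair_functional xs (reg_cesaro \<theta> N B))"
  using xs
proof (induction xs)
  case Nil
  then show ?case by (intro exI[of _ "[]"]) simp
next
  case (Cons p xs)
  obtain u v where p: "p = (u, v)" by (cases p)
  obtain F where F: "finite F" "fin_part F u = u" "fin_part F v = v"
    using Cons.prems by (auto simp: fin_pairs_def p)
  obtain ys where ys: "pair_cost ys = pair_cost xs"
    "\<And>B. B \<in> alg_L \<theta> \<Longrightarrow> pair_functional ys B = pair_functional xs (reg_cesaro \<theta> N B)"
    using Cons by (auto simp: fin_pairs_def)
  define M where "M = Max (insert 0 (tg_len ` F)) + N"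
  have M: "tg_len w + N \<le> M" if "w \<in> F" for w
    using F that by (auto simp: M_def intro!: Max_ge)
  define zs where "zs = map (\<lambda>a. (fin_part (window N F a) u, fin_part (window N F a) v)) [0..<M]"
  have zs_fun: "pair_functional zs B = of_nat N * cinner (blinfun_apply (reg_cesaro \<theta> N B) u) v"
    if B: "B \<in> alg_L \<theta>" for B
  proof -
    have "pair_functional zs B
        = (\<Sum>a<M. cinner (blinfun_apply B (fin_part (window N F a) u)) (fin_part (window N F a) v))"
      by (simp add: zs_def pair_functional_def o_def sum_set_upt_conv_sum_list_nat[symmetric] atLeast0LessThan)
    then show ?thesis using reg_cesaro_window[OF \<theta> B F(1) M N, of u v] F by simp
  qed
  have "pair_cost zs = (\<Sum>a<M. ((norm (fin_part (window N F a) u))\<^sup>2 + (norm (fin_part (window N F a) v))\<^sup>2) / 2)"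
    by (simp add: zs_def pair_cost_def o_def sum_set_upt_conv_sum_list_nat[symmetric] atLeast0LessThan)
  also have "\<dots> = real N * (((norm u)\<^sup>2 + (norm v)\<^sup>2) / 2)"
    by (simp add: sum_divide_distrib[symmetric] sum.distrib sum_window_norm[OF F(1) M] F algebra_simps)
  finally have zs_cost: "pair_cost zs = real N * (((norm u)\<^sup>2 + (norm v)\<^sup>2) / 2)" .
  have cl: "clinear_op B" if "B \<in> alg_L \<theta>" for B
    using that unital_subalgebraD(1)[OF alg_L_subalgebra] by blast
  show ?case
  proof (intro exI[of _ "pair_scale (1 / real N) zs @ ys"] conjI ballI)
    show "pair_cost (pair_scale (1 / real N) zs @ ys) = pair_cost (p # xs)"
      using pair_cost_scale[of "1 / real N" zs] N by (simp add: zs_cost ys p)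
    fix B assume B: "B \<in> alg_L \<theta>"
    show "pair_functional (pair_scale (1 / real N) zs @ ys) B = pair_functional (p # xs) (reg_cesaro \<theta> N B)"
      using pair_functional_scale[OF _ cl[OF B], of "1 / real N" zs] N by (simp add: zs_fun[OF B] ys(2)[OF B] p)
  qed
qed

text \<open>Rank one functionals with finitely supported vectors already approach the norm. The
  level \<open>\<epsilon>\<close> on both sides matches the cost bound of the separation
  argument.\<close>

lemma norm_le_fin_pairs:
  assumes B: "clinear_op B" and \<epsilon>: "\<epsilon> > 0"
    and le: "\<And>xs. fin_pairs xs \<Longrightarrow> pair_cost xs \<le> \<epsilon> \<Longrightarrow> Re (pair_functional xs B) \<le> \<epsilon> * M"
  shows "norm B \<le> M"
proof (rule norm_le_cinner)
  show M0: "0 \<le> M" using le[of "[]"] \<epsilon> by (simp add: fin_pairs_def zero_le_mult_iff)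
  have fin: "cmod (cinner (blinfun_apply B u) v) \<le> M * norm u * norm v"
    if F: "finite F" "fin_part F u = u" "fin_part F v = v" for F u v
  proof (cases "u = 0 \<or> v = 0 \<or> cinner (blinfun_apply B u) v = 0")
    case True
    then show ?thesis using M0 by auto
  next
    case False
    define z where "z = cinner (blinfun_apply B u) v"
    have z: "z \<noteq> 0" and nz: "norm u > 0" "norm v > 0" using False by (auto simp: z_def)
    \<comment> \<open>Both vectors are scaled to norm \<open>sqrt \<epsilon>\<close>, so the cost is
      exactly \<open>\<epsilon>\<close>; the phase of \<open>z\<close> in \<open>b\<close> makes the
      value of the functional real and positive.\<close>
    define a b where "a = complex_of_real (sqrt \<epsilon> / norm u)"
      and "b = complex_of_real (sqrt \<epsilon> / norm v) * (z / complex_of_real (cmod z))"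
    have ab: "cmod a * norm u = sqrt \<epsilon>" "cmod b * norm v = sqrt \<epsilon>"
      using nz z \<epsilon> by (auto simp: a_def b_def norm_mult norm_divide)
    have "a * cnj b * z = complex_of_real (\<epsilon> / (norm u * norm v) * cmod z)"
    proof -
      have "cnj z * z = complex_of_real (cmod z) * complex_of_real (cmod z)"
        by (metis complex_norm_square mult.commute of_real_power power2_eq_square)
      then have c: "cnj z / complex_of_real (cmod z) * z = complex_of_real (cmod z)"
        using z by (simp add: divide_simps)
      have e: "complex_of_real (sqrt \<epsilon>) * complex_of_real (sqrt \<epsilon>) = complex_of_real \<epsilon>"
        using \<epsilon> by (simp flip: of_real_mult)
      have "a * cnj b * z = complex_of_real (sqrt \<epsilon>) * complex_of_real (sqrt \<epsilon>)
          / (complex_of_real (norm u) * complex_of_real (norm v)) * (cnj z / complex_of_real (cmod z) * z)"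
        by (simp add: a_def b_def mult.assoc)
      then show ?thesis unfolding c e by simp
    qed
    then have "pair_functional [(a *\<^sub>C u, b *\<^sub>C v)] B = complex_of_real (\<epsilon> / (norm u * norm v) * cmod z)"
      by (simp add: clinear_opD[OF B] cinner_scaleC_left cinner_scaleC_right z_def mult.assoc mult.left_commute)
    then have "Re (pair_functional [(a *\<^sub>C u, b *\<^sub>C v)] B) = \<epsilon> / (norm u * norm v) * cmod z" by simp
    moreover have "Re (pair_functional [(a *\<^sub>C u, b *\<^sub>C v)] B) \<le> \<epsilon> * M"
    proof (rule le)
      show "fin_pairs [(a *\<^sub>C u, b *\<^sub>C v)]"
        using F by (auto simp: fin_pairs_def fin_part_scaleC intro!: exI[of _ F])
      show "pair_cost [(a *\<^sub>C u, b *\<^sub>C v)] \<le> \<epsilon>" using \<epsilon> by (simp add: norm_scaleC ab)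
    qed
    ultimately have "\<epsilon> * (cmod z / (norm u * norm v)) \<le> \<epsilon> * M" by (simp add: ac_simps)
    then have "cmod z / (norm u * norm v) \<le> M" using \<epsilon> by (simp only: mult_le_cancel_left_pos)
    then show ?thesis using nz by (simp add: z_def divide_le_eq mult.assoc)
  qed
  fix x y
  have le': "cmod (cinner (blinfun_apply B (fin_part F x)) (fin_part F y)) \<le> M * norm x * norm y" if F: "finite F" for F
  proof -
    have "fin_part F (fin_part F z) = fin_part F z" for z :: "'a ell2"
      by (rule ell2_eqI) (simp add: ell2_coord_fin_part F)
    then have "cmod (cinner (blinfun_apply B (fin_part F x)) (fin_part F y)) \<le> M * norm (fin_part F x) * norm (fin_part F y)"
      by (intro fin[OF F])
    also have "\<dots> \<le> M * norm x * norm y"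
      using M0 norm_fin_part_le[OF F] by (intro mult_mono) auto
    finally show ?thesis .
  qed
  have "((\<lambda>F. cmod (cinner (blinfun_apply B (fin_part F x)) (fin_part F y))) \<longlongrightarrow> cmod (cinner (blinfun_apply B x) y))
      (finite_subsets_at_top UNIV)"
    by (intro tendsto_norm bounded_bilinear.tendsto[OF bounded_bilinear_cinner]
        blinfun.tendsto tendsto_const fin_part_tendsto)
  then show "cmod (cinner (blinfun_apply B x) y) \<le> M * norm x * norm y"
    by (rule tendsto_upperbound[OF _ eventually_finite_subsets_at_top_weakI[OF le'] finite_subsets_at_top_neq_bot])
qed


text \<open>Stands in for weak* continuity on the regular side: up to small norm such a functional
  depends on finitely many Fourier coefficients. Linearity is asked on \<open>alg_L \<theta>\<close>
  alone, because the functionals of interest are built from \<open>lift\<close>, which is meaningful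
  only there.\<close>

definition cesaro_continuous :: "('m::finite \<times> 'n::finite \<Rightarrow> 'm \<times> 'n) \<Rightarrow>
    ((('m, 'n) tg ell2 \<Rightarrow>\<^sub>L ('m, 'n) tg ell2) \<Rightarrow> complex) \<Rightarrow> bool" where
  "cesaro_continuous \<theta> r \<longleftrightarrow>
    (\<forall>A\<in>alg_L \<theta>. \<forall>B\<in>alg_L \<theta>. r (A + B) = r A + r B) \<and> (\<forall>c. \<forall>A\<in>alg_L \<theta>. r (c *\<^sub>O A) = c * r A) \<and>
    (\<forall>\<epsilon>>0. \<forall>\<^sub>F N in sequentially. \<forall>B\<in>alg_L \<theta>. cmod (r B - r (reg_cesaro \<theta> N B)) \<le> \<epsilon> * norm B)"

lemma cesaro_continuous_pair_functional:
  assumes \<theta>: "bij \<theta>"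
  shows "cesaro_continuous \<theta> (pair_functional xs)"
  unfolding cesaro_continuous_def
proof (intro conjI ballI allI impI pair_functional_linear)
  fix \<epsilon> :: real assume "\<epsilon> > 0"
  then show "\<forall>\<^sub>F N in sequentially. \<forall>B\<in>alg_L \<theta>.
      cmod (pair_functional xs B - pair_functional xs (reg_cesaro \<theta> N B)) \<le> \<epsilon> * norm B"
  proof (induction xs arbitrary: \<epsilon>)
    case (Cons p xs)
    obtain u v where p: "p = (u, v)" by (cases p)
    have e: "\<epsilon>/2 > 0" using Cons.prems by simp
    from reg_cesaro_uniform[OF \<theta> e, of u v] Cons.IH[OF e] show ?case
    proof eventually_elim
      case (elim N)
      show ?case
      proof
        fix B assume B: "B \<in> alg_L \<theta>"
        have "cmod (pair_functional (p # xs) B - pair_functional (p # xs) (reg_cesaro \<theta> N B))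
            = cmod (cinner (blinfun_apply (B - reg_cesaro \<theta> N B) u) v
              + (pair_functional xs B - pair_functional xs (reg_cesaro \<theta> N B)))"
          by (simp add: p blinfun.diff_left cinner_diff_left algebra_simps)
        also have "\<dots> \<le> \<epsilon>/2 * norm B + \<epsilon>/2 * norm B"
          using elim B by (intro norm_triangle_mono) auto
        finally show "cmod (pair_functional (p # xs) B - pair_functional (p # xs) (reg_cesaro \<theta> N B)) \<le> \<epsilon> * norm B"
          by simp
      qed
    qed
  qed simp
qed

lemma cesaro_continuous_diff:
  assumes "cesaro_continuous \<theta> r" "cesaro_continuous \<theta> s"
  shows "cesaro_continuous \<theta> (\<lambda>B. r B - s B)"
  unfolding cesaro_continuous_def
proof (intro conjI ballI allI impI)
  fix \<epsilon> :: real assume "\<epsilon> > 0"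
  then have e: "\<epsilon>/2 > 0" by simp
  have "\<forall>\<^sub>F N in sequentially. \<forall>B\<in>alg_L \<theta>. cmod (r B - r (reg_cesaro \<theta> N B)) \<le> \<epsilon>/2 * norm B"
    "\<forall>\<^sub>F N in sequentially. \<forall>B\<in>alg_L \<theta>. cmod (s B - s (reg_cesaro \<theta> N B)) \<le> \<epsilon>/2 * norm B"
    using assms e unfolding cesaro_continuous_def by blast+
  then show "\<forall>\<^sub>F N in sequentially. \<forall>B\<in>alg_L \<theta>.
      cmod (r B - s B - (r (reg_cesaro \<theta> N B) - s (reg_cesaro \<theta> N B))) \<le> \<epsilon> * norm B"
  proof eventually_elim
    case (elim N)
    show ?case
    proof
      fix B assume B: "B \<in> alg_L \<theta>"
      have "cmod (r B - r (reg_cesaro \<theta> N B)) \<le> \<epsilon>/2 * norm B" "cmod (s B - s (reg_cesaro \<theta> N B)) \<le> \<epsilon>/2 * norm B"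
        using elim B by blast+
      then have "cmod ((r B - r (reg_cesaro \<theta> N B)) - (s B - s (reg_cesaro \<theta> N B))) \<le> \<epsilon>/2 * norm B + \<epsilon>/2 * norm B"
        by (rule norm_triangle_le_diff[OF add_mono])
      then show "cmod (r B - s B - (r (reg_cesaro \<theta> N B) - s (reg_cesaro \<theta> N B))) \<le> \<epsilon> * norm B"
        by (simp add: algebra_simps)
    qed
  qed
qed (use assms in \<open>simp_all add: cesaro_continuous_def right_diff_distrib\<close>)

lemma cesaro_continuous_sum:
  assumes r: "cesaro_continuous \<theta> r" and A: "\<And>w. w \<in> W \<Longrightarrow> A w \<in> alg_L \<theta>"
  shows "r (\<Sum>w\<in>W. c w *\<^sub>O A w) = (\<Sum>w\<in>W. c w * r (A w))"
proof -
  note L = unital_subalgebraD[OF alg_L_subalgebra[of \<theta>]]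
  have "r (0 *\<^sub>O id_blinfun) = 0 * r id_blinfun" using r L(2) unfolding cesaro_continuous_def by blast
  moreover have "0 *\<^sub>O id_blinfun = (0 :: ('a, 'b) tg ell2 \<Rightarrow>\<^sub>L ('a, 'b) tg ell2)" by (rule blinfun_eqI) simp
  ultimately have z: "r 0 = 0" by simp
  show ?thesis
    using A
  proof (induction W rule: infinite_finite_induct)
    case (insert w W)
    have "(\<Sum>w\<in>W. c w *\<^sub>O A w) \<in> alg_L \<theta>" "c w *\<^sub>O A w \<in> alg_L \<theta>"
      using insert.prems by (auto intro!: unital_subalgebra_sum[OF alg_L_subalgebra] L(5))
    then have "r (c w *\<^sub>O A w + (\<Sum>w\<in>W. c w *\<^sub>O A w)) = r (c w *\<^sub>O A w) + r (\<Sum>w\<in>W. c w *\<^sub>O A w)"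
      using r unfolding cesaro_continuous_def by blast
    moreover have "r (c w *\<^sub>O A w) = c w * r (A w)"
      using r insert.prems unfolding cesaro_continuous_def by blast
    ultimately show ?case using insert by simp
  qed (simp_all add: z)
qed

text \<open>If no finite rank functional of cost \<open>\<epsilon>\<close> were close to \<open>r\<close> on the words of length below
  \<open>N\<close>, a separating vector would be a polynomial contradicting the bound on \<open>r\<close>. Composing
  with the Cesaro mean then makes the remaining coefficients irrelevant.\<close>

lemma cesaro_continuous_approx:
  fixes \<theta> :: "'m::finite \<times> 'n::finite \<Rightarrow> 'm \<times> 'n"
  assumes \<theta>: "bij \<theta>" and r: "cesaro_continuous \<theta> r" and \<epsilon>: "\<epsilon> > 0"
    and bd: "\<And>B. B \<in> alg_L \<theta> \<Longrightarrow> cmod (r B) \<le> \<epsilon> * norm B"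
  shows "\<exists>xs. pair_cost xs \<le> \<epsilon> \<and> (\<forall>B\<in>alg_L \<theta>. cmod (r B - pair_functional xs B) \<le> \<epsilon> / 4 * norm B)"
proof -
  have "\<epsilon>/8 > 0" using \<epsilon> by simp
  then have "\<forall>\<^sub>F N in sequentially. \<forall>B\<in>alg_L \<theta>. cmod (r B - r (reg_cesaro \<theta> N B)) \<le> \<epsilon>/8 * norm B"
    using r unfolding cesaro_continuous_def by blast
  then have "\<forall>\<^sub>F N in sequentially. N > 0 \<and> (\<forall>B\<in>alg_L \<theta>. cmod (r B - r (reg_cesaro \<theta> N B)) \<le> \<epsilon>/8 * norm B)"
    using eventually_gt_at_top[of 0] by eventually_elim simp
  then obtain N where N: "N > 0" and rN: "\<And>B. B \<in> alg_L \<theta> \<Longrightarrow> cmod (r B - r (reg_cesaro \<theta> N B)) \<le> \<epsilon>/8 * norm B"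
    unfolding eventually_sequentially by blast
  define W where "W = {w :: ('m, 'n) tg. tg_len w < N}"
  have W: "finite W" unfolding W_def by (rule finite_tg_len_less)
  have LL: "reg_op \<theta> w \<in> alg_L \<theta>" for w
    by (intro unital_subalgebra_rep_op alg_L_subalgebra two_graph_alg_gen)
  \<comment> \<open>The values of \<open>f\<close> on the words of length below \<open>N\<close>,
    stored as a vector so that separation takes place in a Hilbert space.\<close>
  define c where "c f = (\<Sum>w\<in>W. f (reg_op \<theta> w) *\<^sub>C ket w)"
    for f :: "(('m, 'n) tg ell2 \<Rightarrow>\<^sub>L ('m, 'n) tg ell2) \<Rightarrow> complex"
  have coord_c: "w \<in> W \<Longrightarrow> ell2_coord (c f) w = f (reg_op \<theta> w)" for f w
    using W by (simp add: c_def ell2_coord_sum ell2_coord_ket if_distrib cong: if_cong)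
  define K where "K = {c (pair_functional xs) | xs. fin_pairs xs \<and> pair_cost xs \<le> \<epsilon>}"
  \<comment> \<open>Exceeds the number of words, so the errors \<open>d\<close> summed over
    \<open>W\<close> stay below \<open>\<epsilon> / 8\<close>, and division is safe.\<close>
  define n where "n = real (card W) + 1"
  have n: "n > 0" unfolding n_def by linarith
  define d where "d = \<epsilon> / (8 * n)"
  have d: "d > 0" using \<epsilon> n by (simp add: d_def)
  have "\<exists>xs. fin_pairs xs \<and> pair_cost xs \<le> \<epsilon> \<and> norm (c r - c (pair_functional xs)) < d"
  proof (rule ccontr)
    assume "\<not> ?thesis"
    then have far: "d \<le> norm (c r - x)" if "x \<in> K" for x using that by (force simp: K_def)
    have nil: "fin_pairs ([] :: (('m, 'n) tg ell2 \<times> ('m, 'n) tg ell2) list)" by (simp add: fin_pairs_def)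
    have "c (pair_functional []) \<in> K" using nil \<epsilon> unfolding K_def by fastforce
    then have ne: "K \<noteq> {}" by blast
    have cvx: "x + t *\<^sub>R (y - x) \<in> K" if xy: "x \<in> K" "y \<in> K" and t: "0 \<le> t" "t \<le> 1" for x y t
    proof -
      obtain xs ys where xs: "x = c (pair_functional xs)" "fin_pairs xs" "pair_cost xs \<le> \<epsilon>"
        and ys: "y = c (pair_functional ys)" "fin_pairs ys" "pair_cost ys \<le> \<epsilon>"
        using xy by (auto simp: K_def)
      let ?zs = "pair_scale (1 - t) xs @ pair_scale t ys"
      note cl = unital_subalgebraD(1)[OF alg_L_subalgebra LL]
      have "x + t *\<^sub>R (y - x) = c (pair_functional ?zs)"
      proof (rule ell2_eqI)
        fix w
        have "w \<in> W \<or> ell2_coord (c f) w = 0" for f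
          using W by (auto simp: c_def ell2_coord_sum ell2_coord_ket if_distrib cong: if_cong)
        then show "ell2_coord (x + t *\<^sub>R (y - x)) w = ell2_coord (c (pair_functional ?zs)) w"
          using t by (cases "w \<in> W")
            (auto simp: xs ys coord_c scaleR_scaleC pair_functional_scale cl algebra_simps)
      qed
      moreover have "pair_cost ?zs \<le> \<epsilon>"
      proof -
        have "pair_cost ?zs = (1 - t) * pair_cost xs + t * pair_cost ys"
          using t pair_cost_scale[of t ys] pair_cost_scale[of "1 - t" xs] by simp
        also have "\<dots> \<le> (1 - t) * \<epsilon> + t * \<epsilon>" using t xs ys by (intro add_mono mult_left_mono) auto
        finally show ?thesis by (simp add: algebra_simps)
      qed
      ultimately show ?thesis
        unfolding K_def using xs ys fin_pairs_scale[OF xs(2)] fin_pairs_scale[OF ys(2)] by (intro CollectI exI[of _ ?zs]) simp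
    qed
    have bdK: "norm x \<le> (\<Sum>w\<in>W. \<epsilon> * norm (reg_op \<theta> w))" if "x \<in> K" for x
    proof -
      obtain xs where xs: "x = c (pair_functional xs)" "pair_cost xs \<le> \<epsilon>" using \<open>x \<in> K\<close> by (auto simp: K_def)
      show ?thesis
        unfolding xs c_def
      proof (rule sum_norm_le)
        fix w
        have "cmod (pair_functional xs (reg_op \<theta> w)) \<le> pair_cost xs * norm (reg_op \<theta> w)"
          by (rule cmod_pair_functional_le)
        also have "\<dots> \<le> \<epsilon> * norm (reg_op \<theta> w)" using xs by (intro mult_right_mono) auto
        finally show "norm (pair_functional xs (reg_op \<theta> w) *\<^sub>C ket w) \<le> \<epsilon> * norm (reg_op \<theta> w)"
          by (simp add: norm_scaleC)
      qed
    qed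
    obtain h \<eta> where \<eta>: "\<eta> > 0" and sep: "\<And>x. x \<in> K \<Longrightarrow> Re (cinner x h) \<le> Re (cinner (c r) h) - \<eta>"
      using approximate_separation[OF ne cvx bdK far d] by blast
    \<comment> \<open>Conjugating the coordinates of \<open>h\<close> turns the pairing of
      \<open>c f\<close> with \<open>h\<close> into evaluation of \<open>f\<close> at this
      polynomial.\<close>
    define B where "B = (\<Sum>w\<in>W. cnj (ell2_coord h w) *\<^sub>O reg_op \<theta> w)"
    have B: "B \<in> alg_L \<theta>"
      unfolding B_def by (intro unital_subalgebra_sum unital_subalgebraD(5) alg_L_subalgebra LL)
    have ch: "cinner (c f) h = f B" if "cesaro_continuous \<theta> f" for f
      unfolding B_def using cesaro_continuous_sum[OF that LL, where c = "\<lambda>w. cnj (ell2_coord h w)" and W = W]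
      by (simp add: c_def cinner_sum_left cinner_scaleC_left cinner_ket_left mult.commute)
    \<comment> \<open>Functionals of cost at most \<open>\<epsilon>\<close> come arbitrarily close
      to \<open>\<epsilon> * norm B\<close> at \<open>B\<close>, yet separation keeps them
      \<open>\<eta>\<close> below it.\<close>
    have "norm B \<le> norm B - \<eta> / \<epsilon>"
    proof (rule norm_le_fin_pairs[OF _ \<epsilon>])
      show "clinear_op B" using B unital_subalgebraD(1)[OF alg_L_subalgebra] by blast
      fix xs :: "(('m, 'n) tg ell2 \<times> ('m, 'n) tg ell2) list" assume "fin_pairs xs" "pair_cost xs \<le> \<epsilon>"
      then have "c (pair_functional xs) \<in> K" by (auto simp: K_def)
      then have "Re (pair_functional xs B) \<le> Re (r B) - \<eta>"
        using sep ch[OF r] ch[OF cesaro_continuous_pair_functional[OF \<theta>]] by metis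
      also have "Re (r B) \<le> \<epsilon> * norm B"
        using bd[OF B] complex_Re_le_cmod[of "r B"] by linarith
      finally show "Re (pair_functional xs B) \<le> \<epsilon> * (norm B - \<eta> / \<epsilon>)"
        using \<epsilon> by (simp add: right_diff_distrib)
    qed
    then show False using \<eta> \<epsilon> by (simp add: divide_le_0_iff)
  qed
  then obtain xs where xs: "fin_pairs xs" "pair_cost xs \<le> \<epsilon>" and close: "norm (c r - c (pair_functional xs)) < d"
    by blast
  \<comment> \<open>Closeness is known on short words only. Composition with the mean removes all
    longer words, weights the others by at most 1, and leaves the cost unchanged.\<close>
  obtain ys where ys: "pair_cost ys = pair_cost xs"
    "\<And>B. B \<in> alg_L \<theta> \<Longrightarrow> pair_functional ys B = pair_functional xs (reg_cesaro \<theta> N B)"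
    using pair_functional_cesaro[OF \<theta> N xs(1)] by blast
  show ?thesis
  proof (intro exI[of _ ys] conjI ballI)
    show "pair_cost ys \<le> \<epsilon>" using ys xs by simp
    fix B assume B: "B \<in> alg_L \<theta>"
    define b where "b w = complex_of_real (real (N - tg_len w) / real N) * fourier_coeff B w" for w
    have b: "cmod (b w) \<le> norm B" for w
    proof -
      have "cmod (b w) = real (N - tg_len w) / real N * cmod (fourier_coeff B w)"
        by (simp only: b_def norm_mult norm_of_real) simp
      also have "\<dots> \<le> 1 * norm B"
        using N by (intro mult_mono cmod_fourier_coeff_le) (auto simp: divide_le_eq)
      finally show ?thesis by simp
    qed
    have ces: "f (reg_cesaro \<theta> N B) = (\<Sum>w\<in>W. b w * f (reg_op \<theta> w))" if "cesaro_continuous \<theta> f" for f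
      unfolding cesaro_def b_def W_def by (rule cesaro_continuous_sum[OF that LL])
    have "cmod (r (reg_cesaro \<theta> N B) - pair_functional xs (reg_cesaro \<theta> N B))
        = cmod (\<Sum>w\<in>W. b w * (r (reg_op \<theta> w) - pair_functional xs (reg_op \<theta> w)))"
      by (simp add: ces[OF r] ces[OF cesaro_continuous_pair_functional[OF \<theta>]] sum_subtractf right_diff_distrib)
    also have "\<dots> \<le> (\<Sum>w\<in>W. norm B * d)"
    proof (rule sum_norm_le)
      fix w assume w: "w \<in> W"
      have "cmod (r (reg_op \<theta> w) - pair_functional xs (reg_op \<theta> w)) \<le> d"
        using ell2_coord_norm_le[of "c r - c (pair_functional xs)" w] close by (simp add: coord_c[OF w])
      then show "cmod (b w * (r (reg_op \<theta> w) - pair_functional xs (reg_op \<theta> w))) \<le> norm B * d"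
        unfolding norm_mult by (intro mult_mono b) auto
    qed
    also have "\<dots> = real (card W) * d * norm B" by simp
    also have "\<dots> \<le> \<epsilon>/8 * norm B"
    proof (rule mult_right_mono)
      have "real (card W) * d \<le> (real (card W) + 1) * d" using d by simp
      also have "\<dots> = n * d" by (simp add: n_def)
      also have "\<dots> = \<epsilon>/8" using n by (simp add: d_def)
      finally show "real (card W) * d \<le> \<epsilon>/8" .
    qed simp
    finally have "cmod (r B - pair_functional ys B) \<le> \<epsilon>/8 * norm B + \<epsilon>/8 * norm B"
      using norm_triangle_ineq[of "r B - r (reg_cesaro \<theta> N B)" "r (reg_cesaro \<theta> N B) - pair_functional xs (reg_cesaro \<theta> N B)"]
        rN[OF B] by (simp add: ys(2)[OF B])
    then show "cmod (r B - pair_functional ys B) \<le> \<epsilon> / 4 * norm B" by simp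
  qed
qed

section \<open>From iterated approximation to a representing pair of sequences\<close>

lemma pair_functional_eq_sum:
  "pair_functional xs B = (\<Sum>k<length xs. cinner (blinfun_apply B (fst (xs ! k))) (snd (xs ! k)))"
proof -
  have "pair_functional xs B = (\<Sum>p\<leftarrow>xs. cinner (blinfun_apply B (fst p)) (snd p))"
    by (simp add: pair_functional_def case_prod_unfold)
  then show ?thesis by (simp add: sum_list_sum_nth atLeast0LessThan)
qed

lemma pair_cost_eq_sum:
  "pair_cost xs = (\<Sum>k<length xs. ((norm (fst (xs ! k)))\<^sup>2 + (norm (snd (xs ! k)))\<^sup>2) / 2)"
proof -
  have "pair_cost xs = (\<Sum>p\<leftarrow>xs. ((norm (fst p))\<^sup>2 + (norm (snd p))\<^sup>2) / 2)"
    by (simp add: pair_cost_def case_prod_unfold)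
  then show ?thesis by (simp add: sum_list_sum_nth atLeast0LessThan)
qed

lemma summable_cinner:
  fixes u v :: "nat \<Rightarrow> 'a::chilbert_space"
  assumes "summable (\<lambda>k. (norm (u k))\<^sup>2)" "summable (\<lambda>k. (norm (v k))\<^sup>2)"
  shows "summable (\<lambda>k. cmod (cinner (blinfun_apply B (u k)) (v k)))"
proof (rule summable_comparison_test')
  show "summable (\<lambda>k. norm B * ((norm (u k))\<^sup>2 + (norm (v k))\<^sup>2))"
    by (intro summable_mult summable_add assms)
  fix k
  have "cmod (cinner (blinfun_apply B (u k)) (v k)) \<le> norm B * (norm (u k) * norm (v k))"
    using cmod_cinner_blinfun_le[of B "u k" "v k"] by (simp add: mult.assoc)
  also have "\<dots> \<le> norm B * ((norm (u k))\<^sup>2 + (norm (v k))\<^sup>2)"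
    using zero_le_power2[of "norm (u k) - norm (v k)"] zero_le_power2[of "norm (u k)"] zero_le_power2[of "norm (v k)"]
    unfolding power2_diff by (intro mult_left_mono norm_ge_zero) linarith
  finally show "norm (cmod (cinner (blinfun_apply B (u k)) (v k))) \<le> norm B * ((norm (u k))\<^sup>2 + (norm (v k))\<^sup>2)"
    by simp
qed

theorem cesaro_continuous_representation:
  fixes \<theta> :: "'m::finite \<times> 'n::finite \<Rightarrow> 'm \<times> 'n"
  assumes \<theta>: "bij \<theta>" and r: "cesaro_continuous \<theta> r" and \<epsilon>: "\<epsilon> > 0"
    and bd: "\<And>B. B \<in> alg_L \<theta> \<Longrightarrow> cmod (r B) \<le> \<epsilon> * norm B"
  shows "\<exists>u v :: nat \<Rightarrow> ('m, 'n) tg ell2. summable (\<lambda>k. (norm (u k))\<^sup>2) \<and> summable (\<lambda>k. (norm (v k))\<^sup>2) \<and>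
    (\<forall>B\<in>alg_L \<theta>. r B = (\<Sum>k. cinner (blinfun_apply B (u k)) (v k)))"
proof -
  \<comment> \<open>The block added after stage \<open>n\<close> costs at most
    \<open>\<epsilon> * (1/4)^n\<close>. The cost bound grows by one and a half times that amount,
    which leaves room.\<close>
  define P where "P n xs \<longleftrightarrow> n \<le> length xs \<and> pair_cost xs \<le> 2 * \<epsilon> * (1 - (1/4)^n) \<and>
      (\<forall>B\<in>alg_L \<theta>. cmod (r B - pair_functional xs B) \<le> \<epsilon> * (1/4)^n * norm B)" for n xs
  have P0: "P 0 []" using bd by (simp add: P_def)
  have PS: "\<exists>ys. P (Suc n) ys \<and> (\<exists>zs. ys = xs @ zs)" if "P n xs" for n xs
  proof -
    have e: "\<epsilon> * (1/4)^n > 0" using \<epsilon> by simp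
    have bd': "cmod (r B - pair_functional xs B) \<le> \<epsilon> * (1/4)^n * norm B" if "B \<in> alg_L \<theta>" for B
      using \<open>P n xs\<close> that by (simp add: P_def)
    obtain zs where zs: "pair_cost zs \<le> \<epsilon> * (1/4)^n"
      "\<And>B. B \<in> alg_L \<theta> \<Longrightarrow> cmod (r B - pair_functional xs B - pair_functional zs B) \<le> \<epsilon> * (1/4)^n / 4 * norm B"
      using cesaro_continuous_approx[OF \<theta> cesaro_continuous_diff[OF r cesaro_continuous_pair_functional[OF \<theta>]] e bd']
      by blast
    \<comment> \<open>The pair \<open>(0, 0)\<close> changes neither functional nor cost but
      lengthens the list even if \<open>zs\<close> is empty, so that the lists exhaust an infinite
      sequence.\<close>
    have "P (Suc n) (xs @ (0, 0) # zs)"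
      unfolding P_def
    proof (intro conjI ballI)
      show "Suc n \<le> length (xs @ (0, 0) # zs)" using that by (simp add: P_def)
      have "pair_cost (xs @ (0, 0) # zs) \<le> 2 * \<epsilon> * (1 - (1/4)^n) + \<epsilon> * (1/4)^n"
        using that zs(1) by (simp add: P_def)
      also have "\<dots> \<le> 2 * \<epsilon> * (1 - (1/4)^Suc n)" using e by (simp add: algebra_simps)
      finally show "pair_cost (xs @ (0, 0) # zs) \<le> 2 * \<epsilon> * (1 - (1/4)^Suc n)" .
      fix B assume "B \<in> alg_L \<theta>"
      then show "cmod (r B - pair_functional (xs @ (0, 0) # zs) B) \<le> \<epsilon> * (1/4)^Suc n * norm B"
        using zs(2) by (simp add: algebra_simps)
    qed
    then show ?thesis by blast
  qed
  obtain X where X: "\<And>n. P n (X n)" and Xs: "\<And>n. \<exists>zs. X (Suc n) = X n @ zs"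
    using dependent_nat_choice[of P "\<lambda>_ xs ys. \<exists>zs. ys = xs @ zs"] P0 PS by metis
  have prefix: "\<exists>zs. X m = X n @ zs" if "n \<le> m" for n m
    using that
  proof (induction m rule: dec_induct)
    case (step m)
    then show ?case using Xs[of m] by auto
  qed simp
  \<comment> \<open>Position \<open>k\<close> exists from stage \<open>Suc k\<close> on and never
    changes afterwards.\<close>
  define p where "p k = X (Suc k) ! k" for k
  have p: "X n ! k = p k" if "k < length (X n)" for n k
  proof -
    have "k < length (X (Suc k))" using X[of "Suc k"] by (simp add: P_def)
    then show ?thesis
      using prefix[of n "Suc k"] prefix[of "Suc k" n] that unfolding p_def
      by (cases "n \<le> Suc k") (auto simp: nth_append)
  qed
  define u v where "u k = fst (p k)" and "v k = snd (p k)" for k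
  have cost: "(\<Sum>k<n. ((norm (u k))\<^sup>2 + (norm (v k))\<^sup>2) / 2) \<le> 2 * \<epsilon>" for n
  proof -
    have "(\<Sum>k<n. ((norm (u k))\<^sup>2 + (norm (v k))\<^sup>2) / 2)
        \<le> (\<Sum>k<length (X n). ((norm (u k))\<^sup>2 + (norm (v k))\<^sup>2) / 2)"
      using X[of n] by (intro sum_mono2) (auto simp: P_def)
    also have "\<dots> = pair_cost (X n)" by (simp add: pair_cost_eq_sum p u_def v_def)
    also have "\<dots> \<le> 2 * \<epsilon> * (1 - (1/4)^n)" using X by (simp add: P_def)
    also have "\<dots> \<le> 2 * \<epsilon> * 1" using \<epsilon> by (intro mult_left_mono) auto
    finally show ?thesis by simp
  qed
  have "summable (\<lambda>k. ((norm (u k))\<^sup>2 + (norm (v k))\<^sup>2) / 2)"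
  proof (rule bounded_imp_summable)
    show "(\<Sum>k\<le>n. ((norm (u k))\<^sup>2 + (norm (v k))\<^sup>2) / 2) \<le> 2 * \<epsilon>" for n
      using cost[of "Suc n"] by (simp only: lessThan_Suc_atMost)
  qed simp
  then have s: "summable (\<lambda>k. 2 * (((norm (u k))\<^sup>2 + (norm (v k))\<^sup>2) / 2))" by (rule summable_mult)
  have su: "summable (\<lambda>k. (norm (u k))\<^sup>2)" by (rule summable_comparison_test'[OF s, of 0]) simp
  have sv: "summable (\<lambda>k. (norm (v k))\<^sup>2)" by (rule summable_comparison_test'[OF s, of 0]) simp
  have "r B = (\<Sum>k. cinner (blinfun_apply B (u k)) (v k))" if B: "B \<in> alg_L \<theta>" for B
  proof (rule LIMSEQ_unique)
    have "summable (\<lambda>k. cinner (blinfun_apply B (u k)) (v k))"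
      using summable_norm_cancel[OF summable_cinner[OF su sv]] .
    then have "(\<lambda>n. \<Sum>k<n. cinner (blinfun_apply B (u k)) (v k)) \<longlonglongrightarrow> (\<Sum>k. cinner (blinfun_apply B (u k)) (v k))"
      by (rule summable_LIMSEQ)
    moreover have "filterlim (\<lambda>n. length (X n)) at_top sequentially"
      by (rule filterlim_at_top_mono[OF filterlim_ident]) (use X in \<open>auto simp: P_def\<close>)
    ultimately have "(\<lambda>n. \<Sum>k<length (X n). cinner (blinfun_apply B (u k)) (v k))
        \<longlonglongrightarrow> (\<Sum>k. cinner (blinfun_apply B (u k)) (v k))" by (rule filterlim_compose)
    then show "(\<lambda>n. pair_functional (X n) B) \<longlonglongrightarrow> (\<Sum>k. cinner (blinfun_apply B (u k)) (v k))"
      by (simp add: pair_functional_eq_sum p u_def v_def)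
    have "(\<lambda>n. \<epsilon> * (1/4)^n * norm B) \<longlonglongrightarrow> \<epsilon> * 0 * norm B"
      by (intro tendsto_intros LIMSEQ_power_zero) simp
    then have lim: "(\<lambda>n. \<epsilon> * (1/4)^n * norm B) \<longlonglongrightarrow> 0" by simp
    have "norm (pair_functional (X n) B - r B) \<le> \<epsilon> * (1/4)^n * norm B" for n
      using X[of n] B by (simp add: P_def norm_minus_commute)
    then have "(\<lambda>n. pair_functional (X n) B - r B) \<longlonglongrightarrow> 0"
      by (intro Lim_null_comparison[OF always_eventually lim]) blast
    then show "(\<lambda>n. pair_functional (X n) B) \<longlonglongrightarrow> r B" by (rule LIM_zero_cancel)
  qed
  then show ?thesis using su sv by blast
qed


section \<open>The weak* topology\<close>

lemma topspace_weak_star [simp]: "topspace weak_star = UNIV"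
proof -
  let ?B = "{{A :: 'a \<Rightarrow>\<^sub>L 'a. (\<Sum>k. cinner (blinfun_apply A (x k)) (y k)) \<in> U} | x y U.
      summable (\<lambda>k::nat. (norm (x k))\<^sup>2) \<and> summable (\<lambda>k. (norm (y k))\<^sup>2) \<and> open U}"
  have "{A :: 'a \<Rightarrow>\<^sub>L 'a. (\<Sum>k::nat. cinner (blinfun_apply A 0) 0) \<in> UNIV} \<in> ?B"
    by (rule CollectI, rule exI[of _ "\<lambda>_. 0"], rule exI[of _ "\<lambda>_. 0"], rule exI[of _ UNIV]) simp
  then show ?thesis unfolding weak_star_def topology_generated_by_topspace by blast
qed

lemma continuous_map_weak_star:
  assumes "summable (\<lambda>k::nat. (norm (x k))\<^sup>2)" "summable (\<lambda>k. (norm (y k))\<^sup>2)"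
  shows "continuous_map weak_star euclidean (\<lambda>A. \<Sum>k. cinner (blinfun_apply A (x k)) (y k))"
proof -
  have "openin weak_star {A. (\<Sum>k. cinner (blinfun_apply A (x k)) (y k)) \<in> U}" if "open U" for U
    unfolding weak_star_def using that assms by (intro topology_generated_by_Basis) blast
  then show ?thesis by (simp add: continuous_map_def)
qed

text \<open>The topology is generated by its functionals, so continuity can be tested on them one at
  a time.\<close>

lemma continuous_map_into_weak_star:
  fixes f :: "'x \<Rightarrow> 'a::chilbert_space \<Rightarrow>\<^sub>L 'a"
  assumes f: "\<And>a. a \<in> topspace X \<Longrightarrow> f a \<in> \<A>"
    and cont: "\<And>x y. summable (\<lambda>k::nat. (norm (x k))\<^sup>2) \<Longrightarrow> summable (\<lambda>k. (norm (y k))\<^sup>2) \<Longrightarrow>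
      continuous_map X euclidean (\<lambda>a. \<Sum>k. cinner (blinfun_apply (f a) (x k)) (y k))"
  shows "continuous_map X (subtopology weak_star \<A>) f"
proof -
  have "continuous_map X weak_star f"
    unfolding weak_star_def continuous_on_generated_topo_iff
  proof (intro conjI allI impI)
    fix V assume "V \<in> {{A :: 'a \<Rightarrow>\<^sub>L 'a. (\<Sum>k. cinner (blinfun_apply A (x k)) (y k)) \<in> U} | x y U.
      summable (\<lambda>k::nat. (norm (x k))\<^sup>2) \<and> summable (\<lambda>k. (norm (y k))\<^sup>2) \<and> open U}"
    then obtain x y U where V: "V = {A. (\<Sum>k. cinner (blinfun_apply A (x k)) (y k)) \<in> U}"
      and xy: "summable (\<lambda>k::nat. (norm (x k))\<^sup>2)" "summable (\<lambda>k. (norm (y k))\<^sup>2)" and U: "open U" by blast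
    have "openin X {a \<in> topspace X. (\<Sum>k. cinner (blinfun_apply (f a) (x k)) (y k)) \<in> U}"
      using cont[OF xy] U by (simp add: continuous_map_def)
    also have "{a \<in> topspace X. (\<Sum>k. cinner (blinfun_apply (f a) (x k)) (y k)) \<in> U} = f -` V \<inter> topspace X"
      by (auto simp: V)
    finally show "openin X (f -` V \<inter> topspace X)" .
  next
    show "f ` topspace X \<subseteq> \<Union> {{A :: 'a \<Rightarrow>\<^sub>L 'a. (\<Sum>k. cinner (blinfun_apply A (x k)) (y k)) \<in> U} | x y U.
      summable (\<lambda>k::nat. (norm (x k))\<^sup>2) \<and> summable (\<lambda>k. (norm (y k))\<^sup>2) \<and> open U}"
      using topspace_weak_star unfolding weak_star_def topology_generated_by_topspace by (rule ssubst) simp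
  qed
  then show ?thesis using f by (auto simp: continuous_map_in_subtopology)
qed


section \<open>Intertwining isometries\<close>

text \<open>Abstracts from the wandering vectors: only the isometries and the intertwining relations
  remain. \<open>j0\<close> is the index through which the compression is defined.\<close>

locale intertwined_rep =
  fixes \<theta> :: "'m::finite \<times> 'n::finite \<Rightarrow> 'm \<times> 'n"
    and S :: "'m \<Rightarrow> 'h::chilbert_space \<Rightarrow>\<^sub>L 'h" and T :: "'n \<Rightarrow> 'h \<Rightarrow>\<^sub>L 'h"
    and J :: "'j set" and U :: "'j \<Rightarrow> ('m, 'n) tg ell2 \<Rightarrow>\<^sub>L 'h" and j0 :: 'j
  assumes \<theta>: "bij \<theta>" and clS: "clinear_op (S i)" and clT: "clinear_op (T k)"
    and j0: "j0 \<in> J"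
    and clU: "j \<in> J \<Longrightarrow> clinear_op (U j)"
    and isoU: "j \<in> J \<Longrightarrow> cinner (blinfun_apply (U j) x) (blinfun_apply (U j) y) = cinner x y"
    and SU: "j \<in> J \<Longrightarrow> S i o\<^sub>L U j = U j o\<^sub>L left_regular_E \<theta> i"
    and TU: "j \<in> J \<Longrightarrow> T k o\<^sub>L U j = U j o\<^sub>L left_regular_F \<theta> k"
begin

abbreviation "\<SS> \<equiv> two_graph_alg S T"

definition compress :: "('h \<Rightarrow>\<^sub>L 'h) \<Rightarrow> (('m, 'n) tg ell2 \<Rightarrow>\<^sub>L ('m, 'n) tg ell2)" where
  "compress A = adj (U j0) o\<^sub>L A o\<^sub>L U j0"

lemma \<SS>_subalgebra: "unital_subalgebra \<SS>" and \<SS>_closed: "closedin wot \<SS>"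
  by (rule unital_subalgebra_two_graph_alg[OF clS clT], rule closedin_two_graph_alg[OF clS clT])

lemma compress_apply: "blinfun_apply (compress A) x = blinfun_apply (adj (U j0)) (blinfun_apply A (blinfun_apply (U j0) x))"
  by (simp add: compress_def)

lemma adj_U: "blinfun_apply (adj (U j0)) (blinfun_apply (U j0) x) = x"
  using arg_cong[OF adj_isometry_left[OF clU[OF j0] isoU[OF j0]], of "\<lambda>A. blinfun_apply A x"] by simp

lemma cinner_compress: "cinner (blinfun_apply (compress A) x) y = cinner (blinfun_apply A (blinfun_apply (U j0) x)) (blinfun_apply (U j0) y)"
  by (simp add: compress_apply cinner_adj_left[OF clU[OF j0]])

lemma compress_eqI:
  assumes "A o\<^sub>L U j0 = U j0 o\<^sub>L B"
  shows "compress A = B"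
proof (rule blinfun_eqI)
  fix x
  have "blinfun_apply A (blinfun_apply (U j0) x) = blinfun_apply (U j0) (blinfun_apply B x)"
    using arg_cong[OF assms, of "\<lambda>A. blinfun_apply A x"] by simp
  then show "blinfun_apply (compress A) x = blinfun_apply B x" by (simp add: compress_apply adj_U)
qed

text \<open>Operators that act on the range of every \<open>U j\<close> through one and the same
  element of \<open>alg_L \<theta>\<close>. They form a WOT-closed algebra containing the
  generators, hence all of \<open>\<SS>\<close>; this is how independence of \<open>j\<close> is
  obtained.\<close>

definition intertwining :: "('h \<Rightarrow>\<^sub>L 'h) set" where
  "intertwining = {A. clinear_op A \<and> compress A \<in> alg_L \<theta> \<and> (\<forall>j\<in>J. A o\<^sub>L U j = U j o\<^sub>L compress A)}"

lemma intertwiningI: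
  assumes "clinear_op A" "B \<in> alg_L \<theta>"
    "\<And>j x. j \<in> J \<Longrightarrow> blinfun_apply A (blinfun_apply (U j) x) = blinfun_apply (U j) (blinfun_apply B x)"
  shows "A \<in> intertwining"
proof -
  have e: "A o\<^sub>L U j = U j o\<^sub>L B" if "j \<in> J" for j
    by (rule blinfun_eqI) (simp add: assms(3)[OF that])
  then have "compress A = B" using j0 by (intro compress_eqI)
  then show ?thesis using assms(1,2) e by (simp add: intertwining_def)
qed

lemma intertwiningD:
  assumes "A \<in> intertwining"
  shows "clinear_op A" "compress A \<in> alg_L \<theta>"
    "j \<in> J \<Longrightarrow> blinfun_apply A (blinfun_apply (U j) x) = blinfun_apply (U j) (blinfun_apply (compress A) x)"
proof -
  show "clinear_op A" "compress A \<in> alg_L \<theta>" using assms by (auto simp: intertwining_def)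
  assume "j \<in> J"
  then have "A o\<^sub>L U j = U j o\<^sub>L compress A" using assms by (auto simp: intertwining_def)
  from arg_cong[OF this, of "\<lambda>A. blinfun_apply A x"]
  show "blinfun_apply A (blinfun_apply (U j) x) = blinfun_apply (U j) (blinfun_apply (compress A) x)" by simp
qed

lemma unital_subalgebra_intertwining: "unital_subalgebra intertwining"
  unfolding unital_subalgebra_def
proof (intro conjI ballI allI)
  note L = unital_subalgebraD[OF alg_L_subalgebra[of \<theta>]]
  show "clinear_op A" if "A \<in> intertwining" for A using that by (rule intertwiningD)
  show "id_blinfun \<in> intertwining" by (rule intertwiningI[OF clinear_op_id L(2)]) simp
  fix A assume A: "A \<in> intertwining"
  show "A + B \<in> intertwining" "A o\<^sub>L B \<in> intertwining" if B: "B \<in> intertwining" for B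
  proof -
    show "A + B \<in> intertwining"
      by (rule intertwiningI[OF clinear_op_add L(3)[OF intertwiningD(2)[OF A] intertwiningD(2)[OF B]]])
        (use A B in \<open>simp_all add: intertwiningD blinfun.add_left blinfun.add_right\<close>)
    show "A o\<^sub>L B \<in> intertwining"
      by (rule intertwiningI[OF clinear_op_compose L(4)[OF intertwiningD(2)[OF A] intertwiningD(2)[OF B]]])
        (use A B in \<open>simp_all add: intertwiningD\<close>)
  qed
  show "c *\<^sub>O A \<in> intertwining" for c
    by (rule intertwiningI[OF clinear_op_scaleC L(5)[OF intertwiningD(2)[OF A]]])
      (use A in \<open>simp_all add: intertwiningD clinear_opD[OF clU]\<close>)
qed

lemma closedin_intertwining: "closedin wot intertwining"
proof -
  \<comment> \<open>\<open>compress A\<close> is itself made from \<open>A\<close>, so once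
    \<open>U j\<close> is moved to the right as an adjoint, both sides are matrix coefficients of
    \<open>A\<close>.\<close>
  have iff: "(\<forall>j\<in>J. A o\<^sub>L U j = U j o\<^sub>L compress A) \<longleftrightarrow> (\<forall>(j, x, y)\<in>J \<times> UNIV \<times> UNIV.
      cinner (blinfun_apply A (blinfun_apply (U j) x)) y
        = cinner (blinfun_apply A (blinfun_apply (U j0) x)) (blinfun_apply (U j0) (blinfun_apply (adj (U j)) y)))" for A
  proof -
    have "cinner (blinfun_apply (U j) (blinfun_apply (compress A) x)) y
        = cinner (blinfun_apply A (blinfun_apply (U j0) x)) (blinfun_apply (U j0) (blinfun_apply (adj (U j)) y))"
      if "j \<in> J" for j x y
      by (simp add: cinner_adj[OF clU[OF that]] cinner_compress)
    moreover have "A o\<^sub>L U j = U j o\<^sub>L compress A \<longleftrightarrow> (\<forall>x y. cinner (blinfun_apply A (blinfun_apply (U j) x)) y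
        = cinner (blinfun_apply (U j) (blinfun_apply (compress A) x)) y)" for j
    proof
      assume "A o\<^sub>L U j = U j o\<^sub>L compress A"
      from arg_cong[OF this, of blinfun_apply]
      show "\<forall>x y. cinner (blinfun_apply A (blinfun_apply (U j) x)) y
          = cinner (blinfun_apply (U j) (blinfun_apply (compress A) x)) y" by (simp add: fun_eq_iff)
    next
      assume *: "\<forall>x y. cinner (blinfun_apply A (blinfun_apply (U j) x)) y
          = cinner (blinfun_apply (U j) (blinfun_apply (compress A) x)) y"
      show "A o\<^sub>L U j = U j o\<^sub>L compress A"
        by (intro blinfun_eqI cinner_ext_left) (simp add: *)
    qed
    ultimately show ?thesis by (auto simp: Ball_def)
  qed
  have "intertwining = {A. clinear_op A} \<inter> {A \<in> topspace wot. compress A \<in> alg_L \<theta>} \<inter> {A. \<forall>p\<in>J \<times> UNIV \<times> UNIV.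
      cinner (blinfun_apply A (blinfun_apply (U (fst p)) (fst (snd p)))) (snd (snd p))
        = cinner (blinfun_apply A (blinfun_apply (U j0) (fst (snd p))))
            (blinfun_apply (U j0) (blinfun_apply (adj (U (fst p))) (snd (snd p))))}"
    unfolding intertwining_def iff by (auto simp: case_prod_unfold)
  moreover have "closedin wot {A \<in> topspace wot. compress A \<in> alg_L \<theta>}"
    unfolding compress_def
    by (rule closedin_continuous_map_preimage[OF continuous_map_wot_sandwich closedin_two_graph_alg])
      (simp_all add: clinear_op_adj clU[OF j0])
  ultimately show ?thesis
    by (simp only:) (intro closedin_Int closedin_wot_clinear closedin_wot_equations continuous_map_wot)
qed

lemma \<SS>_intertwining: "\<SS> \<subseteq> intertwining"
proof (rule two_graph_alg_minimal[OF unital_subalgebra_intertwining closedin_intertwining])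
  fix i
  show "S i \<in> intertwining"
    using SU[THEN arg_cong[where f = blinfun_apply]]
    by (intro intertwiningI[OF clS two_graph_alg_gen(1)]) (simp add: fun_eq_iff)
next
  fix i
  show "T i \<in> intertwining"
    using TU[THEN arg_cong[where f = blinfun_apply]]
    by (intro intertwiningI[OF clT two_graph_alg_gen(2)]) (simp add: fun_eq_iff)
qed

lemma compress_in: "A \<in> \<SS> \<Longrightarrow> compress A \<in> alg_L \<theta>"
  and compress_intertwines: "A \<in> \<SS> \<Longrightarrow> j \<in> J \<Longrightarrow>
    blinfun_apply A (blinfun_apply (U j) x) = blinfun_apply (U j) (blinfun_apply (compress A) x)"
  using intertwiningD \<SS>_intertwining by blast+

lemma compress_eqI': "(\<And>x. blinfun_apply A (blinfun_apply (U j0) x) = blinfun_apply (U j0) (blinfun_apply B x)) \<Longrightarrow> compress A = B"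
  by (intro compress_eqI blinfun_eqI) simp

lemma compress_hom:
  shows "compress id_blinfun = id_blinfun" "compress (A + B) = compress A + compress B" "compress (c *\<^sub>O A) = c *\<^sub>O compress A"
    and "A \<in> \<SS> \<Longrightarrow> B \<in> \<SS> \<Longrightarrow> compress (A o\<^sub>L B) = compress A o\<^sub>L compress B"
    and "compress (S i) = left_regular_E \<theta> i" "compress (T k) = left_regular_F \<theta> k"
proof -
  show "compress id_blinfun = id_blinfun" by (rule compress_eqI') simp
  show "compress (A + B) = compress A + compress B"
    by (rule blinfun_eqI) (simp add: compress_apply blinfun.add_left blinfun.add_right)
  show "compress (c *\<^sub>O A) = c *\<^sub>O compress A"
    by (rule blinfun_eqI) (simp add: compress_apply clinear_opD[OF clinear_op_adj[OF clU[OF j0]]])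
  \<comment> \<open>Compressions are not multiplicative in general; here the range of
    \<open>U j0\<close> is invariant under \<open>\<SS>\<close>.\<close>
  show "compress (A o\<^sub>L B) = compress A o\<^sub>L compress B" if "A \<in> \<SS>" "B \<in> \<SS>"
    by (rule compress_eqI') (simp add: compress_intertwines[OF that(1) j0] compress_intertwines[OF that(2) j0])
  show "compress (S i) = left_regular_E \<theta> i" "compress (T k) = left_regular_F \<theta> k"
    using SU TU j0 by (auto intro: compress_eqI)
qed

lemma rep_op_U:
  assumes j: "j \<in> J"
  shows "blinfun_apply (rep_op S T w) (blinfun_apply (U j) x) = blinfun_apply (U j) (blinfun_apply (reg_op \<theta> w) x)"
proof -
  have S1: "blinfun_apply (S i) (blinfun_apply (U j) x) = blinfun_apply (U j) (blinfun_apply (left_regular_E \<theta> i) x)" for i x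
    using arg_cong[OF SU[OF j], of "\<lambda>A. blinfun_apply A x" i] by simp
  have T1: "blinfun_apply (T i) (blinfun_apply (U j) x) = blinfun_apply (U j) (blinfun_apply (left_regular_F \<theta> i) x)" for i x
    using arg_cong[OF TU[OF j], of "\<lambda>A. blinfun_apply A x" i] by simp
  have "blinfun_apply (word_op S u) (blinfun_apply (U j) x) = blinfun_apply (U j) (blinfun_apply (word_op (left_regular_E \<theta>) u) x)" for u x
    by (induction u) (simp_all add: S1)
  moreover have "blinfun_apply (word_op T u) (blinfun_apply (U j) x) = blinfun_apply (U j) (blinfun_apply (word_op (left_regular_F \<theta>) u) x)" for u x
    by (induction u) (simp_all add: T1)
  ultimately show ?thesis by (simp add: rep_op_def)
qed

lemma cesaro_U:
  assumes j: "j \<in> J"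
  shows "blinfun_apply (cesaro S T N b) (blinfun_apply (U j) x)
    = blinfun_apply (U j) (blinfun_apply (cesaro (left_regular_E \<theta>) (left_regular_F \<theta>) N b) x)"
  by (simp add: cesaro_def blinfun_sum_left rep_op_U[OF j] blinfun.sum_right clinear_opD[OF clU[OF j]])

lemma cesaro_in: "cesaro S T N b \<in> \<SS>"
  by (intro cesaro_in_subalgebra \<SS>_subalgebra two_graph_alg_gen)

lemma compress_cesaro: "compress (cesaro S T N b) = cesaro (left_regular_E \<theta>) (left_regular_F \<theta>) N b"
  by (rule compress_eqI') (rule cesaro_U[OF j0])

end

text \<open>\<open>total\<close> is the spanning hypothesis, phrased as a proof rule for closed
  subspaces. \<open>rigidity\<close> has the form in which it is applied, an equality of matrix
  norms for Cesaro polynomials.\<close>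

locale total_intertwined_rep = intertwined_rep \<theta> S T J U j0
  for \<theta> :: "'m::finite \<times> 'n::finite \<Rightarrow> 'm \<times> 'n"
    and S :: "'m \<Rightarrow> 'h::chilbert_space \<Rightarrow>\<^sub>L 'h" and T :: "'n \<Rightarrow> 'h \<Rightarrow>\<^sub>L 'h"
    and J :: "'j set" and U :: "'j \<Rightarrow> ('m, 'n) tg ell2 \<Rightarrow>\<^sub>L 'h" and j0 :: 'j +
  assumes total: "closed_csubspace X \<Longrightarrow> (\<And>j x. j \<in> J \<Longrightarrow> blinfun_apply (U j) x \<in> X) \<Longrightarrow> X = UNIV"
    and rigidity: "matrix_norm k (\<lambda>i j. cesaro S T N (b i j))
      = matrix_norm k (\<lambda>i j. cesaro (left_regular_E \<theta>) (left_regular_F \<theta>) N (b i j))"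
begin

lemma norm_cesaro_le:
  assumes "B \<in> alg_L \<theta>"
  shows "norm (cesaro S T N (fourier_coeff B)) \<le> norm B"
proof -
  have "norm (cesaro S T N (fourier_coeff B)) = norm (reg_cesaro \<theta> N B)"
    using rigidity[of 1 N "\<lambda>_ _. fourier_coeff B"] unfolding matrix_norm_1 .
  then show ?thesis using norm_reg_cesaro_le[OF \<theta> assms, of N] by simp
qed

text \<open>The vectors on which \<open>A\<close> and \<open>B\<close> agree form a closed subspace
  containing the range of each \<open>U j\<close>.\<close>

lemma compress_inj: "inj_on compress \<SS>"
proof (rule inj_onI)
  fix A B assume A: "A \<in> \<SS>" and B: "B \<in> \<SS>" and eq: "compress A = compress B"
  have "{x. blinfun_apply A x = blinfun_apply B x} = UNIV"
  proof (rule total)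
    show "closed_csubspace {x. blinfun_apply A x = blinfun_apply B x}"
      using unital_subalgebraD(1)[OF \<SS>_subalgebra A] unital_subalgebraD(1)[OF \<SS>_subalgebra B]
      by (intro closed_csubspaceI closed_Collect_eq)
        (auto simp: blinfun.add_right clinear_opD intro: continuous_intros)
  qed (simp add: compress_intertwines[OF A] compress_intertwines[OF B] eq)
  then show "A = B" by (intro blinfun_eqI) blast
qed

lemma cesaro_limit:
  assumes B: "B \<in> alg_L \<theta>"
  shows "\<exists>A\<in>\<SS>. compress A = B \<and>
    (\<forall>x y. (\<lambda>N. cinner (blinfun_apply (cesaro S T N (fourier_coeff B)) x) y) \<longlonglongrightarrow> cinner (blinfun_apply A x) y)"
proof -
  define C where "C N = cesaro S T N (fourier_coeff B)" for N
  have nC: "norm (C N) \<le> norm B" for N unfolding C_def by (rule norm_cesaro_le[OF B])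
  have C: "C N \<in> \<SS>" for N unfolding C_def by (rule cesaro_in)
  have clC: "clinear_op (C N)" for N by (rule unital_subalgebraD(1)[OF \<SS>_subalgebra C])
  have CU: "(\<lambda>N. cinner (blinfun_apply (C N) (blinfun_apply (U j) x)) y)
      \<longlonglongrightarrow> cinner (blinfun_apply (U j) (blinfun_apply B x)) y" if j: "j \<in> J" for j x y
    using reg_cesaro_tendsto[OF \<theta> B, of x "blinfun_apply (adj (U j)) y"]
    by (simp add: C_def cesaro_U[OF j] cinner_adj[OF clU[OF j]])
  have "convergent (\<lambda>N. cinner (blinfun_apply (C N) x) y)" for x y
  proof -
    \<comment> \<open>No limit is available on the whole space yet, so convergence is expressed by
      differences with later terms, uniformly in the shift \<open>k\<close>.\<close>
    define f where "f N k x = cmod (cinner (blinfun_apply (C N - C (N + k)) x) y)" for N k :: nat and x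
    have "{x. \<forall>\<epsilon>>0. \<forall>\<^sub>F N in sequentially. \<forall>k\<in>UNIV. f N k x \<le> \<epsilon> * (\<lambda>_. 1) k} = UNIV"
    proof (rule total)
      show "closed_csubspace {x. \<forall>\<epsilon>>0. \<forall>\<^sub>F N in sequentially. \<forall>k\<in>UNIV. f N k x \<le> \<epsilon> * (\<lambda>_. 1) k}"
      proof (rule closed_csubspace_uniform_null[where C = "2 * norm B * norm y"])
        fix N k x x' c
        show "f N k (x + x') \<le> f N k x + f N k x'"
          by (simp add: f_def blinfun.add_right cinner_add_left norm_triangle_ineq)
        show "f N k (c *\<^sub>C x) = cmod c * f N k x"
          by (simp add: f_def blinfun.diff_left clinear_opD[OF clC] cinner_scaleC_left norm_mult
              flip: scaleC_diff_right)
        have "f N k x \<le> norm (C N - C (N + k)) * norm x * norm y"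
          unfolding f_def by (rule cmod_cinner_blinfun_le)
        also have "norm (C N - C (N + k)) \<le> 2 * norm B"
          using norm_triangle_ineq4[of "C N" "C (N + k)"] nC[of N] nC[of "N + k"] by linarith
        finally show "f N k x \<le> 2 * norm B * norm y * 1 * norm x"
          by (simp add: mult_right_mono ac_simps)
      qed simp
      fix j x assume j: "j \<in> J"
      have "Cauchy (\<lambda>N. cinner (blinfun_apply (C N) (blinfun_apply (U j) x)) y)"
        using CU[OF j] by (rule LIMSEQ_imp_Cauchy)
      then have "\<exists>M. \<forall>N\<ge>M. \<forall>k. f N k (blinfun_apply (U j) x) \<le> \<epsilon>" if e: "\<epsilon> > 0" for \<epsilon>
      proof -
        obtain M where M: "\<forall>m\<ge>M. \<forall>n\<ge>M. dist (cinner (blinfun_apply (C m) (blinfun_apply (U j) x)) y)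
            (cinner (blinfun_apply (C n) (blinfun_apply (U j) x)) y) < \<epsilon>"
          using metric_CauchyD[OF \<open>Cauchy _\<close> e] by blast
        show ?thesis
        proof (intro exI[of _ M] allI impI)
          fix N k assume "M \<le> N"
          then have "dist (cinner (blinfun_apply (C N) (blinfun_apply (U j) x)) y)
            (cinner (blinfun_apply (C (N + k)) (blinfun_apply (U j) x)) y) < \<epsilon>" using M by simp
          then show "f N k (blinfun_apply (U j) x) \<le> \<epsilon>"
            by (simp add: f_def dist_norm blinfun.diff_left cinner_diff_left)
        qed
      qed
      then show "blinfun_apply (U j) x \<in> {x. \<forall>\<epsilon>>0. \<forall>\<^sub>F N in sequentially. \<forall>k\<in>UNIV. f N k x \<le> \<epsilon> * (\<lambda>_. 1) k}"
        by (simp add: eventually_sequentially)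
    qed
    then have "x \<in> {x. \<forall>\<epsilon>>0. \<forall>\<^sub>F N in sequentially. \<forall>k\<in>UNIV. f N k x \<le> \<epsilon> * (\<lambda>_. 1) k}" by blast
    then show ?thesis
      by (intro convergent_of_uniform_null) (simp add: f_def blinfun.diff_left cinner_diff_left)
  qed
  then obtain A where A: "clinear_op A" "\<And>x y. (\<lambda>N. cinner (blinfun_apply (C N) x) y) \<longlonglongrightarrow> cinner (blinfun_apply A x) y"
    using weak_limit_operator[of C "norm B"] clC nC by blast
  have "A \<in> \<SS>" by (rule closedin_wot_limit[OF \<SS>_closed C A(2)])
  moreover have "compress A = B"
    by (intro compress_eqI' cinner_ext_left LIMSEQ_unique[OF A(2) CU[OF j0]])
  ultimately show ?thesis using A(2) unfolding C_def by blast
qed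

lemma cesaro_tendsto:
  assumes A: "A \<in> \<SS>"
  shows "(\<lambda>N. cinner (blinfun_apply (cesaro S T N (fourier_coeff (compress A))) x) y) \<longlonglongrightarrow> cinner (blinfun_apply A x) y"
proof -
  obtain A' where A': "A' \<in> \<SS>" "compress A' = compress A"
    "\<And>x y. (\<lambda>N. cinner (blinfun_apply (cesaro S T N (fourier_coeff (compress A))) x) y) \<longlonglongrightarrow> cinner (blinfun_apply A' x) y"
    using cesaro_limit[OF compress_in[OF A]] by blast
  then have "A' = A" using compress_inj A by (auto dest: inj_onD)
  then show ?thesis using A'(3) by simp
qed

lemma bij_betw_compress: "bij_betw compress \<SS> (alg_L \<theta>)"
  unfolding bij_betw_def
proof (intro conjI compress_inj subset_antisym subsetI)
  show "B \<in> compress ` \<SS>" if "B \<in> alg_L \<theta>" for B using cesaro_limit[OF that] by blast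
qed (auto simp: compress_in)

lemma algebra_isomorphism_compress: "algebra_isomorphism \<SS> (alg_L \<theta>) compress"
  unfolding algebra_isomorphism_def using bij_betw_compress compress_hom(1-4) by blast

text \<open>One inequality holds for any compression by an isometry. For the other, \<open>A\<close>
  is the weak limit of its Cesaro polynomials; rigidity moves their matrix norms to the regular
  side, where the means are completely contractive.\<close>

lemma completely_isometric_compress: "completely_isometric_on \<SS> compress"
  unfolding completely_isometric_on_def
proof (intro allI impI antisym)
  fix k and A :: "nat \<Rightarrow> nat \<Rightarrow> _" assume A: "\<forall>i<k. \<forall>j<k. A i j \<in> \<SS>"
  show "matrix_norm k (\<lambda>i j. compress (A i j)) \<le> matrix_norm k A"
  proof (rule matrix_norm_leI[OF matrix_norm_nonneg])
    fix x y
    have "matrix_form k (\<lambda>i j. compress (A i j)) x y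
        = matrix_form k A (\<lambda>j. blinfun_apply (U j0) (x j)) (\<lambda>i. blinfun_apply (U j0) (y i))"
      by (simp add: matrix_form_def cinner_compress)
    then show "cmod (matrix_form k (\<lambda>i j. compress (A i j)) x y)
        \<le> matrix_norm k A * L2_set (\<lambda>j. norm (x j)) {..<k} * L2_set (\<lambda>i. norm (y i)) {..<k}"
      using matrix_form_le[of k A "\<lambda>j. blinfun_apply (U j0) (x j)" "\<lambda>i. blinfun_apply (U j0) (y i)"]
      by (simp add: norm_cinner_isometry[OF isoU[OF j0]])
  qed
  show "matrix_norm k A \<le> matrix_norm k (\<lambda>i j. compress (A i j))"
  proof (rule matrix_norm_leI[OF matrix_norm_nonneg])
    fix x y
    let ?C = "\<lambda>N i j. cesaro S T N (fourier_coeff (compress (A i j)))"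
    have "(\<lambda>N. matrix_form k (?C N) x y) \<longlonglongrightarrow> matrix_form k A x y"
      unfolding matrix_form_def using A by (intro tendsto_sum cesaro_tendsto) auto
    then have lim: "(\<lambda>N. cmod (matrix_form k (?C N) x y)) \<longlonglongrightarrow> cmod (matrix_form k A x y)"
      by (rule tendsto_norm)
    have "cmod (matrix_form k (?C N) x y) \<le> matrix_norm k (\<lambda>i j. compress (A i j))
        * L2_set (\<lambda>j. norm (x j)) {..<k} * L2_set (\<lambda>i. norm (y i)) {..<k}" for N
    proof -
      have "matrix_norm k (?C N) \<le> matrix_norm k (\<lambda>i j. compress (A i j))"
        unfolding rigidity using A by (intro matrix_norm_reg_cesaro_le[OF \<theta>] compress_in) auto
      then have "matrix_norm k (?C N) * L2_set (\<lambda>j. norm (x j)) {..<k} * L2_set (\<lambda>i. norm (y i)) {..<k}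
          \<le> matrix_norm k (\<lambda>i j. compress (A i j)) * L2_set (\<lambda>j. norm (x j)) {..<k} * L2_set (\<lambda>i. norm (y i)) {..<k}"
        by (intro mult_right_mono L2_set_nonneg)
      then show ?thesis using matrix_form_le[of k "?C N" x y] by linarith
    qed
    then show "cmod (matrix_form k A x y) \<le> matrix_norm k (\<lambda>i j. compress (A i j))
        * L2_set (\<lambda>j. norm (x j)) {..<k} * L2_set (\<lambda>i. norm (y i)) {..<k}"
      by (intro LIMSEQ_le_const2[OF lim] exI allI impI)
  qed
qed

section \<open>The inverse of the compression and its weak* continuity\<close>

definition lift :: "(('m, 'n) tg ell2 \<Rightarrow>\<^sub>L ('m, 'n) tg ell2) \<Rightarrow> ('h \<Rightarrow>\<^sub>L 'h)" where
  "lift = inv_into \<SS> compress"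

lemma lift: "B \<in> alg_L \<theta> \<Longrightarrow> lift B \<in> \<SS>" "B \<in> alg_L \<theta> \<Longrightarrow> compress (lift B) = B" "A \<in> \<SS> \<Longrightarrow> lift (compress A) = A"
  using bij_betw_compress
  by (auto simp: lift_def bij_betw_def intro: inv_into_into f_inv_into_f)

lemma lift_hom:
  assumes "A \<in> alg_L \<theta>" "B \<in> alg_L \<theta>"
  shows "lift (A + B) = lift A + lift B" "lift (c *\<^sub>O A) = c *\<^sub>O lift A"
    "lift (cesaro (left_regular_E \<theta>) (left_regular_F \<theta>) N b) = cesaro S T N b"
proof -
  note D = unital_subalgebraD[OF \<SS>_subalgebra]
  show "lift (A + B) = lift A + lift B"
    using lift(3)[OF D(3)[OF lift(1)[OF assms(1)] lift(1)[OF assms(2)]]] by (simp add: compress_hom lift(2) assms)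
  show "lift (c *\<^sub>O A) = c *\<^sub>O lift A"
    using lift(3)[OF D(5)[OF lift(1)[OF assms(1)]]] by (simp add: compress_hom lift(2) assms)
  show "lift (cesaro (left_regular_E \<theta>) (left_regular_F \<theta>) N b) = cesaro S T N b"
    using lift(3)[OF cesaro_in] by (simp add: compress_cesaro)
qed

lemma norm_lift: "B \<in> alg_L \<theta> \<Longrightarrow> norm (lift B) = norm B"
  using completely_isometric_compress[unfolded completely_isometric_on_def, rule_format, of 1 "\<lambda>_ _. lift B"]
  unfolding matrix_norm_1 by (simp add: lift)

lemma norm_lift_diff:
  assumes "B \<in> alg_L \<theta>"
  shows "norm (lift B - cesaro S T N (fourier_coeff B)) \<le> 2 * norm B"
  using norm_triangle_ineq4[of "lift B" "cesaro S T N (fourier_coeff B)"] norm_lift[OF assms] norm_cesaro_le[OF assms, of N]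
  by linarith

text \<open>On the range of \<open>U j\<close> the coefficient against \<open>y\<close> is one of
  \<open>B - reg_cesaro \<theta> N B\<close> against \<open>adj (U j) y\<close>, so the uniform
  estimate for \<open>alg_L \<theta>\<close> applies. Totality and \<open>norm_lift_diff\<close>
  extend it to all vectors.\<close>

lemma cesaro_uniform:
  assumes \<epsilon>: "\<epsilon> > 0"
  shows "\<forall>\<^sub>F N in sequentially. \<forall>B\<in>alg_L \<theta>.
    cmod (cinner (blinfun_apply (lift B - cesaro S T N (fourier_coeff B)) x) y) \<le> \<epsilon> * norm B"
proof -
  define f where "f N B x = cmod (cinner (blinfun_apply (lift B - cesaro S T N (fourier_coeff B)) x) y)" for N B x
  have "{x. \<forall>\<epsilon>>0. \<forall>\<^sub>F N in sequentially. \<forall>B\<in>alg_L \<theta>. f N B x \<le> \<epsilon> * norm B} = UNIV"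
  proof (rule total)
    show "closed_csubspace {x. \<forall>\<epsilon>>0. \<forall>\<^sub>F N in sequentially. \<forall>B\<in>alg_L \<theta>. f N B x \<le> \<epsilon> * norm B}"
    proof (rule closed_csubspace_uniform_null[where C = "2 * norm y"])
      fix N B x x' c assume B: "B \<in> alg_L \<theta>"
      have cl: "clinear_op (lift B)" "clinear_op (cesaro S T N (fourier_coeff B))"
        using unital_subalgebraD(1)[OF \<SS>_subalgebra] lift(1)[OF B] cesaro_in by blast+
      show "f N B (x + x') \<le> f N B x + f N B x'"
        by (simp add: f_def blinfun.add_right cinner_add_left norm_triangle_ineq)
      show "f N B (c *\<^sub>C x) = cmod c * f N B x"
        by (simp add: f_def blinfun.diff_left clinear_opD[OF cl(1)] clinear_opD[OF cl(2)] cinner_scaleC_left norm_mult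
            flip: scaleC_diff_right)
      have "f N B x \<le> norm (lift B - cesaro S T N (fourier_coeff B)) * norm x * norm y"
        unfolding f_def by (rule cmod_cinner_blinfun_le)
      also have "\<dots> \<le> 2 * norm B * norm x * norm y"
        by (intro mult_right_mono norm_lift_diff[OF B]) auto
      finally show "f N B x \<le> 2 * norm y * norm B * norm x" by (simp add: ac_simps)
    qed simp
    fix j x assume j: "j \<in> J"
    have "f N B (blinfun_apply (U j) x)
        = cmod (cinner (blinfun_apply (B - reg_cesaro \<theta> N B) x) (blinfun_apply (adj (U j)) y))" if B: "B \<in> alg_L \<theta>" for N B
      by (simp add: f_def blinfun.diff_left compress_intertwines[OF lift(1)[OF B] j] lift(2)[OF B] cesaro_U[OF j]
          cinner_diff_left cinner_adj[OF clU[OF j]])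
    then show "blinfun_apply (U j) x \<in> {x. \<forall>\<epsilon>>0. \<forall>\<^sub>F N in sequentially. \<forall>B\<in>alg_L \<theta>. f N B x \<le> \<epsilon> * norm B}"
      using reg_cesaro_uniform[OF \<theta>, of _ x "blinfun_apply (adj (U j)) y"] by simp
  qed
  then show ?thesis using \<epsilon> unfolding f_def by blast
qed

text \<open>The vectors \<open>x k\<close> and \<open>y k\<close> need not lie in the range of any
  \<open>U j\<close>. So the transported functional is shown to be Cesaro continuous, and
  \<open>cesaro_continuous_representation\<close> supplies new vectors.\<close>

lemma lift_functional:
  assumes x: "summable (\<lambda>k::nat. (norm (x k))\<^sup>2)" and y: "summable (\<lambda>k. (norm (y k))\<^sup>2)"
  shows "\<exists>u v :: nat \<Rightarrow> ('m, 'n) tg ell2. summable (\<lambda>k. (norm (u k))\<^sup>2) \<and> summable (\<lambda>k. (norm (v k))\<^sup>2) \<and>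
    (\<forall>B\<in>alg_L \<theta>. (\<Sum>k. cinner (blinfun_apply (lift B) (x k)) (y k)) = (\<Sum>k. cinner (blinfun_apply B (u k)) (v k)))"
proof -
  define r where "r B = (\<Sum>k. cinner (blinfun_apply (lift B) (x k)) (y k))" for B
  define a where "a k = (norm (x k))\<^sup>2 + (norm (y k))\<^sup>2" for k
  have a: "summable a" unfolding a_def by (intro summable_add x y)
  have a0: "a k \<ge> 0" for k by (simp add: a_def)
  have le_a: "cmod (cinner (blinfun_apply A (x k)) (y k)) \<le> norm A * a k" for A k
  proof -
    have "cmod (cinner (blinfun_apply A (x k)) (y k)) \<le> norm A * (norm (x k) * norm (y k))"
      using cmod_cinner_blinfun_le[of A "x k" "y k"] by (simp add: mult.assoc)
    also have "\<dots> \<le> norm A * a k"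
      using zero_le_power2[of "norm (x k) - norm (y k)"] zero_le_power2[of "norm (x k)"] zero_le_power2[of "norm (y k)"]
      unfolding power2_diff a_def by (intro mult_left_mono norm_ge_zero) linarith
    finally show ?thesis .
  qed
  have sn: "summable (\<lambda>k. cmod (cinner (blinfun_apply A (x k)) (y k)))" for A by (rule summable_cinner[OF x y])
  have s: "summable (\<lambda>k. cinner (blinfun_apply A (x k)) (y k))" for A by (rule summable_norm_cancel[OF sn])
  define \<epsilon> where "\<epsilon> = suminf a + 1"
  have \<epsilon>: "\<epsilon> > 0" using suminf_nonneg[OF a a0] by (simp add: \<epsilon>_def)
  have bd: "cmod (r B) \<le> \<epsilon> * norm B" if B: "B \<in> alg_L \<theta>" for B
  proof -
    have "cmod (r B) \<le> (\<Sum>k. cmod (cinner (blinfun_apply (lift B) (x k)) (y k)))"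
      unfolding r_def by (rule summable_norm[OF sn])
    also have "\<dots> \<le> (\<Sum>k. norm (lift B) * a k)"
      by (intro suminf_le le_a sn summable_mult a)
    also have "\<dots> = norm B * suminf a" by (simp add: suminf_mult[OF a] norm_lift[OF B])
    also have "\<dots> \<le> norm B * \<epsilon>" by (intro mult_left_mono) (simp_all add: \<epsilon>_def)
    finally show ?thesis by (simp add: mult.commute)
  qed
  have "cesaro_continuous \<theta> r"
    unfolding cesaro_continuous_def
  proof (intro conjI ballI allI impI)
    show "r (A + B) = r A + r B" if "A \<in> alg_L \<theta>" "B \<in> alg_L \<theta>" for A B
      by (simp add: r_def lift_hom[OF that] blinfun.add_left cinner_add_left suminf_add[OF s s])
    show "r (c *\<^sub>O A) = c * r A" if "A \<in> alg_L \<theta>" for A c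
      by (simp add: r_def lift_hom[OF that that] cinner_scaleC_left suminf_mult[OF s])
    fix e :: real assume e: "e > 0"
    \<comment> \<open>Beyond \<open>K\<close> only the bound \<open>2 * norm B\<close> on the
      difference is available, hence a quarter of \<open>e\<close>; the first \<open>K\<close> terms
      share the other half of the error through \<open>\<delta>\<close>.\<close>
    obtain K where K: "norm (\<Sum>k. a (k + K)) < e/4"
      using suminf_exist_split[of "e/4" a] a e by auto
    define n where "n = real K + 1"
    have n: "n > 0" unfolding n_def by linarith
    define \<delta> where "\<delta> = e / (2 * n)"
    have \<delta>: "\<delta> > 0" using e n by (simp add: \<delta>_def)
    have "real K * \<delta> \<le> n * \<delta>" using \<delta> by (intro mult_right_mono) (simp_all add: n_def)
    also have "\<dots> = e/2" using n by (simp add: \<delta>_def)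
    finally have \<delta>K: "real K * \<delta> \<le> e/2" .
    have "\<forall>\<^sub>F N in sequentially. \<forall>k\<in>{..<K}. \<forall>B\<in>alg_L \<theta>.
        cmod (cinner (blinfun_apply (lift B - cesaro S T N (fourier_coeff B)) (x k)) (y k)) \<le> \<delta> * norm B"
      by (intro eventually_ball_finite ballI cesaro_uniform[OF \<delta>]) simp
    then show "\<forall>\<^sub>F N in sequentially. \<forall>B\<in>alg_L \<theta>. cmod (r B - r (reg_cesaro \<theta> N B)) \<le> e * norm B"
    proof eventually_elim
      case (elim N)
      show ?case
      proof
        fix B assume B: "B \<in> alg_L \<theta>"
        define D where "D = lift B - cesaro S T N (fourier_coeff B)"
        have nD: "norm D \<le> 2 * norm B" unfolding D_def by (rule norm_lift_diff[OF B])
        have "r B - r (reg_cesaro \<theta> N B) = (\<Sum>k. cinner (blinfun_apply D (x k)) (y k))"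
          by (simp add: r_def lift_hom(3)[OF B B] D_def blinfun.diff_left cinner_diff_left suminf_diff[OF s s])
        also have "\<dots> = (\<Sum>k. cinner (blinfun_apply D (x (k + K))) (y (k + K))) + (\<Sum>k<K. cinner (blinfun_apply D (x k)) (y k))"
          by (rule suminf_split_initial_segment[OF s])
        finally have split: "r B - r (reg_cesaro \<theta> N B) = \<dots>" .
        have "cmod (\<Sum>k. cinner (blinfun_apply D (x (k + K))) (y (k + K)))
            \<le> (\<Sum>k. cmod (cinner (blinfun_apply D (x (k + K))) (y (k + K))))"
          by (rule summable_norm[OF summable_ignore_initial_segment[OF sn]])
        also have "\<dots> \<le> (\<Sum>k. norm D * a (k + K))"
          by (intro suminf_le le_a summable_mult summable_ignore_initial_segment[OF sn] summable_ignore_initial_segment[OF a])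
        also have "\<dots> = norm D * (\<Sum>k. a (k + K))"
          by (rule suminf_mult[OF summable_ignore_initial_segment[OF a]])
        also have "\<dots> \<le> (2 * norm B) * (e/4)"
          using K a0 nD by (intro mult_mono suminf_nonneg summable_ignore_initial_segment[OF a]) auto
        finally have tail: "cmod (\<Sum>k. cinner (blinfun_apply D (x (k + K))) (y (k + K))) \<le> e/2 * norm B" by simp
        have "cmod (\<Sum>k<K. cinner (blinfun_apply D (x k)) (y k)) \<le> (\<Sum>k<K. \<delta> * norm B)"
          using elim B unfolding D_def by (intro sum_norm_le) auto
        also have "\<dots> = (real K * \<delta>) * norm B" by simp
        also have "\<dots> \<le> e/2 * norm B" by (intro mult_right_mono \<delta>K) simp
        finally show "cmod (r B - r (reg_cesaro \<theta> N B)) \<le> e * norm B"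
          unfolding split using tail by (intro order_trans[OF norm_triangle_ineq]) simp
      qed
    qed
  qed
  from cesaro_continuous_representation[OF \<theta> this \<epsilon> bd] show ?thesis unfolding r_def .
qed

text \<open>The compression is absorbed into the vectors by \<open>U j0\<close>, which preserves
  square summability; for the inverse, \<open>lift_functional\<close> does the same.\<close>

lemma homeomorphic_compress:
  "homeomorphic_map (subtopology weak_star \<SS>) (subtopology weak_star (alg_L \<theta>)) compress"
proof -
  have comp_cont: "continuous_map (subtopology weak_star \<SS>) (subtopology weak_star (alg_L \<theta>)) compress"
  proof (rule continuous_map_into_weak_star)
    fix x y :: "nat \<Rightarrow> ('m, 'n) tg ell2"
    assume "summable (\<lambda>k. (norm (x k))\<^sup>2)" "summable (\<lambda>k. (norm (y k))\<^sup>2)"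
    then show "continuous_map (subtopology weak_star \<SS>) euclidean (\<lambda>A. \<Sum>k. cinner (blinfun_apply (compress A) (x k)) (y k))"
      unfolding cinner_compress
      by (intro continuous_map_from_subtopology continuous_map_weak_star)
        (simp_all add: norm_cinner_isometry[OF isoU[OF j0]])
  qed (simp add: compress_in)
  have lift_cont: "continuous_map (subtopology weak_star (alg_L \<theta>)) (subtopology weak_star \<SS>) lift"
  proof (rule continuous_map_into_weak_star)
    fix x y :: "nat \<Rightarrow> 'h"
    assume xy: "summable (\<lambda>k. (norm (x k))\<^sup>2)" "summable (\<lambda>k. (norm (y k))\<^sup>2)"
    obtain u v :: "nat \<Rightarrow> ('m, 'n) tg ell2" where uv: "summable (\<lambda>k. (norm (u k))\<^sup>2)" "summable (\<lambda>k. (norm (v k))\<^sup>2)"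
      "\<forall>B\<in>alg_L \<theta>. (\<Sum>k. cinner (blinfun_apply (lift B) (x k)) (y k)) = (\<Sum>k. cinner (blinfun_apply B (u k)) (v k))"
      using lift_functional[OF xy] by blast
    show "continuous_map (subtopology weak_star (alg_L \<theta>)) euclidean (\<lambda>B. \<Sum>k. cinner (blinfun_apply (lift B) (x k)) (y k))"
      by (rule continuous_map_eq[OF continuous_map_from_subtopology[OF continuous_map_weak_star[OF uv(1,2)]]])
        (use uv(3) in simp)
  qed (simp add: lift)
  show ?thesis
    unfolding homeomorphic_map_maps homeomorphic_maps_def
    using comp_cont lift_cont by (intro exI[of _ lift]) (simp add: lift)
qed

lemma analytic_isomorphism_compress: "analytic_isomorphism \<theta> S T compress"
  unfolding analytic_isomorphism_def
proof (intro conjI)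
  show "canonical \<theta> S T compress" by (simp add: canonical_def compress_hom)
  show "completely_bounded_on \<SS> compress"
    using completely_isometric_compress unfolding completely_bounded_on_def completely_isometric_on_def
    by (intro exI[of _ 1]) simp
  show "completely_bounded_on (alg_L \<theta>) (inv_into \<SS> compress)"
    unfolding completely_bounded_on_def lift_def[symmetric]
  proof (intro exI[of _ 1] allI impI)
    fix k and B :: "nat \<Rightarrow> nat \<Rightarrow> _" assume B: "\<forall>i<k. \<forall>j<k. B i j \<in> alg_L \<theta>"
    then have "\<forall>i<k. \<forall>j<k. lift (B i j) \<in> \<SS>" by (simp add: lift(1))
    then have "matrix_norm k (\<lambda>i j. compress (lift (B i j))) = matrix_norm k (\<lambda>i j. lift (B i j))"
      using completely_isometric_compress[unfolded completely_isometric_on_def, THEN spec, THEN spec,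
          of k "\<lambda>i j. lift (B i j)"] by (rule rev_mp)
    moreover have "matrix_norm k (\<lambda>i j. compress (lift (B i j))) = matrix_norm k B"
      by (rule matrix_norm_cong) (simp add: B lift(2))
    ultimately show "matrix_norm k (\<lambda>i j. lift (B i j)) \<le> 1 * matrix_norm k B" by simp
  qed
qed (rule algebra_isomorphism_compress homeomorphic_compress)+

end


section \<open>Wandering vectors\<close>

text \<open>\<open>push_f\<close> mirrors the commutation relations, so moving \<open>T j\<close>
  through \<open>word_op S u\<close> changes letter and word exactly as \<open>push_f\<close>
  prescribes.\<close>

lemma rep_op_gen_mult:
  assumes \<theta>: "bij \<theta>" and rep: "isometric_representation \<theta> S T"
  shows "rep_op S T (gen_mult \<theta> (Inl i) w) = S i o\<^sub>L rep_op S T w"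
    and "rep_op S T (gen_mult \<theta> (Inr j) w) = T j o\<^sub>L rep_op S T w"
proof -
  have comm: "S i o\<^sub>L T j = T j' o\<^sub>L S i'" if "\<theta> (i, j) = (i', j')" for i j i' j'
    using rep that by (simp add: isometric_representation_def)
  have push: "T j o\<^sub>L word_op S u = word_op S u' o\<^sub>L T j'" if "push_f \<theta> j u = (u', j')" for j u u' j'
    using that
  proof (induction u arbitrary: j u' j')
    case Nil
    then show ?case by (auto intro!: blinfun_eqI)
  next
    case (Cons i u)
    obtain i0 k where ik: "inv \<theta> (i, j) = (i0, k)" by fastforce
    obtain u1 k1 where uk: "push_f \<theta> k u = (u1, k1)" by fastforce
    have u': "u' = i0 # u1" "j' = k1" using Cons.prems by (auto simp: ik uk)
    have "\<theta> (i0, k) = (i, j)" using \<theta> ik by (metis bij_inv_eq_iff)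
    then have "T j o\<^sub>L S i = S i0 o\<^sub>L T k" using comm by simp
    then show ?case using Cons.IH[OF uk] unfolding u' word_op_simps by (metis blinfun_compose_assoc)
  qed
  obtain u v where w: "w = (u, v)" by (cases w)
  show "rep_op S T (gen_mult \<theta> (Inl i) w) = S i o\<^sub>L rep_op S T w"
    by (simp add: w rep_op_def blinfun_compose_assoc)
  obtain u' j' where p: "push_f \<theta> j u = (u', j')" by fastforce
  show "rep_op S T (gen_mult \<theta> (Inr j) w) = T j o\<^sub>L rep_op S T w"
    using push[OF p] by (simp add: w rep_op_def p) (metis blinfun_compose_assoc)
qed

lemma isometric_representation_clinear:
  assumes "isometric_representation \<theta> S T"
  shows "clinear_op (S i)" "clinear_op (T j)"
  using assms by (simp_all add: isometric_representation_def)

text \<open>The vectors \<open>(ST)\<^sub>w \<zeta>\<close> are orthonormal, and the isometry sends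
  \<open>ket w\<close> to them. The intertwining relations then need checking on basis vectors
  only.\<close>

lemma wandering_isometry:
  assumes \<theta>: "bij \<theta>" and rep: "isometric_representation \<theta> S T" and w: "wandering S T \<zeta>"
  shows "\<exists>U. clinear_op U \<and> (\<forall>x y. cinner (blinfun_apply U x) (blinfun_apply U y) = cinner x y) \<and>
    blinfun_apply U (ket tg_one) = \<zeta> \<and>
    (\<forall>i. S i o\<^sub>L U = U o\<^sub>L left_regular_E \<theta> i) \<and> (\<forall>j. T j o\<^sub>L U = U o\<^sub>L left_regular_F \<theta> j)"
proof -
  obtain U where U: "clinear_op U" "\<And>w. blinfun_apply U (ket w) = blinfun_apply (rep_op S T w) \<zeta>"
    "\<And>x y. cinner (blinfun_apply U x) (blinfun_apply U y) = cinner x y"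
    using isometry_of_orthonormal_family[of "\<lambda>w. blinfun_apply (rep_op S T w) \<zeta>"] w
    unfolding wandering_def by blast
  note cl = isometric_representation_clinear[OF rep]
  have "S i o\<^sub>L U = U o\<^sub>L left_regular_E \<theta> i" for i
    by (rule clinear_op_eq_on_ket)
      (simp_all add: clinear_op_compose cl U left_regular_ket[OF \<theta>] rep_op_gen_mult[OF \<theta> rep] del: gen_mult.simps)
  moreover have "T j o\<^sub>L U = U o\<^sub>L left_regular_F \<theta> j" for j
    by (rule clinear_op_eq_on_ket)
      (simp_all add: clinear_op_compose cl U left_regular_ket[OF \<theta>] rep_op_gen_mult[OF \<theta> rep] del: gen_mult.simps)
  moreover have "blinfun_apply U (ket tg_one) = \<zeta>" by (simp add: U rep_op_def)
  ultimately show ?thesis using U by blast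
qed

text \<open>The isomorphism from rigidity matches generators, so it sends each polynomial in
  \<open>(S, T)\<close> to the same polynomial in the left regular operators.\<close>

lemma rigid_matrix_norm_cesaro:
  fixes \<theta> :: "'m::finite \<times> 'n::finite \<Rightarrow> 'm \<times> 'n" and S :: "'m \<Rightarrow> 'h::chilbert_space \<Rightarrow>\<^sub>L 'h"
  assumes rep: "isometric_representation \<theta> S T" and rig: "rigid \<theta> S T"
  shows "matrix_norm k (\<lambda>i j. cesaro S T N (b i j))
    = matrix_norm k (\<lambda>i j. cesaro (left_regular_E \<theta>) (left_regular_F \<theta>) N (b i j))"
proof -
  define P where "P = unital_subalgebra hull (range S \<union> range T)"
  have P: "unital_subalgebra P"
    unfolding P_def by (rule unital_subalgebra_hull) (rule isometric_representation_clinear[OF rep])+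
  have gen: "S i \<in> P" "T j \<in> P" for i j
    using hull_subset[of "range S \<union> range T" unital_subalgebra] by (auto simp: P_def)
  have PN: "A \<in> P \<Longrightarrow> A \<in> norm_closed_alg S T" for A
    using closure_subset by (auto simp: norm_closed_alg_def P_def)
  note D = unital_subalgebraD[OF P]
  obtain \<phi> where iso: "algebra_isomorphism (norm_closed_alg S T) (alg_A \<theta>) \<phi>" and can: "canonical \<theta> S T \<phi>"
    and ci: "completely_isometric_on (norm_closed_alg S T) \<phi>" using rig unfolding rigid_def by blast
  have hom: "\<phi> id_blinfun = id_blinfun" "A \<in> P \<Longrightarrow> B \<in> P \<Longrightarrow> \<phi> (A + B) = \<phi> A + \<phi> B"
    "A \<in> P \<Longrightarrow> B \<in> P \<Longrightarrow> \<phi> (A o\<^sub>L B) = \<phi> A o\<^sub>L \<phi> B" "A \<in> P \<Longrightarrow> \<phi> (c *\<^sub>O A) = c *\<^sub>O \<phi> A" for A B c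
    using iso PN unfolding algebra_isomorphism_def by simp_all
  have S: "\<phi> (word_op S u) = word_op (left_regular_E \<theta>) u" for u
    using can by (induction u) (simp_all add: hom gen unital_subalgebra_word_op[OF P] canonical_def)
  have T: "\<phi> (word_op T u) = word_op (left_regular_F \<theta>) u" for u
    using can by (induction u) (simp_all add: hom gen unital_subalgebra_word_op[OF P] canonical_def)
  have rep_op: "\<phi> (rep_op S T w) = reg_op \<theta> w" for w
    by (simp add: rep_op_def hom gen unital_subalgebra_word_op[OF P] S T)
  have z: "\<phi> 0 = 0"
  proof -
    have "0 *\<^sub>O id_blinfun = (0 :: 'h \<Rightarrow>\<^sub>L 'h)" "0 *\<^sub>O id_blinfun = (0 :: ('m, 'n) tg ell2 \<Rightarrow>\<^sub>L ('m, 'n) tg ell2)"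
      by (rule blinfun_eqI, simp)+
    then show ?thesis using hom(4)[OF D(2), of 0] hom(1) by simp
  qed
  have sum: "\<phi> (\<Sum>w\<in>W. c w *\<^sub>O rep_op S T w) = (\<Sum>w\<in>W. c w *\<^sub>O reg_op \<theta> w)" for W c
  proof (induction W rule: infinite_finite_induct)
    case (insert w W)
    have "c w *\<^sub>O rep_op S T w \<in> P" "(\<Sum>w\<in>W. c w *\<^sub>O rep_op S T w) \<in> P"
      by (intro unital_subalgebra_sum[OF P] D(5) unital_subalgebra_rep_op[OF P] gen)+
    then show ?case using insert by (simp add: hom D unital_subalgebra_rep_op[OF P] gen rep_op)
  qed (simp_all add: z)
  have "cesaro S T N (b i j) \<in> norm_closed_alg S T" for i j
    by (intro PN cesaro_in_subalgebra P gen)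
  then have "matrix_norm k (\<lambda>i j. \<phi> (cesaro S T N (b i j))) = matrix_norm k (\<lambda>i j. cesaro S T N (b i j))"
    using ci[unfolded completely_isometric_on_def, THEN spec, THEN spec, of k "\<lambda>i j. cesaro S T N (b i j)"] by blast
  moreover have "\<phi> (cesaro S T N (b i j)) = cesaro (left_regular_E \<theta>) (left_regular_F \<theta>) N (b i j)" for i j
    unfolding cesaro_def by (rule sum)
  ultimately show ?thesis by simp
qed

text \<open>On the zero space the identity equals 0, and an isomorphism would carry this over to
  \<open>ell2\<close>. This rules out an empty \<open>J\<close>.\<close>

lemma rigid_nontrivial:
  fixes \<theta> :: "'m \<times> 'n \<Rightarrow> 'm \<times> 'n" and S :: "'m \<Rightarrow> 'h::chilbert_space \<Rightarrow>\<^sub>L 'h"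
  assumes rep: "isometric_representation \<theta> S T" and rig: "rigid \<theta> S T"
  shows "\<exists>x :: 'h. x \<noteq> 0"
proof (rule ccontr)
  assume "\<not> ?thesis"
  then have "0 *\<^sub>O id_blinfun = (id_blinfun :: 'h \<Rightarrow>\<^sub>L 'h)" by (auto intro: blinfun_eqI)
  moreover obtain \<phi> where iso: "algebra_isomorphism (norm_closed_alg S T) (alg_A \<theta>) \<phi>"
    using rig unfolding rigid_def by blast
  moreover have "id_blinfun \<in> norm_closed_alg S T"
    using unital_subalgebraD(2)[OF unital_subalgebra_hull[of S T]] isometric_representation_clinear[OF rep] closure_subset
    unfolding norm_closed_alg_def by blast
  ultimately have "0 *\<^sub>O id_blinfun = (id_blinfun :: ('m, 'n) tg ell2 \<Rightarrow>\<^sub>L ('m, 'n) tg ell2)"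
    unfolding algebra_isomorphism_def by metis
  then have "blinfun_apply (0 *\<^sub>O id_blinfun) (ket tg_one) = (ket tg_one :: ('m, 'n) tg ell2)" by simp
  then have "norm (ket tg_one :: ('m, 'n) tg ell2) = 0" by simp
  then show False by (simp only: norm_ket)
qed

theorem lemma3p9:
  fixes \<theta> :: "'m::finite \<times> 'n::finite \<Rightarrow> 'm \<times> 'n"
    and S :: "'m \<Rightarrow> 'h::chilbert_space \<Rightarrow>\<^sub>L 'h"
    and T :: "'n \<Rightarrow> 'h \<Rightarrow>\<^sub>L 'h"
    and \<zeta> :: "'j \<Rightarrow> 'h"
    and J :: "'j set"
  assumes "CARD('m) > 1 \<or> CARD('n) > 1"
    and "bij \<theta>"
    and "isometric_representation \<theta> S T"
    and "rigid \<theta> S T"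
    and "\<forall>j\<in>J. wandering S T (\<zeta> j)"
    and "closed_join (\<lambda>j. cyclic_subspace (two_graph_alg S T) (\<zeta> j)) J = UNIV"
  shows "analytic \<theta> S T \<and>
    (\<exists>\<phi>. analytic_isomorphism \<theta> S T \<phi> \<and> completely_isometric_on (two_graph_alg S T) \<phi>)"
proof -
  note \<theta> = assms(2) and rep = assms(3) and rig = assms(4)
  let ?M = "\<lambda>j. cyclic_subspace (two_graph_alg S T) (\<zeta> j)"
  have join: "X = UNIV" if X: "closed_csubspace X" and M: "\<And>j. j \<in> J \<Longrightarrow> ?M j \<subseteq> X" for X
  proof -
    have "closed_join ?M J \<subseteq> X"
      unfolding closed_join_def by (rule hull_minimal) (use X M in blast)+
    then show ?thesis using assms(6) by blast
  qed
  have "J \<noteq> {}"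
  proof
    assume "J = {}"
    then have "{0 :: 'h} = UNIV" by (intro join closed_csubspaceI) auto
    then show False using rigid_nontrivial[OF rep rig] by blast
  qed
  then obtain j0 where j0: "j0 \<in> J" by blast
  have "\<forall>j\<in>J. \<exists>U. clinear_op U \<and> (\<forall>x y. cinner (blinfun_apply U x) (blinfun_apply U y) = cinner x y) \<and>
      blinfun_apply U (ket tg_one) = \<zeta> j \<and>
      (\<forall>i. S i o\<^sub>L U = U o\<^sub>L left_regular_E \<theta> i) \<and> (\<forall>k. T k o\<^sub>L U = U o\<^sub>L left_regular_F \<theta> k)"
    using assms(5) by (intro ballI wandering_isometry[OF \<theta> rep]) blast
  from bchoice[OF this] obtain U where "\<forall>j\<in>J. clinear_op (U j) \<and>
      (\<forall>x y. cinner (blinfun_apply (U j) x) (blinfun_apply (U j) y) = cinner x y) \<and>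
      blinfun_apply (U j) (ket tg_one) = \<zeta> j \<and>
      (\<forall>i. S i o\<^sub>L U j = U j o\<^sub>L left_regular_E \<theta> i) \<and> (\<forall>k. T k o\<^sub>L U j = U j o\<^sub>L left_regular_F \<theta> k)" ..
  then have U: "\<And>j. j \<in> J \<Longrightarrow> clinear_op (U j)"
    "\<And>j x y. j \<in> J \<Longrightarrow> cinner (blinfun_apply (U j) x) (blinfun_apply (U j) y) = cinner x y"
    "\<And>j. j \<in> J \<Longrightarrow> blinfun_apply (U j) (ket tg_one) = \<zeta> j"
    "\<And>j i. j \<in> J \<Longrightarrow> S i o\<^sub>L U j = U j o\<^sub>L left_regular_E \<theta> i"
    "\<And>j k. j \<in> J \<Longrightarrow> T k o\<^sub>L U j = U j o\<^sub>L left_regular_F \<theta> k"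
    by simp_all
  interpret intertwined_rep \<theta> S T J U j0
    by unfold_locales (simp_all add: \<theta> isometric_representation_clinear[OF rep] j0 U)
  interpret total_intertwined_rep \<theta> S T J U j0
  proof
    show "matrix_norm k (\<lambda>i j. cesaro S T N (b i j))
      = matrix_norm k (\<lambda>i j. cesaro (left_regular_E \<theta>) (left_regular_F \<theta>) N (b i j))" for k N b
      by (rule rigid_matrix_norm_cesaro[OF rep rig])
    fix X :: "'h set" assume X: "closed_csubspace X" and UX: "\<And>j x. j \<in> J \<Longrightarrow> blinfun_apply (U j) x \<in> X"
    show "X = UNIV"
    proof (rule join[OF X])
      fix j assume j: "j \<in> J"
      \<comment> \<open>\<open>\<zeta> j\<close> is the image of \<open>ket tg_one\<close>, so its
        orbit under the algebra stays in the range of \<open>U j\<close>.\<close>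
      have "blinfun_apply A (\<zeta> j) \<in> X" if "A \<in> two_graph_alg S T" for A
        using compress_intertwines[OF that j, of "ket tg_one"] UX[OF j] by (simp add: U(3)[OF j])
      then show "?M j \<subseteq> X"
        unfolding cyclic_subspace_def using X by (intro closure_minimal) (auto simp: closed_csubspace_def)
    qed
  qed
  show ?thesis
    using analytic_isomorphism_compress completely_isometric_compress unfolding analytic_def by blast
qed

end
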